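(* Suppose $\mathbb{P}_{\pi}(A_1=0)=0$ and $\mathbb{P}_{\pi}(B_1=0)<1$. Then the following conditions are equivalent (where "for some/all $i$" means that the version with "for some $i\in\mathcal{S}$" and the version with "for all $i\in\mathcal{S}$" may both be used): (a) $\lim_{n\to\infty}\Psi_{1:n}(0)=Z_\infty=\sum_{n\ge 1}\Pi_{n-1}B_n$ a.s. and $Z_\infty$ is a proper (a.s. finite) random variable. (b) $\lim_{n\to\infty}\Pi_{\tau_n(i)}=0$ a.s. and $\mathbb{E}_i J_i(\log^+ W^i)<\infty$ for some/all $i\in\mathcal{S}$. (c) $\mathbb{P}_i(|\Pi_{\tau(i)}|=1)<1$ for some/all $i\in\mathcal{S}$, and $\limsup_{n\to\infty}|\Pi_{n-1}B_n|<\infty$ a.s. (d) $\lim_{n\to\infty}\Pi_{n-1}B_n=0$ a.s. (e) $\sum_{n\ge 1}|\Pi_{n-1}B_n|<\infty$ a.s. Furthermore, $\Psi_{1:n}(Z_0)$ converges a.s. to a proper random variable for any admissible $Z_0$ if and only if $\lim_{n\to\infty}\Pi_n=0$ a.s. and $\mathbb{E}_iJ_i(\log^+W^i)<\infty$ for some/all $i\in\mathcal{S}$. In this case, the limit always equals $Z_\infty$.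
   Context: Setting: $(M_n)_{n\ge0}$ is an ergodic (irreducible, positive recurrent, aperiodic) Markov chain on a countable state space $\mathcal{S}$ with transition matrix $(p_{ij})_{i,j\in\mathcal S}$ and unique stationary law $\pi=(\pi_i)_{i\in\mathcal S}$. $(A_n,B_n)_{n\ge1}$ is a sequence of $\mathbb{R}^2$-valued random vectors modulated by $(M_n)_{n\ge0}$: given the whole sequence $(M_n)_{n\ge0}$, the $(A_n,B_n)$ are conditionally independent, and the conditional law of $(A_n,B_n)$ depends only on $(M_{n-1},M_n)$ and not on $n$, i.e. $\mathbb{P}((A_n,B_n)\in\cdot\,|M_{n-1}=i,M_n=j)=K_{ij}$ for a stochastic kernel $K$ from $\mathcal S^2$ to $\mathbb R^2$. Write $\mathbb{P}_i=\mathbb{P}(\cdot|M_0=i)$, $\mathbb{P}_\pi=\sum_i\pi_i\mathbb{P}_i$, with expectations $\mathbb{E}_i,\mathbb{E}_\pi$; "a.s." without qualifier means $\mathbb{P}_\pi$-a.s. (equivalently $\mathbb P_i$-a.s. for all $i$). Notation: $\Psi_n(x)=A_nx+B_n$; $\Psi_{1:n}=\Psi_1\circ\cdots\circ\Psi_n$ (backward iterations); $\Pi_0=1$, $\Pi_n=A_1\cdots A_n$; so $\Psi_{1:n}(x)=\Pi_nx+\sum_{k=1}^n\Pi_{k-1}B_k$. $S_n=-\log|\Pi_n|$. For $i\in\mathcal S$: $\tau_0(i)=0$, $\tau_n(i)=\inf\{k>\tau_{n-1}(i):M_k=i\}$, $\tau(i)=\tau_1(i)$. $W^i=\max_{1\le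 k\le\tau(i)}|\Pi_{k-1}B_k|$. $J_i(0)=1$ and, for $x>0$, $J_i(x)=x/\mathbb{E}_i(S_{\tau(i)}^+\wedge x)$ if $\mathbb{P}_i(S_{\tau(i)}\le0)<1$, and $J_i(x)=x$ otherwise. $\log^+0=0$. A random variable $Z_0$ is called admissible if $Z_0$ and $(M_n,A_n,B_n)_{n\ge1}$ are conditionally independent given $M_0$. *)

theory Defs
  imports "HOL-Probability.Probability"
begin

section \<open>Ergodic Markov chains on a countable state space\<close>

text \<open>A transition matrix is a family \<open>p\<close> of probability mass functions,
  \<open>p\<^sub>i\<^sub>j = pmf (p i) j\<close>; \<open>pmf (nstep p n i) j\<close> is the \<open>(i,j)\<close> entry of its \<open>n\<close>-th power.\<close>

primrec nstep :: "('s \<Rightarrow> 's pmf) \<Rightarrow> nat \<Rightarrow> 's \<Rightarrow> 's pmf" where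
  "nstep p 0 i = return_pmf i"
| "nstep p (Suc n) i = bind_pmf (nstep p n i) p"

definition irreducible_chain :: "('s \<Rightarrow> 's pmf) \<Rightarrow> bool" where
  "irreducible_chain p \<longleftrightarrow> (\<forall>i j. \<exists>n. pmf (nstep p n i) j > 0)"

definition aperiodic_chain :: "('s \<Rightarrow> 's pmf) \<Rightarrow> bool" where
  "aperiodic_chain p \<longleftrightarrow> (\<forall>i. Gcd {n. n > 0 \<and> pmf (nstep p n i) i > 0} = (1::nat))"

text \<open>Successive return times; \<open>Inf {} = \<infinity>\<close> covers paths without a further visit to \<open>i\<close>.\<close>

primrec tau :: "(nat \<Rightarrow> 'w \<Rightarrow> 's) \<Rightarrow> 's \<Rightarrow> nat \<Rightarrow> 'w \<Rightarrow> enat" where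
  "tau M i 0 \<omega> = 0"
| "tau M i (Suc n) \<omega> = Inf {enat k | k. enat k > tau M i n \<omega> \<and> M k \<omega> = i}"

definition positive_recurrent_chain :: "('s \<Rightarrow> 'w measure) \<Rightarrow> (nat \<Rightarrow> 'w \<Rightarrow> 's) \<Rightarrow> bool" where
  "positive_recurrent_chain P M \<longleftrightarrow>
     (\<forall>i. (\<integral>\<^sup>+ \<omega>. ennreal_of_enat (tau M i 1 \<omega>) \<partial>P i) < \<infinity>)"

definition path_algebra :: "'w measure \<Rightarrow> (nat \<Rightarrow> 'w \<Rightarrow> 's) \<Rightarrow> 'w measure" where
  "path_algebra N M =
     vimage_algebra (space N) (\<lambda>\<omega> n. M n \<omega>) (PiM UNIV (\<lambda>_. count_space UNIV))"

section \<open>Markov-modulated sequences\<close>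

text \<open>\<open>N\<close> carries the underlying measurable space (its measure plays no role) and \<open>P i\<close> is the
  law given \<open>M 0 = i\<close>. The vectors \<open>(A n, B n)\<close> are indexed by \<open>n \<ge> 1\<close>; the values \<open>A 0\<close> and
  \<open>B 0\<close> are junk. The last assumption says that, given the whole sequence \<open>M\<close>, the \<open>(A n, B n)\<close>
  are independent with laws \<open>K (M (n - 1)) (M n)\<close>.\<close>

locale markov_modulated =
  fixes N :: "'w measure"
    and P :: "'s::countable \<Rightarrow> 'w measure"
    and M :: "nat \<Rightarrow> 'w \<Rightarrow> 's"
    and A B :: "nat \<Rightarrow> 'w \<Rightarrow> real"
    and p :: "'s \<Rightarrow> 's pmf"
    and K :: "'s \<Rightarrow> 's \<Rightarrow> (real \<times> real) measure"
    and \<pi> :: "'s pmf"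
  assumes prob_space_P: "\<And>i. prob_space (P i)"
    and sets_P: "\<And>i. sets (P i) = sets N"
    and measurable_M: "\<And>n. M n \<in> N \<rightarrow>\<^sub>M count_space UNIV"
    and measurable_A: "\<And>n. n \<ge> 1 \<Longrightarrow> A n \<in> borel_measurable N"
    and measurable_B: "\<And>n. n \<ge> 1 \<Longrightarrow> B n \<in> borel_measurable N"
    and initial_state: "\<And>i. AE \<omega> in P i. M 0 \<omega> = i"
    and markov_property: "\<And>i n x.
      measure (P i) {\<omega> \<in> space N. \<forall>k\<le>Suc n. M k \<omega> = x k} =
      measure (P i) {\<omega> \<in> space N. \<forall>k\<le>n. M k \<omega> = x k} * pmf (p (x n)) (x (Suc n))"
    and irreducible: "irreducible_chain p"
    and aperiodic: "aperiodic_chain p"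
    and positive_recurrent: "positive_recurrent_chain P M"
    and stationary: "bind_pmf \<pi> p = \<pi>"
    and prob_space_K: "\<And>i j. prob_space (K i j)"
    and sets_K: "\<And>i j. sets (K i j) = sets borel"
    and modulated: "\<And>i n D. (\<And>k. D k \<in> sets borel) \<Longrightarrow>
      AE \<omega> in P i.
        real_cond_exp (P i) (path_algebra N M)
          (indicator {\<omega> \<in> space N. \<forall>k\<in>{1..n}. (A k \<omega>, B k \<omega>) \<in> D k}) \<omega> =
        (\<Prod>k=1..n. measure (K (M (k - 1) \<omega>) (M k \<omega>)) (D k))"

text \<open>The mixture \<open>\<Sum>\<^sub>i \<pi>\<^sub>i P\<^sub>i\<close>.\<close>

definition P_mix :: "'s pmf \<Rightarrow> ('s \<Rightarrow> 'w measure) \<Rightarrow> 'w measure" where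
  "P_mix \<pi> P = measure_pmf \<pi> \<bind> P"

section \<open>Backward iterations and associated quantities\<close>

definition Psi :: "(nat \<Rightarrow> 'w \<Rightarrow> real) \<Rightarrow> (nat \<Rightarrow> 'w \<Rightarrow> real) \<Rightarrow> nat \<Rightarrow> 'w \<Rightarrow> real \<Rightarrow> real" where
  "Psi A B n \<omega> x = A n \<omega> * x + B n \<omega>"

primrec Psi_back ::
    "(nat \<Rightarrow> 'w \<Rightarrow> real) \<Rightarrow> (nat \<Rightarrow> 'w \<Rightarrow> real) \<Rightarrow> nat \<Rightarrow> 'w \<Rightarrow> real \<Rightarrow> real" where
  "Psi_back A B 0 \<omega> = id"
| "Psi_back A B (Suc n) \<omega> = Psi_back A B n \<omega> \<circ> Psi A B (Suc n) \<omega>"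

definition Prd :: "(nat \<Rightarrow> 'w \<Rightarrow> real) \<Rightarrow> nat \<Rightarrow> 'w \<Rightarrow> real" where
  "Prd A n \<omega> = (\<Prod>k=1..n. A k \<omega>)"

text \<open>The perpetuity terms, indexed from \<open>n = 0\<close>: \<open>perp_term A B n\<close> is \<open>\<Pi>\<^sub>n B\<^sub>n\<^sub>+\<^sub>1\<close>.\<close>

definition perp_term :: "(nat \<Rightarrow> 'w \<Rightarrow> real) \<Rightarrow> (nat \<Rightarrow> 'w \<Rightarrow> real) \<Rightarrow> nat \<Rightarrow> 'w \<Rightarrow> real" where
  "perp_term A B n \<omega> = Prd A n \<omega> * B (Suc n) \<omega>"

definition Z_inf :: "(nat \<Rightarrow> 'w \<Rightarrow> real) \<Rightarrow> (nat \<Rightarrow> 'w \<Rightarrow> real) \<Rightarrow> 'w \<Rightarrow> real" where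
  "Z_inf A B \<omega> = (\<Sum>n. perp_term A B n \<omega>)"

text \<open>\<open>\<Pi>\<close> at the \<open>n\<close>-th return time to \<open>i\<close>, arbitrary on the null event that this time is infinite.
  The same applies to the quantities below.\<close>

definition Prd_ret ::
    "(nat \<Rightarrow> 'w \<Rightarrow> 's) \<Rightarrow> (nat \<Rightarrow> 'w \<Rightarrow> real) \<Rightarrow> 's \<Rightarrow> nat \<Rightarrow> 'w \<Rightarrow> real" where
  "Prd_ret M A i n \<omega> = Prd A (the_enat (tau M i n \<omega>)) \<omega>"

definition S_ret :: "(nat \<Rightarrow> 'w \<Rightarrow> 's) \<Rightarrow> (nat \<Rightarrow> 'w \<Rightarrow> real) \<Rightarrow> 's \<Rightarrow> 'w \<Rightarrow> real" where
  "S_ret M A i \<omega> = - ln \<bar>Prd_ret M A i 1 \<omega>\<bar>"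

definition W :: "(nat \<Rightarrow> 'w \<Rightarrow> 's) \<Rightarrow> (nat \<Rightarrow> 'w \<Rightarrow> real) \<Rightarrow> (nat \<Rightarrow> 'w \<Rightarrow> real) \<Rightarrow> 's \<Rightarrow> 'w \<Rightarrow> real" where
  "W M A B i \<omega> = Max {\<bar>Prd A (k - 1) \<omega> * B k \<omega>\<bar> | k. 1 \<le> k \<and> enat k \<le> tau M i 1 \<omega>}"

definition log_plus :: "real \<Rightarrow> real" where
  "log_plus x = (if x = 0 then 0 else max 0 (ln x))"

definition J :: "('s \<Rightarrow> 'w measure) \<Rightarrow> (nat \<Rightarrow> 'w \<Rightarrow> 's) \<Rightarrow> (nat \<Rightarrow> 'w \<Rightarrow> real) \<Rightarrow> 's \<Rightarrow> real \<Rightarrow> real" where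
  "J P M A i x =
     (if x = 0 then 1
      else if measure (P i) {\<omega> \<in> space (P i). S_ret M A i \<omega> \<le> 0} < 1
      then x / (\<integral>\<omega>. min (max (S_ret M A i \<omega>) 0) x \<partial>P i)
      else x)"

definition J_moment ::
    "('s \<Rightarrow> 'w measure) \<Rightarrow> (nat \<Rightarrow> 'w \<Rightarrow> 's) \<Rightarrow> (nat \<Rightarrow> 'w \<Rightarrow> real) \<Rightarrow> (nat \<Rightarrow> 'w \<Rightarrow> real) \<Rightarrow> 's \<Rightarrow> ennreal" where
  "J_moment P M A B i = (\<integral>\<^sup>+ \<omega>. ennreal (J P M A i (log_plus (W M A B i \<omega>))) \<partial>P i)"

text \<open>Conditional independence given the discrete variable \<open>M 0\<close> is independence under every \<open>P i\<close>.\<close>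

definition admissible ::
    "'w measure \<Rightarrow> ('s \<Rightarrow> 'w measure) \<Rightarrow> (nat \<Rightarrow> 'w \<Rightarrow> 's) \<Rightarrow> (nat \<Rightarrow> 'w \<Rightarrow> real) \<Rightarrow> (nat \<Rightarrow> 'w \<Rightarrow> real)
      \<Rightarrow> ('w \<Rightarrow> real) \<Rightarrow> bool" where
  "admissible N P M A B Z0 \<longleftrightarrow>
     Z0 \<in> borel_measurable N \<and>
     (\<forall>i. prob_space.indep_set (P i)
        (sets (vimage_algebra (space N) Z0 borel))
        (sets (vimage_algebra (space N) (\<lambda>\<omega> n. (M (Suc n) \<omega>, A (Suc n) \<omega>, B (Suc n) \<omega>))
           (PiM UNIV (\<lambda>_. count_space UNIV \<Otimes>\<^sub>M (borel \<Otimes>\<^sub>M borel))))))"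

end

(*
  Cut at the successive returns to a state i, the modulated sequence becomes an i.i.d. sequence of
  blocks. With X = -ln |product of A over a block|, Y = log+ of the largest perpetuity term in a
  block, S_n and T_n the partial sums of X and of its positive part, everything reduces to comparing
  Y_{n+1} with S_n.

  Necessity: if Y_{n+1} - S_n, hence Y_{n+1} - T_n, is bounded above, decompose at the last time
  where Y_{n+1} - T_n exceeds a large constant c. The T-increments are nonnegative, so the sum over n
  of P(Y_{n+1} > T_n + c) is finite; its summands integrate the renewal function of T against the
  law of Y, and that function is at least J.

  Sufficiency: if S_n tends to infinity, restart at the time of the overall minimum. It then suffices
  to sum P(Y_{n+1} > S_n, S_k >= 0 for k <= n) over n. By time reversal the second event becomes
  "n is a record time of S". The running maximum absorbs the positive part of every increment taken
  at a record time, so the expected number of records with S_n <= y is at most 2 J(y).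

  The block length has finite mean, so passing from the block maximum to the sum over a block only
  adds an integrable term.
*)
theory Submission
  imports Defs
begin

section \<open>Independent and identically distributed sequences\<close>

text \<open>No moment of X is assumed: both parts of X may have infinite mean, so the law of large
  numbers yields no drift. Divergence of S_n is drawn from the almost sure hypotheses instead: a
  walk that keeps returning below a fixed level would break the bound on the terms. Under (d), block
  products of modulus one have to be excluded beforehand: the i.i.d. block maxima would then exceed
  a fixed positive level infinitely often, undamped.

  T enters necessity because S \<le> T weakens the bound to one for a walk whose restarts lie below
  the original. Sufficiency has to keep S, since Y < T says nothing about S.

  The conditional expectations in the hypotheses are used once, to identify the law of the sequence
  of marks (M_n, A_n, B_n) for each initial state. Sequences can be shifted, so the Markov property
  becomes an identity of integrals, and independence of blocks follows from it.

  The versions for some and for all states meet in (e), which mentions no state: the first passage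
  from j to i only adds finitely many terms and a constant factor.\<close>

definition psum :: "(nat \<Rightarrow> real \<times> real) \<Rightarrow> nat \<Rightarrow> real" where
  "psum x n = (\<Sum>k<n. fst (x k))"

definition psum_pos :: "(nat \<Rightarrow> real \<times> real) \<Rightarrow> nat \<Rightarrow> real" where
  "psum_pos x n = (\<Sum>k<n. max 0 (fst (x k)))"

definition drop_seq :: "nat \<Rightarrow> (nat \<Rightarrow> 'e) \<Rightarrow> nat \<Rightarrow> 'e" where
  "drop_seq m x = (\<lambda>k. x (m + k))"

definition reverse_prefix :: "nat \<Rightarrow> (nat \<Rightarrow> 'e) \<Rightarrow> nat \<Rightarrow> 'e" where
  "reverse_prefix n x = (\<lambda>k. x (if k < n then n - Suc k else k))"

lemma drop_seq_apply: "drop_seq m x k = x (m + k)"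
  by (simp add: drop_seq_def)

lemma drop_seq_comb_seq [simp]: "drop_seq n (comb_seq n x y) = y"
  by (auto simp: drop_seq_def comb_seq_def)

lemma drop_seq_0 [simp]: "drop_seq 0 x = x"
  by (simp add: drop_seq_def)

lemma psum_0 [simp]: "psum x 0 = 0" and psum_Suc: "psum x (Suc n) = psum x n + fst (x n)"
  by (simp_all add: psum_def)

lemma psum_pos_0 [simp]: "psum_pos x 0 = 0"
  and psum_pos_Suc: "psum_pos x (Suc n) = psum_pos x n + max 0 (fst (x n))"
  by (simp_all add: psum_pos_def)

lemma psum_drop_seq: "psum (drop_seq m x) n = psum x (m + n) - psum x m"
  by (induction n) (simp_all add: psum_Suc drop_seq_def)

lemma psum_pos_drop_seq: "psum_pos (drop_seq m x) n = psum_pos x (m + n) - psum_pos x m"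
  by (induction n) (simp_all add: psum_pos_Suc drop_seq_def)

lemma psum_pos_mono: "m \<le> n \<Longrightarrow> psum_pos x m \<le> psum_pos x n"
  unfolding psum_pos_def by (rule sum_mono2) auto

lemma psum_le_psum_pos: "psum x n \<le> psum_pos x n"
  unfolding psum_def psum_pos_def by (rule sum_mono) auto

lemma psum_comb_seq: "m \<le> n \<Longrightarrow> psum (comb_seq n x y) m = psum x m"
  by (simp add: psum_def comb_seq_def)

lemma psum_pos_comb_seq: "m \<le> n \<Longrightarrow> psum_pos (comb_seq n x y) m = psum_pos x m"
  by (simp add: psum_pos_def comb_seq_def)

lemma psum_reverse_prefix: "k \<le> n \<Longrightarrow> psum (reverse_prefix n x) k = psum x n - psum x (n - k)"
proof (induction k)
  case (Suc k)
  have "n - k = Suc (n - Suc k)" using Suc.prems by simp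
  then show ?case using Suc by (simp add: psum_Suc reverse_prefix_def)
qed simp

section \<open>Measurability and uniqueness of measures on sequence spaces\<close>

lemma measurable_seq_of_components:
  assumes "\<And>k. (\<lambda>w. f w k) \<in> L \<rightarrow>\<^sub>M E"
  shows "f \<in> L \<rightarrow>\<^sub>M (\<Pi>\<^sub>M k\<in>UNIV. E)"
  by (rule measurable_PiM_single') (use assms in \<open>auto dest: measurable_space\<close>)

text \<open>Cylinders over a finite index set are reduced to cylinders over an initial segment by
  filling the missing coordinates with the whole space.\<close>

lemma measure_eqI_rectangles:
  assumes "finite_measure M1" "sets M1 = sets (\<Pi>\<^sub>M k\<in>(UNIV :: nat set). E)" "sets M2 = sets (\<Pi>\<^sub>M k\<in>(UNIV :: nat set). E)"
    and eq: "\<And>n D. (\<And>k. D k \<in> sets E) \<Longrightarrow>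
      emeasure M1 {x \<in> space (\<Pi>\<^sub>M k\<in>(UNIV :: nat set). E). \<forall>k<n. x k \<in> D k}
      = emeasure M2 {x \<in> space (\<Pi>\<^sub>M k\<in>(UNIV :: nat set). E). \<forall>k<n. x k \<in> D k}"
  shows "M1 = M2"
proof (rule measure_eqI_PiM_infinite[OF assms(2,3) _ assms(1)])
  fix C and J :: "nat set"
  assume J: "finite J" "\<And>k. k \<in> J \<Longrightarrow> C k \<in> sets E"
  obtain n where n: "J \<subseteq> {..<n}" using J(1) by (meson finite_nat_iff_bounded)
  define D where "D k = (if k \<in> J then C k else space E)" for k
  have "D k \<in> sets E" for k using J(2) by (auto simp: D_def)
  moreover have "prod_emb UNIV (\<lambda>_. E) J (Pi\<^sub>E J C) = {x \<in> space (\<Pi>\<^sub>M k\<in>UNIV. E). \<forall>k<n. x k \<in> D k}"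
    using n by (auto simp: prod_emb_def PiE_iff D_def space_PiM subset_iff)
  ultimately show "emeasure M1 (prod_emb UNIV (\<lambda>_. E) J (Pi\<^sub>E J C)) = emeasure M2 (prod_emb UNIV (\<lambda>_. E) J (Pi\<^sub>E J C))"
    using eq by simp
qed

lemma measurable_drop_seq [measurable]: "drop_seq m \<in> (\<Pi>\<^sub>M k\<in>UNIV. E) \<rightarrow>\<^sub>M (\<Pi>\<^sub>M k\<in>UNIV. E)"
  by (rule measurable_seq_of_components) (simp add: drop_seq_def)

lemma measurable_drop_seq' [measurable (raw)]:
  "f \<in> L \<rightarrow>\<^sub>M (\<Pi>\<^sub>M k\<in>UNIV. E) \<Longrightarrow> (\<lambda>w. drop_seq m (f w)) \<in> L \<rightarrow>\<^sub>M (\<Pi>\<^sub>M k\<in>UNIV. E)"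
  by (rule measurable_compose[OF _ measurable_drop_seq])

section \<open>Past and future of an i.i.d. sequence\<close>

context sequence_space
begin

text \<open>Coordinates selected without repetition are again i.i.d. The two instances used are the
  shift and the reversal of a prefix.\<close>

lemma distr_reindex_seq:
  assumes "inj f"
  shows "distr S S (\<lambda>x k. x (f k)) = S"
  using distr_PiM_reindex[of UNIV "\<lambda>_. M" f UNIV] assms M.prob_space_axioms
  by (simp add: restrict_UNIV)

lemma nn_integral_comb_seq:
  assumes [measurable]: "f \<in> borel_measurable S"
  shows "(\<integral>\<^sup>+x. f x \<partial>S) = (\<integral>\<^sup>+x. \<integral>\<^sup>+y. f (comb_seq n x y) \<partial>S \<partial>S)"
proof -
  have "(\<integral>\<^sup>+x. f x \<partial>S) = (\<integral>\<^sup>+x. f x \<partial>distr (S \<Otimes>\<^sub>M S) S (\<lambda>(x, y). comb_seq n x y))"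
    by (simp only: PiM_comb_seq)
  also have "\<dots> = (\<integral>\<^sup>+z. f (comb_seq n (fst z) (snd z)) \<partial>(S \<Otimes>\<^sub>M S))"
    by (subst nn_integral_distr) (auto simp: split_beta)
  also have "\<dots> = (\<integral>\<^sup>+x. \<integral>\<^sup>+y. f (comb_seq n x y) \<partial>S \<partial>S)"
    by (subst P.nn_integral_fst[symmetric]) auto
  finally show ?thesis .
qed

lemma nn_integral_component:
  "f \<in> borel_measurable M \<Longrightarrow> (\<integral>\<^sup>+x. f (x k) \<partial>S) = (\<integral>\<^sup>+z. f z \<partial>M)"
  using nn_integral_distr[of "\<lambda>x. x k" S M f] distr_PiM_component[of UNIV "\<lambda>_. M" k]
    M.prob_space_axioms by simp

text \<open>\<open>F\<close> may only look at the first \<open>n\<close> entries of its argument, which are independent of entry \<open>n\<close>.\<close>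

lemma nn_integral_prefix_next:
  assumes F [measurable]: "F \<in> borel_measurable (S \<Otimes>\<^sub>M M)"
    and F_prefix: "\<And>x y z. F (comb_seq n x y, z) = F (x, z)"
  shows "(\<integral>\<^sup>+x. F (x, x n) \<partial>S) = (\<integral>\<^sup>+x. \<integral>\<^sup>+z. F (x, z) \<partial>M \<partial>S)"
proof -
  have "(\<integral>\<^sup>+x. F (x, x n) \<partial>S) = (\<integral>\<^sup>+x. \<integral>\<^sup>+y. F (x, y 0) \<partial>S \<partial>S)"
    by (subst nn_integral_comb_seq[where n = n]) (simp_all add: F_prefix comb_seq_def)
  also have "\<dots> = (\<integral>\<^sup>+x. \<integral>\<^sup>+z. F (x, z) \<partial>M \<partial>S)"
    by (intro nn_integral_cong nn_integral_component) measurable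
  finally show ?thesis .
qed

lemma nn_integral_prefix_suffix:
  assumes [measurable]: "F \<in> borel_measurable S" "G \<in> borel_measurable S"
    and F_prefix: "\<And>x y. F (comb_seq n x y) = F x"
  shows "(\<integral>\<^sup>+x. F x * G (drop_seq n x) \<partial>S) = (\<integral>\<^sup>+x. F x \<partial>S) * (\<integral>\<^sup>+x. G x \<partial>S)"
  by (subst nn_integral_comb_seq[where n = n])
    (simp_all add: F_prefix nn_integral_cmult nn_integral_multc)

lemma suminf_le_of_window:
  fixes f :: "nat \<Rightarrow> ennreal"
  assumes "\<And>n. f n \<le> 1" and window: "\<And>m n. f m \<noteq> 0 \<Longrightarrow> f n \<noteq> 0 \<Longrightarrow> m \<le> n \<Longrightarrow> n \<le> m + k"
  shows "(\<Sum>n. f n) \<le> of_nat (Suc k)"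
proof (cases "\<exists>n. f n \<noteq> 0")
  case True
  define m where "m = (LEAST n. f n \<noteq> 0)"
  have m: "f m \<noteq> 0" using LeastI_ex[OF True] by (simp add: m_def)
  have "(\<Sum>n. f n) = (\<Sum>n\<in>{m..m + k}. f n)"
  proof (rule suminf_finite)
    fix n assume n: "n \<notin> {m..m + k}"
    show "f n = 0"
    proof (rule ccontr)
      assume *: "f n \<noteq> 0"
      then have "m \<le> n" unfolding m_def by (rule Least_le)
      then show False using window[OF m *] n by simp
    qed
  qed simp
  also have "\<dots> \<le> (\<Sum>n\<in>{m..m + k}. 1)" by (rule sum_mono) (rule assms(1))
  finally show ?thesis by simp
next
  case False
  then have "f = (\<lambda>_. 0)" by auto
  then show ?thesis by simp
qed

text \<open>\<open>E n\<close> depends on the first \<open>r n\<close> entries, and if it is followed by the independent event \<open>V\<close> it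
  can recur only within the next \<open>k\<close> indices.\<close>

lemma sum_emeasure_prefix_finite:
  fixes V :: "(nat \<Rightarrow> 'a) \<Rightarrow> ennreal"
  assumes E [measurable]: "\<And>n. E n \<in> sets S" and V [measurable]: "V \<in> borel_measurable S"
    and V_le: "\<And>x. V x \<le> 1" and V_pos: "(\<integral>\<^sup>+x. V x \<partial>S) \<noteq> 0"
    and prefix: "\<And>n x y. comb_seq (r n) x y \<in> E n \<longleftrightarrow> x \<in> E n"
    and window: "\<And>x m n. x \<in> E m \<Longrightarrow> V (drop_seq (r m) x) \<noteq> 0 \<Longrightarrow> x \<in> E n \<Longrightarrow> m \<le> n \<Longrightarrow> n \<le> m + k"
  shows "(\<Sum>n. emeasure S (E n)) < \<infinity>"
proof -
  let ?f = "\<lambda>n x. indicator (E n) x * V (drop_seq (r n) x)"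
  have "(\<integral>\<^sup>+x. ?f n x \<partial>S) = emeasure S (E n) * (\<integral>\<^sup>+x. V x \<partial>S)" for n
    by (subst nn_integral_prefix_suffix) (simp_all add: indicator_def prefix)
  \<comment> \<open>The factor turns the sum of probabilities into the mean, weighted by V, of the
    number of n at which \<open>E n\<close> is followed by V. Pathwise this number is at most
    \<open>Suc k\<close>.\<close>
  then have "(\<Sum>n. emeasure S (E n)) * (\<integral>\<^sup>+x. V x \<partial>S) = (\<Sum>n. \<integral>\<^sup>+x. ?f n x \<partial>S)" by simp
  also have "\<dots> = (\<integral>\<^sup>+x. (\<Sum>n. ?f n x) \<partial>S)"
    by (rule nn_integral_suminf[symmetric]) measurable
  also have "\<dots> \<le> (\<integral>\<^sup>+x. of_nat (Suc k) \<partial>S)"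
  proof (rule nn_integral_mono, rule suminf_le_of_window)
    show "?f n x \<le> 1" for n x by (simp add: V_le split: split_indicator)
    show "?f m x \<noteq> 0 \<Longrightarrow> ?f n x \<noteq> 0 \<Longrightarrow> m \<le> n \<Longrightarrow> n \<le> m + k" for m n x
      using window[of x m n] by (auto split: split_indicator_asm)
  qed
  also have "\<dots> < \<infinity>" by (simp add: P.emeasure_space_1[simplified] of_nat_less_top del: of_nat_Suc)
  finally show ?thesis using V_pos by (auto simp: ennreal_mult_less_top)
qed

lemma AE_drop_seq: "AE x in S. F x \<Longrightarrow> AE x in S. F (drop_seq n x)"
proof -
  have "distr S S (drop_seq n) = S"
    using distr_reindex_seq[of "\<lambda>k. n + k"] by (simp add: drop_seq_def[abs_def] inj_def)
  then show "AE x in S. F x \<Longrightarrow> AE x in S. F (drop_seq n x)"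
    using AE_distrD[where f = "drop_seq n" and M = S and M' = S and P = F]
    by (metis measurable_drop_seq)
qed

lemma nn_integral_prod_prefix:
  assumes [measurable]: "g \<in> borel_measurable M"
  shows "(\<integral>\<^sup>+x. (\<Prod>k<n. g (x k)) \<partial>S) = (\<integral>\<^sup>+z. g z \<partial>M) ^ n"
proof (induction n)
  case 0
  then show ?case by (simp add: P.emeasure_space_1)
next
  case (Suc n)
  have "(\<integral>\<^sup>+x. (\<Prod>k<Suc n. g (x k)) \<partial>S) = (\<integral>\<^sup>+x. (\<lambda>(x, z). (\<Prod>k<n. g (x k)) * g z) (x, x n) \<partial>S)"
    by simp
  also have "\<dots> = (\<integral>\<^sup>+x. \<integral>\<^sup>+z. (\<lambda>(x, z). (\<Prod>k<n. g (x k)) * g z) (x, z) \<partial>M \<partial>S)"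
    by (rule nn_integral_prefix_next) (simp_all add: comb_seq_def)
  also have "\<dots> = (\<integral>\<^sup>+z. g z \<partial>M) ^ Suc n"
    by (simp add: nn_integral_cmult nn_integral_multc Suc mult.commute)
  finally show ?case .
qed

text \<open>Laplace transform argument: by independence the means of \<open>exp (- sum)\<close> form
  a geometric series whose ratio \<open>\<rho>\<close> is below 1 because f is not almost surely 0.
  So the series of these exponentials converges almost surely, its terms tend to 0, and the sums
  diverge.\<close>

lemma AE_filterlim_sum_at_top:
  fixes f :: "'a \<Rightarrow> real"
  assumes [measurable]: "f \<in> borel_measurable M"
    and nonneg: "AE z in M. 0 \<le> f z" and nonzero: "\<not> (AE z in M. f z = 0)"
  shows "AE x in S. filterlim (\<lambda>n. \<Sum>k<n. f (x k)) at_top sequentially"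
proof -
  define \<rho> where "\<rho> = (\<integral>\<^sup>+z. ennreal (exp (- f z)) \<partial>M)"
  have "\<rho> < 1"
  proof -
    have "\<rho> \<le> (\<integral>\<^sup>+z. 1 \<partial>M)"
      unfolding \<rho>_def by (rule nn_integral_mono_AE) (use nonneg in eventually_elim, simp)
    then have le: "\<rho> \<le> 1" by (simp add: M.emeasure_space_1)
    have "\<rho> \<noteq> 1"
    proof
      assume eq: "\<rho> = 1"
      have "(\<integral>\<^sup>+z. 1 - ennreal (exp (- f z)) \<partial>M) = (\<integral>\<^sup>+z. 1 \<partial>M) - \<rho>"
        unfolding \<rho>_def
        by (rule nn_integral_diff) (use nonneg le in \<open>auto simp: \<rho>_def less_top[symmetric] top_unique\<close>)
      also have "\<dots> = 0" by (simp add: eq M.emeasure_space_1)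
      finally have "AE z in M. 1 - ennreal (exp (- f z)) = 0"
        by (subst (asm) nn_integral_0_iff_AE) auto
      then have "AE z in M. f z = 0"
        using nonneg
        by eventually_elim (auto simp: ennreal_1[symmetric] ennreal_minus simp del: ennreal_1)
      then show False using nonzero by simp
    qed
    then show ?thesis using le by simp
  qed
  have "(\<integral>\<^sup>+x. (\<Sum>n. ennreal (exp (- (\<Sum>k<n. f (x k))))) \<partial>S)
      = (\<Sum>n. \<integral>\<^sup>+x. (\<Prod>k<n. ennreal (exp (- f (x k)))) \<partial>S)"
    by (subst nn_integral_suminf)
      (simp_all add: prod_ennreal exp_sum[symmetric] sum_negf)
  also have "\<dots> = (\<Sum>n. \<rho> ^ n)"
    unfolding \<rho>_def by (intro suminf_cong nn_integral_prod_prefix) measurable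
  also have "\<dots> < \<infinity>"
  proof -
    obtain r where r: "\<rho> = ennreal r" "0 \<le> r" "r < 1"
      using \<open>\<rho> < 1\<close> by (cases \<rho>) (auto simp: ennreal_less_iff ennreal_1[symmetric] simp del: ennreal_1)
    have "(\<Sum>n. \<rho> ^ n) = (\<Sum>n. ennreal (r ^ n))" by (simp add: r ennreal_power)
    also have "\<dots> = ennreal (\<Sum>n. r ^ n)"
      by (rule suminf_ennreal2) (use r in \<open>auto intro: summable_geometric\<close>)
    finally show ?thesis by simp
  qed
  finally have "AE x in S. (\<Sum>n. ennreal (exp (- (\<Sum>k<n. f (x k))))) \<noteq> \<infinity>"
    by (intro nn_integral_noteq_infinite) auto
  then show ?thesis
  proof eventually_elim
    case (elim x)
    have "summable (\<lambda>n. exp (- (\<Sum>k<n. f (x k))))"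
      by (rule summable_suminf_not_top) (use elim in auto)
    then have "(\<lambda>n. exp (- (\<Sum>k<n. f (x k)))) \<longlonglongrightarrow> 0"
      by (rule summable_LIMSEQ_zero)
    then have "filterlim (\<lambda>n. exp (- (\<Sum>k<n. f (x k)))) (at_right 0) sequentially"
      by (auto simp: filterlim_at)
    then have "filterlim (\<lambda>n. ln (exp (- (\<Sum>k<n. f (x k))))) at_bot sequentially"
      by (rule filterlim_compose[OF ln_at_0])
    then show ?case by (simp add: filterlim_uminus_at_bot)
  qed
qed

end

lemma not_AE_nonpos_obtain:
  fixes g :: "'a \<Rightarrow> real"
  assumes "\<not> (AE z in M. g z \<le> 0)"
  obtains w where "w > 0" "\<not> (AE z in M. g z < w)"
proof (rule ccontr)
  assume *: "\<not> thesis"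
  have "AE z in M. g z < 1 / real (Suc k)" for k
    using * that[of "1 / real (Suc k)"] by auto
  then have "AE z in M. \<forall>k. g z < 1 / real (Suc k)"
    by (simp only: AE_all_countable simp_thms)
  then have "AE z in M. g z \<le> 0"
  proof eventually_elim
    case (elim z)
    show ?case
    proof (rule field_le_epsilon)
      fix e :: real assume "0 < e"
      then obtain k where "1 / real (Suc k) < e" using nat_approx_posE by blast
      then show "g z \<le> 0 + e" using elim[rule_format, of k] by simp
    qed
  qed
  then show False using assms by simp
qed

lemma emeasure_pos_of_not_AE:
  assumes "\<not> (AE z in M. \<not> R z)" "{z \<in> space M. R z} \<in> sets M"
  shows "0 < emeasure M {z \<in> space M. R z}"
proof (rule ccontr)
  assume "\<not> ?thesis"
  then have "AE z in M. z \<notin> {z \<in> space M. R z}" using assms(2) by (intro AE_not_in null_setsI) auto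
  then have "AE z in M. \<not> R z" using AE_space[of M] by eventually_elim simp
  then show False using assms(1) by simp
qed

text \<open>The first component is the step X of the walk. The second one varies with the use: the
  block maximum itself when divergence of the walk is proved, and the log+ of a block maximum or
  block sum in the moment theorems.\<close>

locale iid_pairs = sequence_space \<mu> for \<mu> :: "(real \<times> real) measure" +
  assumes sets_mu [measurable_cong, simp]: "sets \<mu> = sets borel"
begin

lemma space_mu [simp]: "space \<mu> = UNIV"
  using sets_eq_imp_space_eq[OF sets_mu] by simp

lemma space_S [simp]: "space S = UNIV"
  by (simp add: space_PiM)

lemma measurable_fst_mu [measurable (raw)]:
  "f \<in> L \<rightarrow>\<^sub>M \<mu> \<Longrightarrow> (\<lambda>w. fst (f w)) \<in> borel_measurable L"
  "f \<in> L \<rightarrow>\<^sub>M \<mu> \<Longrightarrow> (\<lambda>w. snd (f w)) \<in> borel_measurable L"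
  by (simp_all add: borel_prod[symmetric] cong: measurable_cong_sets)

lemma measurable_fst_component [measurable (raw)]:
  assumes [measurable]: "f \<in> L \<rightarrow>\<^sub>M S"
  shows "(\<lambda>w. fst (f w k)) \<in> borel_measurable L" "(\<lambda>w. snd (f w k)) \<in> borel_measurable L"
  by (rule measurable_fst_mu, measurable)+

lemma measurable_psum [measurable (raw)]:
  assumes [measurable]: "f \<in> L \<rightarrow>\<^sub>M S"
  shows "(\<lambda>w. psum (f w) n) \<in> borel_measurable L" "(\<lambda>w. psum_pos (f w) n) \<in> borel_measurable L"
  unfolding psum_def psum_pos_def by measurable

lemma AE_psum_pos_at_top:
  assumes "\<not> (AE z in \<mu>. fst z \<le> 0)"
  shows "AE x in S. filterlim (psum_pos x) at_top sequentially"
proof -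
  have "AE x in S. filterlim (\<lambda>n. \<Sum>k<n. max 0 (fst (x k))) at_top sequentially"
  proof (rule AE_filterlim_sum_at_top)
    show "\<not> (AE z in \<mu>. max 0 (fst z) = 0)"
    proof
      assume "AE z in \<mu>. max 0 (fst z) = 0"
      then have "AE z in \<mu>. fst z \<le> 0" by eventually_elim (simp add: max_def split: if_splits)
      then show False using assms by simp
    qed
  qed auto
  then show ?thesis by (simp add: psum_pos_def[abs_def])
qed

text \<open>A visit below \<open>y\<close> is followed, with a probability bounded away from zero, by \<open>k\<close> large negative
  increments and a large second component, which breaks the bound \<open>c\<close>. Hence the expected number of
  visits below \<open>y\<close> before the bound is broken is finite.\<close>

lemma AE_psum_at_top:
  assumes bound: "AE x in S. \<exists>c::nat. \<forall>n. exp (- psum x n) * snd (x n) \<le> real c"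
    and snd_pos: "\<not> (AE z in \<mu>. snd z \<le> 0)" and nonzero: "\<not> (AE z in \<mu>. fst z = 0)"
  shows "AE x in S. filterlim (psum x) at_top sequentially"
proof (cases "AE z in \<mu>. 0 \<le> fst z")
  case True
  show ?thesis
    using AE_filterlim_sum_at_top[OF _ True nonzero] by (simp add: psum_def[abs_def])
next
  case False
  then have "\<not> (AE z in \<mu>. - fst z \<le> 0)" by simp
  from not_AE_nonpos_obtain[OF this] obtain \<epsilon> where \<epsilon>: "\<epsilon> > 0" "\<not> (AE z in \<mu>. - fst z < \<epsilon>)" by blast
  obtain w where w: "w > 0" "\<not> (AE z in \<mu>. snd z < w)"
    using not_AE_nonpos_obtain[OF snd_pos] by blast
  define \<delta> where "\<delta> = emeasure \<mu> {z. \<epsilon> \<le> - fst z}"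
  define \<eta> where "\<eta> = emeasure \<mu> {z. w \<le> snd z}"
  have \<delta>: "\<delta> > 0"
    using emeasure_pos_of_not_AE[where M = \<mu> and R = "\<lambda>z. \<epsilon> \<le> - fst z"] \<epsilon> by (simp add: \<delta>_def not_le)
  have \<eta>: "\<eta> > 0"
    using emeasure_pos_of_not_AE[where M = \<mu> and R = "\<lambda>z. w \<le> snd z"] w by (simp add: \<eta>_def not_le)
  \<comment> \<open>Only visits made before the bound c is first broken are counted. This keeps the
    event a function of the first n entries, and it limits recurrences: once the bound breaks,
    counting stops.\<close>
  let ?visit = "\<lambda>c y x n. psum x n \<le> real y \<and> (\<forall>m<n. \<not> real c < exp (- psum x m) * snd (x m))"
  have finite_visits: "AE x in S. eventually (\<lambda>n. \<not> ?visit c y x n) sequentially" for c y :: nat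
  proof -
    \<comment> \<open>From a height of at most y, k steps down by at least \<open>\<epsilon>\<close>
      lead below \<open>y - k * \<epsilon>\<close>. The number k is chosen so large that a second
      component of size w then exceeds c after multiplication by the exponential.\<close>
    obtain k :: nat where "(real y + real c / w) / \<epsilon> < real k" using reals_Archimedean2 by blast
    then have "real c / w < real k * \<epsilon> - real y" using \<epsilon> by (simp add: field_simps)
    also have "\<dots> < exp (real k * \<epsilon> - real y)" by (rule exp_gt_self)
    finally have k: "real c < exp (real k * \<epsilon> - real y) * w" using w by (simp add: field_simps)
    define G where "G n = {x \<in> space S. ?visit c y x n}" for n
    have [measurable]: "G n \<in> sets S" for n unfolding G_def by measurable
    define V where "V x = (\<Prod>j<k. indicator {z. \<epsilon> \<le> - fst z} (x j)) * (indicator {z. w \<le> snd z} (x k) :: ennreal)"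
      for x :: "nat \<Rightarrow> real \<times> real"
    have [measurable]: "V \<in> borel_measurable S" unfolding V_def by measurable
    have V_eq: "V x = indicator {x. (\<forall>j<k. \<epsilon> \<le> - fst (x j)) \<and> w \<le> snd (x k)} x" for x
      by (auto simp: V_def prod_zero_iff split: split_indicator)
    have V_le: "V x \<le> 1" for x by (simp add: V_eq split: split_indicator)
    have V_integral: "(\<integral>\<^sup>+x. V x \<partial>S) = \<delta> ^ k * \<eta>"
    proof -
      let ?F = "\<lambda>(x, z). (\<Prod>j<k. indicator {z. \<epsilon> \<le> - fst z} (x j)) * (indicator {z. w \<le> snd z} z :: ennreal)"
      have "(\<integral>\<^sup>+x. V x \<partial>S) = (\<integral>\<^sup>+x. ?F (x, x k) \<partial>S)" by (simp add: V_def)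
      also have "\<dots> = (\<integral>\<^sup>+x. \<integral>\<^sup>+z. ?F (x, z) \<partial>\<mu> \<partial>S)"
        by (rule nn_integral_prefix_next) (simp_all add: comb_seq_def)
      also have "\<dots> = (\<integral>\<^sup>+x. (\<Prod>j<k. indicator {z. \<epsilon> \<le> - fst z} (x j)) \<partial>S) * \<eta>"
        by (simp add: nn_integral_cmult nn_integral_multc \<eta>_def)
      finally show ?thesis by (simp add: nn_integral_prod_prefix \<delta>_def)
    qed
    have drop: "psum x (n + j) \<le> psum x n - real j * \<epsilon>"
      if "\<forall>j<k. \<epsilon> \<le> - fst (x (n + j))" "j \<le> k" for x n j
      using \<open>j \<le> k\<close>
    proof (induction j)
      case (Suc j)
      then show ?case using that(1)[rule_format, of j] by (simp add: psum_Suc algebra_simps)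
    qed simp
    have "(\<Sum>n. emeasure S (G n)) < \<infinity>"
    proof (rule sum_emeasure_prefix_finite[where r = "\<lambda>n. n"])
      show "comb_seq n x y \<in> G n \<longleftrightarrow> x \<in> G n" for n x y
        by (auto simp: G_def psum_comb_seq comb_seq_less)
      fix x m n assume "x \<in> G m" "V (drop_seq m x) \<noteq> 0" "x \<in> G n"
      then have m: "psum x m \<le> real y" "\<forall>j<k. \<epsilon> \<le> - fst (x (m + j))" "w \<le> snd (x (m + k))"
        by (auto simp: V_eq G_def drop_seq_apply split: split_indicator_asm)
      have "real k * \<epsilon> - real y \<le> - psum x (m + k)" using drop[OF m(2), of k] m(1) by simp
      then have "exp (real k * \<epsilon> - real y) * w \<le> exp (- psum x (m + k)) * snd (x (m + k))"
        using m(3) w by (intro mult_mono) auto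
      then have "real c < exp (- psum x (m + k)) * snd (x (m + k))" using k by simp
      then show "n \<le> m + k" using \<open>x \<in> G n\<close> unfolding G_def by (auto simp: not_le[symmetric])
    qed (use \<delta> \<eta> in \<open>auto simp: V_le V_integral\<close>)
    then have "AE x in S. eventually (\<lambda>n. x \<in> space S - G n) sequentially"
      by (intro borel_cantelli_AE1 summable_suminf_not_top)
        (auto simp: less_top[symmetric] P.emeasure_eq_measure[symmetric])
    then show ?thesis by eventually_elim (auto simp: G_def)
  qed
  then have "AE x in S. \<forall>c y::nat. eventually (\<lambda>n. \<not> ?visit c y x n) sequentially"
    by (simp add: AE_all_countable)
  with bound show ?thesis
  proof eventually_elim
    case (elim x)
    then obtain c :: nat where c: "\<And>n. exp (- psum x n) * snd (x n) \<le> real c" by blast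
    show ?case
      unfolding filterlim_at_top
    proof
      fix Z :: real
      obtain y :: nat where "Z \<le> real y" using real_arch_simple by blast
      moreover have "eventually (\<lambda>n. \<not> psum x n \<le> real y) sequentially"
        using elim(2)[rule_format, of y c] c by (simp add: not_less)
      ultimately show "eventually (\<lambda>n. Z \<le> psum x n) sequentially"
        by (auto elim!: eventually_mono)
    qed
  qed
qed

end

section \<open>The truncated-mean moment condition\<close>

definition trunc_mean :: "(real \<times> real) measure \<Rightarrow> real \<Rightarrow> real" where
  "trunc_mean \<mu> y = (\<integral>z. min (max (fst z) 0) y \<partial>\<mu>)"

text \<open>Erickson's function y / E(X^+ \<and> y), which bounds from below the renewal function of
  the walk with steps X^+. It is \<open>J\<close> read off from the law of a block, for steps that
  are positive with positive probability. The quotient is at least 1 everywhere, so the value 1 at 0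
  keeps the function monotone.\<close>

definition erickson :: "(real \<times> real) measure \<Rightarrow> real \<Rightarrow> real" where
  "erickson \<mu> y = (if y = 0 then 1 else y / trunc_mean \<mu> y)"

locale iid_pairs_pos = iid_pairs +
  assumes not_nonpos: "\<not> (AE z in \<mu>. fst z \<le> 0)"
begin

lemma integrable_trunc: "0 \<le> y \<Longrightarrow> integrable \<mu> (\<lambda>z. min (max (fst z) 0) y)"
  by (rule M.integrable_const_bound[where B = y]) auto

lemma ennreal_trunc_mean:
  "0 \<le> y \<Longrightarrow> ennreal (trunc_mean \<mu> y) = (\<integral>\<^sup>+z. ennreal (min (max (fst z) 0) y) \<partial>\<mu>)"
  unfolding trunc_mean_def by (subst nn_integral_eq_integral) (auto intro: integrable_trunc)

lemma trunc_mean_nonneg: "0 \<le> y \<Longrightarrow> 0 \<le> trunc_mean \<mu> y"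
  unfolding trunc_mean_def by (intro integral_nonneg_AE) auto

lemma trunc_mean_pos:
  assumes "0 < y"
  shows "0 < trunc_mean \<mu> y"
proof -
  have "trunc_mean \<mu> y \<noteq> 0"
  proof
    assume "trunc_mean \<mu> y = 0"
    then have "AE z in \<mu>. min (max (fst z) 0) y = 0"
      unfolding trunc_mean_def
      by (subst (asm) integral_nonneg_eq_0_iff_AE) (use assms in \<open>auto intro: integrable_trunc\<close>)
    then have "AE z in \<mu>. fst z \<le> 0"
      by eventually_elim (use assms in \<open>auto simp: min_def max_def split: if_splits\<close>)
    then show False using not_nonpos by simp
  qed
  then show ?thesis using trunc_mean_nonneg[of y] assms by simp
qed

lemma trunc_mean_le: "0 \<le> y \<Longrightarrow> trunc_mean \<mu> y \<le> y"
  using integral_mono[OF integrable_trunc[of y], of "\<lambda>_. y"]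
  by (simp add: trunc_mean_def M.prob_space[simplified])

lemma trunc_mean_mono: "0 \<le> x \<Longrightarrow> x \<le> y \<Longrightarrow> trunc_mean \<mu> x \<le> trunc_mean \<mu> y"
  unfolding trunc_mean_def by (intro integral_mono integrable_trunc) auto

text \<open>For fixed a \<ge> 0 the function min a t is concave in t and vanishes at 0, so its
  quotient by t decreases. Integrated, this makes \<open>erickson\<close> increasing.\<close>

lemma trunc_mean_concave:
  assumes "0 \<le> x" "x \<le> y"
  shows "x * trunc_mean \<mu> y \<le> y * trunc_mean \<mu> x"
proof -
  have "x * min (max (fst z) 0) y \<le> y * min (max (fst z) 0) x" for z :: "real \<times> real"
  proof (cases "max (fst z) 0 \<le> x")
    case True
    then show ?thesis using assms by (simp add: mult_right_mono)
  next
    case False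
    have "x * min (max (fst z) 0) y \<le> x * y" by (rule mult_left_mono) (use assms in auto)
    then show ?thesis using False assms by (simp add: mult.commute)
  qed
  then have "(\<integral>z. x * min (max (fst z) 0) y \<partial>\<mu>) \<le> (\<integral>z. y * min (max (fst z) 0) x \<partial>\<mu>)"
    using assms by (intro integral_mono integrable_mult_right integrable_trunc) auto
  then show ?thesis by (simp add: trunc_mean_def)
qed

lemma erickson_ge_1: "0 \<le> y \<Longrightarrow> 1 \<le> erickson \<mu> y"
  using trunc_mean_pos[of y] trunc_mean_le[of y] by (simp add: erickson_def)

lemma erickson_mono:
  assumes "0 \<le> x" "x \<le> y"
  shows "erickson \<mu> x \<le> erickson \<mu> y"
proof (cases "x = 0")
  case True
  then show ?thesis using erickson_ge_1[of y] assms by (simp add: erickson_def)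
next
  case False
  then show ?thesis
    using trunc_mean_concave[OF assms] trunc_mean_pos[of x] trunc_mean_pos[of y] assms
    by (simp add: erickson_def field_simps)
qed

text \<open>The numerator x + y is split, and each part only gains when the denominator drops to the
  truncated mean at x or at y. Subadditivity is what lets additive constants and block lengths be
  taken out of the argument.\<close>

lemma erickson_subadd:
  assumes "0 \<le> x" "0 \<le> y"
  shows "erickson \<mu> (x + y) \<le> erickson \<mu> x + erickson \<mu> y"
proof (cases "x = 0 \<or> y = 0")
  case True
  then show ?thesis by (auto simp: erickson_def)
next
  case False
  then have pos: "0 < x" "0 < y" using assms by auto
  have "x / trunc_mean \<mu> (x + y) \<le> x / trunc_mean \<mu> x"
    using pos trunc_mean_mono[of x "x + y"] trunc_mean_pos[of x] by (intro divide_left_mono) auto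
  moreover have "y / trunc_mean \<mu> (x + y) \<le> y / trunc_mean \<mu> y"
    using pos trunc_mean_mono[of y "x + y"] trunc_mean_pos[of y] by (intro divide_left_mono) auto
  ultimately show ?thesis using pos by (simp add: erickson_def add_divide_distrib)
qed

text \<open>Beyond 1 the denominator is at least its value at 1. A linear bound suffices for
  arguments of finite mean, such as the length of a block.\<close>

lemma erickson_le_linear:
  assumes "0 \<le> y"
  shows "erickson \<mu> y \<le> erickson \<mu> 1 * (1 + y)"
proof (cases "y \<le> 1")
  case True
  have "erickson \<mu> y \<le> erickson \<mu> 1 * 1"
    using erickson_mono[OF assms True] by simp
  also have "\<dots> \<le> erickson \<mu> 1 * (1 + y)"
    using assms erickson_ge_1[of 1] by (intro mult_left_mono) auto
  finally show ?thesis .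
next
  case False
  then have "erickson \<mu> y \<le> y / trunc_mean \<mu> 1"
    using trunc_mean_mono[of 1 y] trunc_mean_pos[of 1] by (auto simp: erickson_def intro!: divide_left_mono)
  also have "\<dots> \<le> erickson \<mu> 1 * (1 + y)"
    using trunc_mean_pos[of 1] by (simp add: erickson_def field_simps)
  finally show ?thesis .
qed

section \<open>Necessity: the renewal function and the last exceedance\<close>

lemma measurable_trunc_mean [measurable]: "trunc_mean \<mu> \<in> borel_measurable borel"
  unfolding trunc_mean_def[abs_def] by measurable

lemma measurable_erickson [measurable]: "erickson \<mu> \<in> borel_measurable borel"
  unfolding erickson_def[abs_def] by measurable

text \<open>An identity of Wald type: the steps taken below level v, truncated at v, add up to at
  least v on every divergent path. Being below v at time n depends on the first n entries only, so
  the mean of this sum is the renewal function at v times the truncated mean.\<close>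

lemma erickson_le_renewal:
  assumes v: "0 < v"
  shows "ennreal (erickson \<mu> v) \<le> (\<integral>\<^sup>+x. (\<Sum>n. indicator {x. psum_pos x n < v} x) \<partial>S)"
proof -
  define U where "U = (\<integral>\<^sup>+x. (\<Sum>n. indicator {x. psum_pos x n < v} x) \<partial>S)"
  define t where "t z = min (max (fst z) 0) v" for z :: "real \<times> real"
  have [measurable]: "t \<in> borel_measurable \<mu>" unfolding t_def by measurable
  let ?f = "\<lambda>n x. indicator {x. psum_pos x n < v} x * ennreal (t (x n))"
  have [measurable]: "{x. psum_pos x n < v} \<in> sets S" for n
  proof -
    have "{x \<in> space S. psum_pos x n < v} \<in> sets S" by measurable
    then show ?thesis by simp
  qed
  have path: "AE x in S. ennreal v \<le> (\<Sum>n. ?f n x)"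
    using AE_psum_pos_at_top[OF not_nonpos]
  proof eventually_elim
    case (elim x)
    then obtain N where N: "v \<le> psum_pos x N"
      by (auto simp: filterlim_at_top eventually_sequentially)
    define g where "g n = (if psum_pos x n < v then t (x n) else 0)" for n
    \<comment> \<open>Truncating at v loses nothing: a step longer than v taken from a nonnegative
      height crosses v even after it has been cut to v.\<close>
    have "min (psum_pos x n) v \<le> (\<Sum>k<n. g k)" for n
    proof (induction n)
      case (Suc n)
      have "0 \<le> psum_pos x n" using psum_pos_mono[of 0 n x] by simp
      then show ?case using Suc v by (simp add: psum_pos_Suc g_def t_def max.commute) linarith
    qed (use v in simp)
    then have "ennreal v \<le> ennreal (\<Sum>k<N. g k)" using N by (intro ennreal_leI) (metis min.absorb2)
    also have "\<dots> = (\<Sum>k<N. ennreal (g k))"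
      using v by (intro sum_ennreal[symmetric]) (auto simp: g_def t_def)
    also have "\<dots> \<le> (\<Sum>k. ennreal (g k))" by (rule sum_le_suminf) auto
    also have "\<dots> = (\<Sum>n. ?f n x)"
      by (intro suminf_cong) (auto simp: g_def)
    finally show ?case .
  qed
  have "ennreal v = (\<integral>\<^sup>+x. ennreal v \<partial>S)" by (simp add: P.emeasure_space_1[simplified])
  also have "\<dots> \<le> (\<integral>\<^sup>+x. (\<Sum>n. ?f n x) \<partial>S)"
    by (rule nn_integral_mono_AE) (rule path)
  also have "\<dots> = (\<Sum>n. \<integral>\<^sup>+x. ?f n x \<partial>S)"
    by (rule nn_integral_suminf) measurable
  also have "\<dots> = (\<Sum>n. emeasure S {x. psum_pos x n < v} * ennreal (trunc_mean \<mu> v))"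
  proof (rule suminf_cong)
    fix n
    let ?F = "\<lambda>(x, z). indicator {x. psum_pos x n < v} x * ennreal (t z)"
    have "(\<integral>\<^sup>+x. ?f n x \<partial>S) = (\<integral>\<^sup>+x. ?F (x, x n) \<partial>S)" by simp
    also have "\<dots> = (\<integral>\<^sup>+x. \<integral>\<^sup>+z. ?F (x, z) \<partial>\<mu> \<partial>S)"
      by (rule nn_integral_prefix_next) (auto simp: psum_pos_comb_seq split: split_indicator)
    also have "\<dots> = emeasure S {x. psum_pos x n < v} * ennreal (trunc_mean \<mu> v)"
      using v by (simp add: nn_integral_cmult nn_integral_multc ennreal_trunc_mean t_def[abs_def])
    finally show "(\<integral>\<^sup>+x. ?f n x \<partial>S) = emeasure S {x. psum_pos x n < v} * ennreal (trunc_mean \<mu> v)" .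
  qed
  also have "\<dots> = U * ennreal (trunc_mean \<mu> v)"
    by (simp add: U_def nn_integral_suminf)
  finally have *: "ennreal v \<le> U * ennreal (trunc_mean \<mu> v)" .
  have "ennreal (erickson \<mu> v) = ennreal v / ennreal (trunc_mean \<mu> v)"
    using v trunc_mean_pos[OF v] by (simp add: erickson_def divide_ennreal)
  also have "\<dots> \<le> U"
    using * trunc_mean_pos[OF v] by (intro divide_le_posI_ennreal) (auto simp: mult.commute)
  finally show ?thesis by (simp add: U_def)
qed

text \<open>If \<open>E m\<close> is the event that \<open>snd (x m)\<close> exceeds \<open>psum_pos x m + c\<close>, then on \<open>E m\<close> no later
  exceedance occurs as soon as the walk restarted after \<open>m\<close> has none, an independent event of
  probability \<open>q\<close>. Decomposing at the last exceedance, \<open>q\<close> times the sum of the probabilities of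
  the \<open>E m\<close> is at most one.\<close>

theorem erickson_moment_necessary:
  assumes bound: "AE x in S. \<exists>c::nat. \<forall>n. snd (x n) \<le> psum_pos x n + real c"
    and nonneg: "AE z in \<mu>. 0 \<le> snd z"
  shows "(\<integral>\<^sup>+z. ennreal (erickson \<mu> (snd z)) \<partial>\<mu>) < \<infinity>"
proof -
  define F where "F c = {x \<in> space S. \<forall>n. snd (x n) \<le> psum_pos x n + real c}" for c :: nat
  have [measurable]: "F c \<in> sets S" for c unfolding F_def not_less[symmetric] by measurable
  obtain c0 where c0: "emeasure S (F c0) \<noteq> 0"
  proof (rule ccontr)
    assume *: "\<not> thesis"
    have "AE x in S. x \<notin> F c" for c
      using * that[of c] by (intro AE_not_in null_setsI) auto
    then have "AE x in S. \<forall>c. x \<notin> F c" by (simp only: AE_all_countable simp_thms)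
    with bound have "AE x in S. False" by eventually_elim (auto simp: F_def)
    then show False by simp
  qed
  define c where "c = Suc c0"
  define q where "q = emeasure S (F c)"
  have "emeasure S (F c0) \<le> q"
    unfolding q_def
  proof (rule emeasure_mono)
    show "F c0 \<subseteq> F c"
    proof
      fix x assume "x \<in> F c0"
      then have "snd (x n) \<le> psum_pos x n + real c0" for n by (auto simp: F_def)
      then have "snd (x n) \<le> psum_pos x n + real c" for n
        by (rule order_trans) (simp add: c_def)
      then show "x \<in> F c" by (simp add: F_def)
    qed
  qed measurable
  then have q: "q \<noteq> 0" using c0 by auto
  have c: "0 < c" by (simp add: c_def)
  define E where "E m = {x \<in> space S. psum_pos x m + real c < snd (x m)}" for m
  have [measurable]: "E m \<in> sets S" for m unfolding E_def by measurable
  \<comment> \<open>\<open>E m\<close> looks at entry m itself, so its prefix has length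
    \<open>Suc m\<close>. The window has width 0 because \<open>F c\<close> after the restart rules
    out every later exceedance.\<close>
  have fin: "(\<Sum>m. emeasure S (E m)) < \<infinity>"
  proof (rule sum_emeasure_prefix_finite[where r = Suc and V = "indicator (F c)" and k = 0])
    show "comb_seq (Suc m) x y \<in> E m \<longleftrightarrow> x \<in> E m" for m x y
      by (auto simp: E_def psum_pos_comb_seq comb_seq_def)
    fix x m n assume "indicator (F c) (drop_seq (Suc m) x) \<noteq> (0::ennreal)" "x \<in> E n"
    then have F: "drop_seq (Suc m) x \<in> F c" by (simp split: split_indicator_asm)
    show "n \<le> m + 0"
    proof (rule ccontr)
      assume "\<not> n \<le> m + 0"
      then have "n = Suc m + (n - Suc m)" by simp
      then obtain l where l: "n = Suc m + l" by blast
      \<comment> \<open>Here the sign of the increments counts: the restarted walk lies below the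
        original one, so a bound in terms of the former implies the same bound in terms of the
        latter.\<close>
      have "snd (x n) \<le> psum_pos x n - psum_pos x (Suc m) + real c"
        using F by (auto simp: F_def psum_pos_drop_seq drop_seq_apply l)
      moreover have "0 \<le> psum_pos x (Suc m)" using psum_pos_mono[of 0 "Suc m" x] by simp
      ultimately show False using \<open>x \<in> E n\<close> by (simp add: E_def)
    qed
  qed (use q in \<open>simp_all add: q_def split: split_indicator\<close>)
  define D where "D m = {w \<in> space (S \<Otimes>\<^sub>M \<mu>). psum_pos (fst w) m + real c < snd (snd w)}" for m
  have [measurable]: "D m \<in> sets (S \<Otimes>\<^sub>M \<mu>)" for m unfolding D_def by measurable
  have D_iff: "(x, z) \<in> D m \<longleftrightarrow> psum_pos x m + real c < snd z" for x z m
    by (simp add: D_def space_pair_measure)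
  let ?K = "\<lambda>z. ennreal (erickson \<mu> (snd z - real c)) * indicator {z. real c < snd z} z"
  have "(\<integral>\<^sup>+z. ?K z \<partial>\<mu>) \<le> (\<integral>\<^sup>+z. \<integral>\<^sup>+x. (\<Sum>m. indicator {x. psum_pos x m < snd z - real c} x) \<partial>S \<partial>\<mu>)"
    by (intro nn_integral_mono) (auto split: split_indicator intro: erickson_le_renewal)
  also have "\<dots> = (\<integral>\<^sup>+z. \<integral>\<^sup>+x. (\<Sum>m. indicator (D m) (x, z)) \<partial>S \<partial>\<mu>)"
    by (intro nn_integral_cong suminf_cong) (auto simp: D_iff split: split_indicator)
  also have "\<dots> = (\<integral>\<^sup>+x. \<integral>\<^sup>+z. (\<Sum>m. indicator (D m) (x, z)) \<partial>\<mu> \<partial>S)"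
  proof -
    interpret pair_sigma_finite S \<mu> by unfold_locales
    show ?thesis by (rule Fubini') measurable
  qed
  also have "\<dots> = (\<Sum>m. \<integral>\<^sup>+x. \<integral>\<^sup>+z. indicator (D m) (x, z) \<partial>\<mu> \<partial>S)"
  proof -
    show ?thesis
      by (subst nn_integral_suminf[symmetric], measurable)+
  qed
  also have "\<dots> = (\<Sum>m. emeasure S (E m))"
  proof (rule suminf_cong)
    fix m
    let ?F = "indicator (D m) :: _ \<Rightarrow> ennreal"
    have "(\<integral>\<^sup>+x. \<integral>\<^sup>+z. ?F (x, z) \<partial>\<mu> \<partial>S) = (\<integral>\<^sup>+x. ?F (x, x m) \<partial>S)"
      by (rule nn_integral_prefix_next[symmetric]) (auto simp: D_iff psum_pos_comb_seq split: split_indicator)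
    also have "\<dots> = (\<integral>\<^sup>+x. indicator (E m) x \<partial>S)"
      by (intro nn_integral_cong) (auto simp: E_def D_iff split: split_indicator)
    finally show "(\<integral>\<^sup>+x. \<integral>\<^sup>+z. ?F (x, z) \<partial>\<mu> \<partial>S) = emeasure S (E m)" by simp
  qed
  finally have fin': "(\<integral>\<^sup>+z. ?K z \<partial>\<mu>) < \<infinity>"
    using fin by (auto simp: less_top[symmetric] top_unique)
  \<comment> \<open>Subadditivity undoes the shift by c; where \<open>snd z\<close> does not exceed
    c, monotonicity is enough.\<close>
  have "(\<integral>\<^sup>+z. ennreal (erickson \<mu> (snd z)) \<partial>\<mu>)
      \<le> (\<integral>\<^sup>+z. ?K z + ennreal (erickson \<mu> (real c)) \<partial>\<mu>)"
  proof (rule nn_integral_mono_AE)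
    show "AE z in \<mu>. ennreal (erickson \<mu> (snd z)) \<le> ?K z + ennreal (erickson \<mu> (real c))"
      using nonneg
    proof eventually_elim
      case (elim z)
      show ?case
      proof (cases "real c < snd z")
        case True
        then have "erickson \<mu> (snd z) \<le> erickson \<mu> (snd z - real c) + erickson \<mu> (real c)"
          using erickson_subadd[of "snd z - real c" "real c"] by simp
        moreover have "0 \<le> erickson \<mu> (snd z - real c)" "0 \<le> erickson \<mu> (real c)"
          using erickson_ge_1[of "snd z - real c"] erickson_ge_1[of "real c"] True by auto
        ultimately show ?thesis using True by (simp add: ennreal_plus[symmetric] ennreal_leI del: ennreal_plus)
      next
        case False
        then show ?thesis using elim erickson_mono[of "snd z" "real c"] by (simp add: ennreal_leI)
      qed
    qed
  qed
  also have "\<dots> = (\<integral>\<^sup>+z. ?K z \<partial>\<mu>) + ennreal (erickson \<mu> (real c))"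
  proof -
    have [measurable]: "{z. real c < snd z} \<in> sets \<mu>"
    proof -
      have "{z \<in> space \<mu>. real c < snd z} \<in> sets \<mu>" by measurable
      then show ?thesis by simp
    qed
    show ?thesis by (subst nn_integral_add) (simp_all add: M.emeasure_space_1[simplified])
  qed
  also have "\<dots> < \<infinity>" using fin' by simp
  finally show ?thesis .
qed

end

section \<open>Sufficiency of the moment condition\<close>

definition running_max :: "(nat \<Rightarrow> real \<times> real) \<Rightarrow> nat \<Rightarrow> real" where
  "running_max x n = Max (psum x ` {..n})"

text \<open>Ties count as records. This matches the nonstrict condition that the walk stays
  nonnegative, into which time reversal translates it.\<close>

definition record_time :: "(nat \<Rightarrow> real \<times> real) \<Rightarrow> nat \<Rightarrow> bool" where
  "record_time x n \<longleftrightarrow> (\<forall>k\<le>n. psum x k \<le> psum x n)"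

lemma running_max_0 [simp]: "running_max x 0 = 0"
  by (simp add: running_max_def)

lemma running_max_Suc: "running_max x (Suc n) = max (psum x (Suc n)) (running_max x n)"
  by (simp add: running_max_def atMost_Suc)

lemma running_max_mono_Suc: "running_max x n \<le> running_max x (Suc n)"
  by (simp add: running_max_Suc)

lemma running_max_record:
  assumes "record_time x n"
  shows "running_max x n = psum x n" "running_max x (Suc n) = psum x n + max (fst (x n)) 0"
proof -
  show "running_max x n = psum x n"
    unfolding running_max_def by (rule Max_eqI) (use assms in \<open>auto simp: record_time_def\<close>)
  then show "running_max x (Suc n) = psum x n + max (fst (x n)) 0"
    by (simp add: running_max_Suc psum_Suc max_def)
qed

text \<open>The running maximum absorbs the whole positive part of an increment taken at a record time.\<close>

lemma sum_record_low_le: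
  assumes "0 \<le> y"
  shows "(\<Sum>n<N. if record_time x n
    then (if psum x n \<le> y then 1 else 0) * min (max (fst (x n)) 0) y else 0) \<le> 2 * y"
    (is "?L N \<le> _")
proof -
  \<comment> \<open>The cap 2y: at a record of height at most y the running maximum, and with it the
    sum so far, is at most y, and the truncated step adds at most another y.\<close>
  have "?L N \<le> min (running_max x N) (2 * y)"
  proof (induction N)
    case (Suc N)
    show ?case
    proof (cases "record_time x N \<and> psum x N \<le> y")
      case True
      then have "?L (Suc N) = ?L N + min (max (fst (x N)) 0) y" by simp
      then show ?thesis using Suc.IH True running_max_record[of x N] by linarith
    next
      case False
      then have "?L (Suc N) = ?L N" by auto
      then show ?thesis using Suc.IH running_max_mono_Suc[of x N] by linarith
    qed
  qed (use assms in simp)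
  then show ?thesis by simp
qed

text \<open>The function h of the running maximum is a decreasing potential with values in [0, 1].
  At a record of height s above y, a step with positive part a lowers it by exp (y - s) * (1 - exp
  (- a)), so these losses cannot add up to more than 1.\<close>

lemma sum_record_high_le:
  "(\<Sum>n<N. if record_time x n
    then (if y < psum x n then exp (y - psum x n) else 0) * (1 - exp (- max (fst (x n)) 0)) else 0) \<le> 1"
    (is "?L N \<le> _")
proof -
  define h where "h s = min 1 (exp (y - s))" for s :: real
  have h_mono: "s \<le> t \<Longrightarrow> h t \<le> h s" for s t
    by (auto simp: h_def min_def intro: order_trans[of _ "exp (y - s)"])
  have "?L N \<le> 1 - h (running_max x N)"
  proof (induction N)
    case (Suc N)
    show ?case
    proof (cases "record_time x N \<and> y < psum x N")
      case True
      then have "h (running_max x N) = exp (y - psum x N)"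
        "h (running_max x (Suc N)) = exp (y - psum x N) * exp (- max (fst (x N)) 0)"
        using running_max_record[of x N] by (auto simp: h_def exp_add[symmetric] algebra_simps)
      moreover have "?L (Suc N) = ?L N + exp (y - psum x N) * (1 - exp (- max (fst (x N)) 0))"
        using True by simp
      ultimately show ?thesis using Suc.IH by (simp add: algebra_simps)
    next
      case False
      then have "?L (Suc N) = ?L N" by auto
      then show ?thesis using Suc.IH h_mono[OF running_max_mono_Suc[of x N]] by linarith
    qed
  qed (simp add: h_def)
  moreover have "0 \<le> h (running_max x N)" by (simp add: h_def)
  ultimately show ?thesis by linarith
qed

text \<open>The reversed walk at time k is the difference \<open>psum x n - psum x (n - k)\<close>,
  so its sign compares an earlier height with the last one.\<close>

lemma stays_nonneg_reverse_prefix: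
  "(\<forall>k\<le>n. 0 \<le> psum (reverse_prefix n x) k) \<longleftrightarrow> record_time x n"
  unfolding record_time_def
proof safe
  fix k assume *: "\<forall>k\<le>n. 0 \<le> psum (reverse_prefix n x) k" "k \<le> n"
  then have "0 \<le> psum (reverse_prefix n x) (n - k)" by simp
  then show "psum x k \<le> psum x n" using \<open>k \<le> n\<close> by (simp add: psum_reverse_prefix)
qed (simp add: psum_reverse_prefix)

context iid_pairs
begin

lemma measurable_record_time [measurable (raw)]:
  assumes [measurable]: "f \<in> L \<rightarrow>\<^sub>M S"
  shows "Measurable.pred L (\<lambda>w. record_time (f w) n)"
  unfolding record_time_def not_less[symmetric] by measurable

lemma distr_reverse_prefix: "distr S S (reverse_prefix n) = S"
proof -
  have "inj (\<lambda>k. if k < n then n - Suc k else k)"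
    by (rule injI) (auto split: if_splits)
  then show ?thesis
    using distr_reindex_seq[of "\<lambda>k. if k < n then n - Suc k else k"]
    by (simp add: reverse_prefix_def[abs_def])
qed

lemma measurable_reverse_prefix [measurable]: "reverse_prefix n \<in> S \<rightarrow>\<^sub>M S"
  unfolding reverse_prefix_def[abs_def] by (rule measurable_seq_of_components) measurable

lemma nn_integral_stays_nonneg_eq_record:
  fixes g :: "real \<Rightarrow> ennreal"
  assumes [measurable]: "g \<in> borel_measurable borel"
  shows "(\<integral>\<^sup>+x. (if \<forall>k\<le>n. 0 \<le> psum x k then g (psum x n) else 0) \<partial>S)
    = (\<integral>\<^sup>+x. (if record_time x n then g (psum x n) else 0) \<partial>S)"
proof -
  have "(\<integral>\<^sup>+x. (if \<forall>k\<le>n. 0 \<le> psum x k then g (psum x n) else 0) \<partial>S)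
    = (\<integral>\<^sup>+x. (if \<forall>k\<le>n. 0 \<le> psum x k then g (psum x n) else 0) \<partial>distr S S (reverse_prefix n))"
    by (simp only: distr_reverse_prefix)
  also have "\<dots> = (\<integral>\<^sup>+x. (if \<forall>k\<le>n. 0 \<le> psum (reverse_prefix n x) k then g (psum (reverse_prefix n x) n) else 0) \<partial>S)"
    by (rule nn_integral_distr) measurable
  also have "\<dots> = (\<integral>\<^sup>+x. (if record_time x n then g (psum x n) else 0) \<partial>S)"
    by (simp only: stays_nonneg_reverse_prefix psum_reverse_prefix order_refl diff_self_eq_0 psum_0 diff_zero)
  finally show ?thesis .
qed

end

section \<open>Expected sums over record times\<close>

context iid_pairs_pos
begin

text \<open>One minus the Laplace transform of X^+ at 1: the mean fraction of the potential lost at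
  a record above the level.\<close>

definition rho :: real where
  "rho = (\<integral>z. 1 - exp (- max (fst z) 0) \<partial>\<mu>)"

lemma ennreal_rho: "ennreal rho = (\<integral>\<^sup>+z. ennreal (1 - exp (- max (fst z) 0)) \<partial>\<mu>)"
  unfolding rho_def
  by (intro nn_integral_eq_integral[symmetric] M.integrable_const_bound[where B = 1]) auto

lemma rho_pos: "0 < rho"
proof -
  have int: "integrable \<mu> (\<lambda>z. 1 - exp (- max (fst z) 0))"
    by (rule M.integrable_const_bound[where B = 1]) auto
  have "0 \<le> rho" unfolding rho_def by (intro integral_nonneg_AE) auto
  moreover have "rho \<noteq> 0"
  proof
    assume "rho = 0"
    then have "AE z in \<mu>. 1 - exp (- max (fst z) 0) = 0"
      unfolding rho_def by (subst (asm) integral_nonneg_eq_0_iff_AE) (use int in auto)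
    then have "AE z in \<mu>. fst z \<le> 0" by eventually_elim (simp add: max_def split: if_splits)
    then show False using not_nonpos by simp
  qed
  ultimately show ?thesis by simp
qed

text \<open>Whether n is a record, and at which height, is decided by the first n entries, so the
  weight \<open>t (x n)\<close> is independent of it. A pathwise bound C on the weighted sum thus
  becomes a bound C / c on the mean of the unweighted one.\<close>

lemma record_sum_le:
  fixes u :: "real \<Rightarrow> real" and t :: "real \<times> real \<Rightarrow> real"
  assumes [measurable]: "u \<in> borel_measurable borel" "t \<in> borel_measurable \<mu>"
    and nonneg: "\<And>s. 0 \<le> u s" "\<And>z. 0 \<le> t z"
    and bound: "\<And>x N. (\<Sum>n<N. if record_time x n then u (psum x n) * t (x n) else 0) \<le> C"
    and c: "0 < c" "(\<integral>\<^sup>+z. ennreal (t z) \<partial>\<mu>) = ennreal c"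
  shows "(\<Sum>n. \<integral>\<^sup>+x. (if record_time x n then ennreal (u (psum x n)) else 0) \<partial>S) \<le> ennreal (C / c)"
    (is "(\<Sum>n. ?U n) \<le> _")
proof -
  let ?G = "\<lambda>n x. if record_time x n then u (psum x n) * t (x n) else 0"
  have "?U n * ennreal c = (\<integral>\<^sup>+x. ennreal (?G n x) \<partial>S)" for n
  proof -
    let ?F = "\<lambda>(x, z). (if record_time x n then ennreal (u (psum x n)) else 0) * ennreal (t z)"
    have "(\<integral>\<^sup>+x. ennreal (?G n x) \<partial>S) = (\<integral>\<^sup>+x. ?F (x, x n) \<partial>S)"
      by (intro nn_integral_cong) (simp add: ennreal_mult nonneg)
    also have "\<dots> = (\<integral>\<^sup>+x. \<integral>\<^sup>+z. ?F (x, z) \<partial>\<mu> \<partial>S)"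
      by (rule nn_integral_prefix_next) (auto simp: psum_comb_seq record_time_def)
    also have "\<dots> = ?U n * ennreal c"
      by (simp add: nn_integral_cmult nn_integral_multc c)
    finally show ?thesis by simp
  qed
  then have "(\<Sum>n. ?U n) * ennreal c = (\<Sum>n. \<integral>\<^sup>+x. ennreal (?G n x) \<partial>S)"
    unfolding ennreal_suminf_multc[symmetric] by (rule suminf_cong)
  also have "\<dots> = (\<integral>\<^sup>+x. (\<Sum>n. ennreal (?G n x)) \<partial>S)"
    by (rule nn_integral_suminf[symmetric]) measurable
  also have "\<dots> \<le> (\<integral>\<^sup>+x. ennreal C \<partial>S)"
  proof (rule nn_integral_mono, rule suminf_le_const)
    fix x N
    have "(\<Sum>n<N. ennreal (?G n x)) = ennreal (\<Sum>n<N. ?G n x)"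
      by (rule sum_ennreal) (simp add: nonneg)
    also have "\<dots> \<le> ennreal C" by (intro ennreal_leI bound)
    finally show "(\<Sum>n<N. ennreal (?G n x)) \<le> ennreal C" .
  qed simp
  also have "\<dots> = ennreal C" by (simp add: P.emeasure_space_1[simplified])
  finally have "(\<Sum>n. ?U n) * ennreal c / ennreal c \<le> ennreal C / ennreal c"
    by (rule divide_right_mono_ennreal)
  moreover have "0 \<le> C" using bound[of undefined 0] by simp
  ultimately show ?thesis using c(1) by (simp add: ennreal_mult_divide_eq divide_ennreal)
qed

text \<open>The soft cutoff equals 1 up to y and decays exponentially beyond. After reversal, the
  records up to y cost at most twice \<open>erickson \<mu> y\<close>, by the cap 2y, and the tail
  costs 1 / \<open>rho\<close>, by the unit potential.\<close>

lemma stays_nonneg_sum: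
  assumes y: "0 < y"
  shows "(\<Sum>n. \<integral>\<^sup>+x. (if \<forall>k\<le>n. 0 \<le> psum x k then ennreal (min 1 (exp (y - psum x n))) else 0) \<partial>S)
    \<le> ennreal (2 * erickson \<mu> y + 1 / rho)" (is "(\<Sum>n. ?I n) \<le> _")
proof -
  define u where "u s = (if s \<le> y then 1 else 0 :: real)" for s
  define v where "v s = (if y < s then exp (y - s) else 0)" for s
  have [measurable]: "u \<in> borel_measurable borel" "v \<in> borel_measurable borel"
    unfolding u_def[abs_def] v_def[abs_def] by measurable
  let ?R = "\<lambda>w n. \<integral>\<^sup>+x. (if record_time x n then ennreal (w (psum x n)) else 0) \<partial>S"
  have "?I n = ?R u n + ?R v n" for n
  proof -
    have "?I n = ?R (\<lambda>s. min 1 (exp (y - s))) n"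
      by (rule nn_integral_stays_nonneg_eq_record) measurable
    also have "\<dots> = (\<integral>\<^sup>+x. (if record_time x n then ennreal (u (psum x n)) else 0)
        + (if record_time x n then ennreal (v (psum x n)) else 0) \<partial>S)"
      by (intro nn_integral_cong) (auto simp: u_def v_def min_def)
    also have "\<dots> = ?R u n + ?R v n" by (rule nn_integral_add) measurable
    finally show ?thesis .
  qed
  then have "(\<Sum>n. ?I n) = (\<Sum>n. ?R u n) + (\<Sum>n. ?R v n)" by (simp add: suminf_add)
  also have "\<dots> \<le> ennreal (2 * y / trunc_mean \<mu> y) + ennreal (1 / rho)"
  proof (rule add_mono)
    show "(\<Sum>n. ?R u n) \<le> ennreal (2 * y / trunc_mean \<mu> y)"
    proof (rule record_sum_le[where t = "\<lambda>z. min (max (fst z) 0) y"])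
      show "(\<Sum>n<N. if record_time x n then u (psum x n) * min (max (fst (x n)) 0) y else 0) \<le> 2 * y"
        for x N unfolding u_def using y by (intro sum_record_low_le) simp
    qed (use y in \<open>simp_all add: u_def ennreal_trunc_mean trunc_mean_pos\<close>)
    show "(\<Sum>n. ?R v n) \<le> ennreal (1 / rho)"
    proof (rule record_sum_le[where t = "\<lambda>z. 1 - exp (- max (fst z) 0)"])
      show "(\<Sum>n<N. if record_time x n then v (psum x n) * (1 - exp (- max (fst (x n)) 0)) else 0) \<le> 1"
        for x N unfolding v_def by (rule sum_record_high_le)
    qed (simp_all add: v_def ennreal_rho rho_pos)
  qed
  also have "\<dots> = ennreal (2 * erickson \<mu> y + 1 / rho)"
    using y trunc_mean_pos[OF y] rho_pos by (subst ennreal_plus[symmetric]) (auto simp: erickson_def)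
  finally show ?thesis .
qed

text \<open>Taking means of \<open>min 1 (exp (Y - S_n))\<close> rather than probabilities of Y >
  S_n costs only the constant 1 / \<open>rho\<close> and yields summability of the exponentials, not
  merely finitely many exceedances. The estimate holds on paths that stay nonnegative; the drift
  reduces every path to this case.\<close>

theorem erickson_moment_sufficient:
  assumes drift: "AE x in S. filterlim (psum x) at_top sequentially"
    and nonneg: "AE z in \<mu>. 0 \<le> snd z"
    and moment: "(\<integral>\<^sup>+z. ennreal (erickson \<mu> (snd z)) \<partial>\<mu>) < \<infinity>"
  shows "AE x in S. summable (\<lambda>n. exp (snd (x n) - psum x n))"
proof -
  define F where "F n xz = (if \<forall>k\<le>n. 0 \<le> psum (fst xz) k
    then ennreal (min 1 (exp (snd (snd xz) - psum (fst xz) n))) else 0)"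
    for n and xz :: "(nat \<Rightarrow> real \<times> real) \<times> (real \<times> real)"
  have [measurable]: "F n \<in> borel_measurable (S \<Otimes>\<^sub>M \<mu>)" for n
    unfolding F_def by measurable
  have F_prefix: "F n (comb_seq n x y, z) = F n (x, z)" for n x y z
    by (auto simp: F_def psum_comb_seq)
  have "(\<integral>\<^sup>+x. (\<Sum>n. F n (x, x n)) \<partial>S) = (\<Sum>n. \<integral>\<^sup>+x. F n (x, x n) \<partial>S)"
    by (rule nn_integral_suminf) measurable
  also have "\<dots> = (\<Sum>n. \<integral>\<^sup>+x. \<integral>\<^sup>+z. F n (x, z) \<partial>\<mu> \<partial>S)"
    by (intro suminf_cong nn_integral_prefix_next F_prefix) measurable
  also have "\<dots> = (\<Sum>n. \<integral>\<^sup>+z. \<integral>\<^sup>+x. F n (x, z) \<partial>S \<partial>\<mu>)"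
  proof (rule suminf_cong)
    fix n
    interpret pair_sigma_finite \<mu> S by unfold_locales
    show "(\<integral>\<^sup>+x. \<integral>\<^sup>+z. F n (x, z) \<partial>\<mu> \<partial>S) = (\<integral>\<^sup>+z. \<integral>\<^sup>+x. F n (x, z) \<partial>S \<partial>\<mu>)"
      by (rule Fubini') measurable
  qed
  also have "\<dots> = (\<integral>\<^sup>+z. (\<Sum>n. \<integral>\<^sup>+x. F n (x, z) \<partial>S) \<partial>\<mu>)"
    by (rule nn_integral_suminf[symmetric]) measurable
  also have "\<dots> \<le> (\<integral>\<^sup>+z. ennreal 2 * ennreal (erickson \<mu> (snd z)) + ennreal (2 * erickson \<mu> 1 + 1 / rho) \<partial>\<mu>)"
  proof (rule nn_integral_mono_AE)
    show "AE z in \<mu>. (\<Sum>n. \<integral>\<^sup>+x. F n (x, z) \<partial>S)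
        \<le> ennreal 2 * ennreal (erickson \<mu> (snd z)) + ennreal (2 * erickson \<mu> 1 + 1 / rho)"
      using nonneg
    proof eventually_elim
      case (elim z)
      \<comment> \<open>\<open>stays_nonneg_sum\<close> asks for a positive level while
        \<open>snd z\<close> may be 0. Raising the level by 1 adds only the constant
        \<open>2 * erickson \<mu> 1\<close>.\<close>
      have "(\<Sum>n. \<integral>\<^sup>+x. F n (x, z) \<partial>S)
          \<le> (\<Sum>n. \<integral>\<^sup>+x. (if \<forall>k\<le>n. 0 \<le> psum x k then ennreal (min 1 (exp ((snd z + 1) - psum x n))) else 0) \<partial>S)"
        by (intro suminf_le nn_integral_mono) (auto simp: F_def min_le_iff_disj intro!: ennreal_leI)
      also have "\<dots> \<le> ennreal (2 * erickson \<mu> (snd z + 1) + 1 / rho)"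
        using elim by (intro stays_nonneg_sum) simp
      also have "\<dots> \<le> ennreal (2 * erickson \<mu> (snd z) + (2 * erickson \<mu> 1 + 1 / rho))"
        using erickson_subadd[of "snd z" 1] elim by (intro ennreal_leI) simp
      also have "\<dots> = ennreal 2 * ennreal (erickson \<mu> (snd z)) + ennreal (2 * erickson \<mu> 1 + 1 / rho)"
        using erickson_ge_1[of "snd z"] erickson_ge_1[of 1] elim rho_pos
        by (subst ennreal_plus) (auto simp: ennreal_mult)
      finally show ?case .
    qed
  qed
  also have "\<dots> = ennreal 2 * (\<integral>\<^sup>+z. ennreal (erickson \<mu> (snd z)) \<partial>\<mu>) + ennreal (2 * erickson \<mu> 1 + 1 / rho)"
    by (subst nn_integral_add) (simp_all add: nn_integral_cmult M.emeasure_space_1[simplified])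
  also have "\<dots> < \<infinity>" using moment by (simp add: ennreal_mult_less_top)
  finally have "AE x in S. (\<Sum>n. F n (x, x n)) \<noteq> \<infinity>"
    by (intro nn_integral_noteq_infinite) (auto simp: less_top)
  then have on_nonneg: "AE x in S. (\<forall>n. 0 \<le> psum x n) \<longrightarrow> summable (\<lambda>n. exp (snd (x n) - psum x n))"
  proof eventually_elim
    case (elim x)
    show ?case
    proof
      assume "\<forall>n. 0 \<le> psum x n"
      then have eq: "F n (x, x n) = ennreal (min 1 (exp (snd (x n) - psum x n)))" for n
        by (simp add: F_def)
      have sm: "summable (\<lambda>n. min 1 (exp (snd (x n) - psum x n)))"
        by (rule summable_suminf_not_top) (use elim in \<open>auto simp: eq\<close>)
      then have "(\<lambda>n. min 1 (exp (snd (x n) - psum x n))) \<longlonglongrightarrow> 0"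
        by (rule summable_LIMSEQ_zero)
      \<comment> \<open>Eventually the minimum is not attained by 1, so the truncation disappears
        from the tail of the series.\<close>
      then have "eventually (\<lambda>n. min 1 (exp (snd (x n) - psum x n)) < 1) sequentially"
        by (rule order_tendstoD) simp
      then have "eventually (\<lambda>n. min 1 (exp (snd (x n) - psum x n)) = exp (snd (x n) - psum x n)) sequentially"
        by eventually_elim linarith
      then show "summable (\<lambda>n. exp (snd (x n) - psum x n))"
        using sm by (simp add: summable_cong)
    qed
  qed
  \<comment> \<open>A walk tending to infinity is nonnegative when restarted at the time of its overall minimum.\<close>
  have "AE x in S. \<forall>m. (\<forall>n. 0 \<le> psum (drop_seq m x) n) \<longrightarrow>
      summable (\<lambda>n. exp (snd (drop_seq m x n) - psum (drop_seq m x) n))"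
    using AE_drop_seq[OF on_nonneg] by (simp add: AE_all_countable)
  with drift show ?thesis
  proof eventually_elim
    case (elim x)
    obtain N where N: "\<And>n. N \<le> n \<Longrightarrow> 0 \<le> psum x n"
      using elim(1) by (auto simp: filterlim_at_top eventually_sequentially)
    obtain m where m: "m \<le> N" "\<And>k. k \<le> N \<Longrightarrow> psum x m \<le> psum x k"
    proof -
      have "Min (psum x ` {..N}) \<in> psum x ` {..N}" by (rule Min_in) auto
      then obtain m where "m \<in> {..N}" "Min (psum x ` {..N}) = psum x m" by blast
      moreover have "Min (psum x ` {..N}) \<le> psum x k" if "k \<le> N" for k
        by (rule Min_le) (use that in auto)
      ultimately show ?thesis using that[of m] by auto
    qed
    \<comment> \<open>The starting height 0 is among the values minimised over, so the minimum also
      lies below the nonnegative heights after N.\<close>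
    have min: "psum x m \<le> psum x n" for n
    proof (cases "n \<le> N")
      case False
      have "psum x m \<le> 0" using m(2)[of 0] by simp
      then show ?thesis using N[of n] False by simp
    qed (use m in simp)
    have "summable (\<lambda>n. exp (snd (drop_seq m x n) - psum (drop_seq m x) n))"
      using elim(2)[rule_format, of m] min by (simp add: psum_drop_seq)
    then have "summable (\<lambda>n. exp (- psum x m) * exp (snd (drop_seq m x n) - psum (drop_seq m x) n))"
      by (rule summable_mult)
    then have "summable (\<lambda>n. exp (snd (x (n + m)) - psum x (n + m)))"
      by (simp add: psum_drop_seq drop_seq_apply exp_add[symmetric] add.commute[of m])
    then show ?case
      by (subst (asm) summable_iff_shift[of "\<lambda>n. exp (snd (x n) - psum x n)" m])
  qed
qed

end

section \<open>Regenerative blocks\<close>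

definition drop_random :: "((nat \<Rightarrow> 'e) \<Rightarrow> nat) \<Rightarrow> (nat \<Rightarrow> 'e) \<Rightarrow> nat \<Rightarrow> 'e" where
  "drop_random \<sigma> x = drop_seq (\<sigma> x) x"

lemma measurable_drop_random:
  assumes \<sigma>: "\<sigma> \<in> (\<Pi>\<^sub>M k\<in>UNIV. E) \<rightarrow>\<^sub>M count_space UNIV"
  shows "drop_random \<sigma> \<in> (\<Pi>\<^sub>M k\<in>UNIV. E) \<rightarrow>\<^sub>M (\<Pi>\<^sub>M k\<in>UNIV. E)"
  unfolding drop_random_def[abs_def]
  by (rule measurable_compose_countable[OF _ \<sigma>]) measurable

text \<open>Q itself need not be a product measure. The hypothesis is required for each fixed length
  l; summing over l makes the first block independent of the shifted sequence, which again has law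
  Q. Block k + 1 of a sequence is block k of the shifted one, so induction yields the product
  formula on rectangles.\<close>

theorem regenerative_blocks_iid:
  fixes Q :: "(nat \<Rightarrow> 'e) measure" and \<sigma> :: "(nat \<Rightarrow> 'e) \<Rightarrow> nat" and blk :: "(nat \<Rightarrow> 'e) \<Rightarrow> 'b"
  assumes "prob_space Q" and sets_Q [measurable_cong]: "sets Q = sets (\<Pi>\<^sub>M k\<in>UNIV. E)"
    and \<sigma> [measurable]: "\<sigma> \<in> (\<Pi>\<^sub>M k\<in>UNIV. E) \<rightarrow>\<^sub>M count_space UNIV"
    and blk [measurable]: "blk \<in> (\<Pi>\<^sub>M k\<in>UNIV. E) \<rightarrow>\<^sub>M F"
    and regen: "\<And>l D G. D \<in> sets F \<Longrightarrow> G \<in> sets Q \<Longrightarrow>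
      emeasure Q {x \<in> space Q. \<sigma> x = l \<and> blk x \<in> D \<and> drop_seq l x \<in> G} =
      emeasure Q {x \<in> space Q. \<sigma> x = l \<and> blk x \<in> D} * emeasure Q G"
  shows "distr Q (\<Pi>\<^sub>M k\<in>UNIV. F) (\<lambda>x n. blk ((drop_random \<sigma> ^^ n) x)) = (\<Pi>\<^sub>M k\<in>UNIV. distr Q F blk)"
proof -
  interpret Q: prob_space Q by fact
  interpret D: prob_space "distr Q F blk" by (rule Q.prob_space_distr) measurable
  interpret D: sequence_space "distr Q F blk" by unfold_locales
  note measurable_drop_random[OF \<sigma>, measurable]
  have iter [measurable]: "(drop_random \<sigma> ^^ n) \<in> (\<Pi>\<^sub>M k\<in>UNIV. E) \<rightarrow>\<^sub>M (\<Pi>\<^sub>M k\<in>UNIV. E)" for n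
    by (induction n) (simp_all add: id_def[abs_def] measurable_comp[OF _ measurable_drop_random[OF \<sigma>]])
  have blocks [measurable]: "(\<lambda>x n. blk ((drop_random \<sigma> ^^ n) x)) \<in> Q \<rightarrow>\<^sub>M (\<Pi>\<^sub>M k\<in>UNIV. F)"
    by (rule measurable_seq_of_components) measurable
  have one: "emeasure Q {x \<in> space Q. blk x \<in> D \<and> drop_random \<sigma> x \<in> G} =
      emeasure Q {x \<in> space Q. blk x \<in> D} * emeasure Q G"
    if [measurable]: "D \<in> sets F" "G \<in> sets Q" for D G
  proof -
    have [measurable]: "G \<in> sets (\<Pi>\<^sub>M k\<in>UNIV. E)" using sets_Q that by simp
    have "emeasure Q {x \<in> space Q. blk x \<in> D \<and> drop_random \<sigma> x \<in> G}
      = emeasure Q (\<Union>l. {x \<in> space Q. \<sigma> x = l \<and> blk x \<in> D \<and> drop_seq l x \<in> G})"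
      by (rule arg_cong[where f = "emeasure Q"]) (auto simp: drop_random_def)
    also have "\<dots> = (\<Sum>l. emeasure Q {x \<in> space Q. \<sigma> x = l \<and> blk x \<in> D \<and> drop_seq l x \<in> G})"
      by (rule suminf_emeasure[symmetric]) (auto simp: disjoint_family_on_def)
    also have "\<dots> = (\<Sum>l. emeasure Q {x \<in> space Q. \<sigma> x = l \<and> blk x \<in> D}) * emeasure Q G"
      by (simp add: regen that)
    also have "(\<Sum>l. emeasure Q {x \<in> space Q. \<sigma> x = l \<and> blk x \<in> D})
      = emeasure Q (\<Union>l. {x \<in> space Q. \<sigma> x = l \<and> blk x \<in> D})"
      by (rule suminf_emeasure) (auto simp: disjoint_family_on_def)
    also have "(\<Union>l. {x \<in> space Q. \<sigma> x = l \<and> blk x \<in> D}) = {x \<in> space Q. blk x \<in> D}"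
      by auto
    finally show ?thesis .
  qed
  have rect: "emeasure Q {x \<in> space Q. \<forall>k<n. blk ((drop_random \<sigma> ^^ k) x) \<in> D k}
      = (\<Prod>k<n. emeasure Q {x \<in> space Q. blk x \<in> D k})"
    if "\<And>k. D k \<in> sets F" for n D
    using that
  proof (induction n arbitrary: D)
    case 0
    then show ?case by (simp add: Q.emeasure_space_1)
  next
    case (Suc n)
    note [measurable] = Suc.prems
    let ?G = "{x \<in> space Q. \<forall>k<n. blk ((drop_random \<sigma> ^^ k) x) \<in> D (Suc k)}"
    have sp: "drop_random \<sigma> x \<in> space Q" if "x \<in> space Q" for x
      using measurable_space[OF measurable_drop_random[OF \<sigma>]] that
      by (simp add: sets_eq_imp_space_eq[OF sets_Q])
    have G: "?G \<in> sets Q" by measurable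
    have "{x \<in> space Q. \<forall>k<Suc n. blk ((drop_random \<sigma> ^^ k) x) \<in> D k}
      = {x \<in> space Q. blk x \<in> D 0 \<and> drop_random \<sigma> x \<in> ?G}"
      using sp by (auto simp: All_less_Suc2 funpow_swap1)
    then have "emeasure Q {x \<in> space Q. \<forall>k<Suc n. blk ((drop_random \<sigma> ^^ k) x) \<in> D k}
      = emeasure Q {x \<in> space Q. blk x \<in> D 0} * emeasure Q ?G"
      by (simp only: one[OF Suc.prems G])
    also have "emeasure Q ?G = (\<Prod>k<n. emeasure Q {x \<in> space Q. blk x \<in> D (Suc k)})"
      by (rule Suc.IH) (rule Suc.prems)
    finally show ?case by (simp add: prod.lessThan_Suc_shift del: prod.lessThan_Suc)
  qed
  show ?thesis
  proof (rule measure_eqI_rectangles[where E = F])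
    show "finite_measure (distr Q (\<Pi>\<^sub>M k\<in>UNIV. F) (\<lambda>x n. blk ((drop_random \<sigma> ^^ n) x)))"
      by (rule Q.finite_measure_distr[OF blocks])
    show "sets (\<Pi>\<^sub>M k\<in>(UNIV :: nat set). distr Q F blk) = sets (\<Pi>\<^sub>M k\<in>UNIV. F)"
      by (rule sets_PiM_cong) simp_all
  next
    fix n and D :: "nat \<Rightarrow> 'b set"
    assume [measurable]: "\<And>k. D k \<in> sets F"
    let ?R = "{y \<in> space (\<Pi>\<^sub>M k\<in>(UNIV :: nat set). F). \<forall>k<n. y k \<in> D k}"
    have "emeasure (distr Q (\<Pi>\<^sub>M k\<in>UNIV. F) (\<lambda>x n. blk ((drop_random \<sigma> ^^ n) x))) ?R
      = emeasure Q {x \<in> space Q. \<forall>k<n. blk ((drop_random \<sigma> ^^ k) x) \<in> D k}"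
      using measurable_space[OF blocks]
      by (subst emeasure_distr) (auto intro!: arg_cong[where f = "emeasure Q"])
    also have "\<dots> = (\<Prod>k<n. emeasure Q {x \<in> space Q. blk x \<in> D k})"
      by (rule rect) measurable
    also have "\<dots> = (\<Prod>k<n. emeasure (distr Q F blk) (D k))"
      by (intro prod.cong refl, subst emeasure_distr) (auto intro!: arg_cong[where f = "emeasure Q"])
    also have "\<dots> = emeasure (\<Pi>\<^sub>M k\<in>UNIV. distr Q F blk) ?R"
      using D.emeasure_PiM_Collect[of "{..<n}" D] by (simp add: space_PiM Ball_def)
    finally show "emeasure (distr Q (\<Pi>\<^sub>M k\<in>UNIV. F) (\<lambda>x n. blk ((drop_random \<sigma> ^^ n) x))) ?R
      = emeasure (\<Pi>\<^sub>M k\<in>UNIV. distr Q F blk) ?R" .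
  qed simp
qed

section \<open>The law of the chain with its marks\<close>

type_synonym 's mark = "'s \<times> real \<times> real"

abbreviation mark_space :: "'s mark measure" where
  "mark_space \<equiv> count_space UNIV \<Otimes>\<^sub>M (borel \<Otimes>\<^sub>M borel)"

abbreviation mark_seqs :: "(nat \<Rightarrow> 's mark) measure" where
  "mark_seqs \<equiv> \<Pi>\<^sub>M k\<in>UNIV. mark_space"

lemma space_mark_seqs [simp]: "space mark_seqs = UNIV"
  by (simp add: space_PiM space_pair_measure)

lemma space_mark_space [simp]: "space mark_space = UNIV"
  by (simp add: space_pair_measure)

text \<open>The state after \<open>n\<close> steps when \<open>x\<close> lists the successive marks of the chain started in \<open>i\<close>.\<close>

definition state_at :: "'s \<Rightarrow> nat \<Rightarrow> (nat \<Rightarrow> 's mark) \<Rightarrow> 's" where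
  "state_at i n x = (if n = 0 then i else fst (x (n - 1)))"

lemma state_at_Suc [simp]: "state_at i (Suc n) x = fst (x n)"
  and state_at_0 [simp]: "state_at i 0 x = i"
  by (simp_all add: state_at_def)

lemma state_at_comb_seq: "m \<le> n \<Longrightarrow> state_at i m (comb_seq n x y) = state_at i m x"
  by (auto simp: state_at_def comb_seq_def)

lemma (in prob_space) set_integral_const_real: "U \<in> events \<Longrightarrow> (\<integral>w\<in>U. c \<partial>M) = prob U * (c::real)"
  by (simp add: set_lebesgue_integral_def)

section \<open>From the modulated sequence to a law on sequences of marks\<close>

context markov_modulated
begin

lemma space_P [simp]: "space (P i) = space N"
  by (rule sets_eq_imp_space_eq) (rule sets_P)

lemma measurable_P: "f \<in> N \<rightarrow>\<^sub>M L \<Longrightarrow> f \<in> P i \<rightarrow>\<^sub>M L"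
  using measurable_cong_sets[OF sets_P refl] by blast

text \<open>Entry n records step n + 1. The junk values \<open>A 0\<close> and \<open>B 0\<close>
  thereby disappear, and so does the initial state, which has to be supplied separately, as in
  \<open>state_at\<close>.\<close>

definition marks :: "'w \<Rightarrow> nat \<Rightarrow> 's mark" where
  "marks w n = (M (Suc n) w, A (Suc n) w, B (Suc n) w)"

definition Q :: "'s \<Rightarrow> (nat \<Rightarrow> 's mark) measure" where
  "Q i = distr (P i) mark_seqs marks"

definition \<kappa> :: "'s \<Rightarrow> 's mark measure" where
  "\<kappa> i = measure_pmf (p i) \<bind> (\<lambda>s. distr (K i s) mark_space (Pair s))"

lemma measurable_marks [measurable]: "marks \<in> N \<rightarrow>\<^sub>M mark_seqs"
  unfolding marks_def[abs_def]
  by (rule measurable_seq_of_components)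
    (intro measurable_Pair measurable_M measurable_A measurable_B; simp)

lemma sets_Q [simp, measurable_cong]: "sets (Q i) = sets mark_seqs"
  by (simp add: Q_def)

lemma space_Q [simp]: "space (Q i) = UNIV"
  by (simp add: Q_def)

lemma prob_space_Q: "prob_space (Q i)"
  unfolding Q_def by (rule prob_space.prob_space_distr[OF prob_space_P]) (rule measurable_P, measurable)

lemma measurable_Q [measurable]: "Q \<in> count_space UNIV \<rightarrow>\<^sub>M subprob_algebra mark_seqs"
  by (simp add: space_subprob_algebra prob_space_imp_subprob_space prob_space_Q)

lemma sets_K' [measurable_cong, simp]: "sets (K i j) = sets (borel \<Otimes>\<^sub>M borel)"
  by (subst borel_prod) (rule sets_K)

lemma space_K [simp]: "space (K i j) = UNIV"
  using sets_eq_imp_space_eq[OF sets_K] by simp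

lemma measurable_Pair_K: "Pair s \<in> K i j \<rightarrow>\<^sub>M mark_space"
  by measurable

lemma kernel_K: "(\<lambda>s. distr (K i s) mark_space (Pair s)) \<in> measure_pmf (p i) \<rightarrow>\<^sub>M subprob_algebra mark_space"
  by (simp add: space_subprob_algebra prob_space_imp_subprob_space
      prob_space.prob_space_distr[OF prob_space_K measurable_Pair_K])

lemma nn_integral_\<kappa>:
  assumes [measurable]: "g \<in> borel_measurable mark_space"
  shows "(\<integral>\<^sup>+e. g e \<partial>\<kappa> i) = (\<integral>\<^sup>+s. \<integral>\<^sup>+z. g (s, z) \<partial>K i s \<partial>measure_pmf (p i))"
  unfolding \<kappa>_def
  by (subst nn_integral_bind[OF assms kernel_K]) (simp add: nn_integral_distr measurable_Pair_K)

lemma sets_\<kappa> [simp, measurable_cong]: "sets (\<kappa> i) = sets mark_space"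
  unfolding \<kappa>_def by (rule sets_bind) auto

lemma space_\<kappa> [simp]: "space (\<kappa> i) = UNIV"
  using sets_eq_imp_space_eq[OF sets_\<kappa>] by simp

lemma emeasure_\<kappa>_UNIV: "emeasure (\<kappa> i) UNIV = 1"
proof -
  have "emeasure (\<kappa> i) UNIV = (\<integral>\<^sup>+e. 1 \<partial>\<kappa> i)" by simp
  also have "\<dots> = (\<integral>\<^sup>+s. \<integral>\<^sup>+z. 1 \<partial>K i s \<partial>measure_pmf (p i))"
    by (rule nn_integral_\<kappa>) simp
  also have "\<dots> = 1"
    using prob_space.emeasure_space_1[OF prob_space_K] by (simp add: measure_pmf.emeasure_space_1[simplified])
  finally show ?thesis .
qed

lemma path_event [measurable]: "{w \<in> space N. \<forall>k\<le>n. M k w = x k} \<in> sets N"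
proof -
  note measurable_M [measurable]
  show ?thesis by measurable
qed

lemma path_prob:
  "measure (P i) {w \<in> space N. \<forall>k\<le>n. M k w = x k}
    = (if x 0 = i then \<Prod>k<n. pmf (p (x k)) (x (Suc k)) else 0)"
proof (induction n)
  case 0
  interpret prob_space "P i" by (rule prob_space_P)
  show ?case
  proof (cases "x 0 = i")
    case True
    have "AE w in P i. w \<in> {w \<in> space N. \<forall>k\<le>0. M k w = x k}"
      using initial_state[of i] AE_space by eventually_elim (simp add: True)
    then have "prob {w \<in> space N. \<forall>k\<le>0. M k w = x k} = 1"
      by (rule prob_eq_1[THEN iffD2, rotated]) (unfold sets_P, rule path_event)
    then show ?thesis using True by simp
  next
    case False
    have "AE w in P i. w \<notin> {w \<in> space N. \<forall>k\<le>0. M k w = x k}"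
      using initial_state[of i] by eventually_elim (use False in auto)
    then have "prob {w \<in> space N. \<forall>k\<le>0. M k w = x k} = 0"
      by (rule prob_eq_0[THEN iffD2, rotated]) (unfold sets_P, rule path_event)
    then show ?thesis using False by simp
  qed
next
  case (Suc n)
  then show ?case by (simp add: markov_property)
qed

lemma subalgebra_path: "subalgebra (P i) (path_algebra N M)"
proof -
  have "(\<lambda>w n. M n w) \<in> N \<rightarrow>\<^sub>M (\<Pi>\<^sub>M n\<in>UNIV. count_space UNIV)"
    by (rule measurable_seq_of_components) (rule measurable_M)
  then show ?thesis
    by (auto simp: subalgebra_def path_algebra_def sets_P sets_vimage_algebra2 space_PiM
        dest: measurable_sets)
qed

lemma path_event_path_algebra: "{w \<in> space N. \<forall>k\<le>n. M k w = x k} \<in> sets (path_algebra N M)"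
proof -
  let ?S = "\<Pi>\<^sub>M n\<in>(UNIV :: nat set). (count_space UNIV :: 's measure)"
  have eq: "{w \<in> space N. \<forall>k\<le>n. M k w = x k}
      = (\<lambda>w n. M n w) -` {m \<in> space ?S. \<forall>k\<le>n. m k = x k} \<inter> space N"
    by (auto simp: space_PiM)
  have "{m \<in> space ?S. \<forall>k\<le>n. m k = x k} \<in> sets ?S" by measurable
  then show ?thesis
    unfolding path_algebra_def eq by (rule in_vimage_algebra)
qed

text \<open>The event that the chain follows x up to time n belongs to the path algebra, and on it
  the conditional probability of the marks is the constant \<open>?c\<close>. Integrating over this
  event turns the conditional expectation into an elementary product.\<close>

lemma path_marks_prob:
  assumes D: "\<And>k. D k \<in> sets (borel :: (real \<times> real) measure)"
  shows "measure (P i) {w \<in> space N. (\<forall>k\<le>n. M k w = x k) \<and> (\<forall>k\<in>{1..n}. (A k w, B k w) \<in> D k)}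
    = (if x 0 = i then \<Prod>k<n. pmf (p (x k)) (x (Suc k)) * measure (K (x k) (x (Suc k))) (D (Suc k)) else 0)"
proof -
  interpret P: prob_space "P i" by (rule prob_space_P)
  interpret finite_measure_subalgebra "P i" "path_algebra N M"
    by unfold_locales (rule subalgebra_path)
  let ?A = "{w \<in> space N. \<forall>k\<le>n. M k w = x k}"
  let ?B = "{w \<in> space N. \<forall>k\<in>{1..n}. (A k w, B k w) \<in> D k}"
  let ?c = "\<Prod>k=1..n. measure (K (x (k - 1)) (x k)) (D k)"
  have B: "?B \<in> sets (P i)"
  proof -
    have "{w \<in> space N. (A k w, B k w) \<in> D k} \<in> sets N" if "k \<in> {1..n}" for k
    proof -
      have "(\<lambda>w. (A k w, B k w)) \<in> borel_measurable N"
        using that by (intro borel_measurable_Pair measurable_A measurable_B) auto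
      then have "(\<lambda>w. (A k w, B k w)) -` D k \<inter> space N \<in> sets N"
        using D by (rule measurable_sets)
      moreover have "(\<lambda>w. (A k w, B k w)) -` D k \<inter> space N = {w \<in> space N. (A k w, B k w) \<in> D k}"
        by auto
      ultimately show ?thesis by simp
    qed
    then have "{w \<in> space N. \<forall>k\<in>{1..n}. (A k w, B k w) \<in> D k} \<in> sets N"
      by (intro sets.sets_Collect_finite_All) auto
    then show ?thesis by (simp add: sets_P)
  qed
  have A: "?A \<in> sets (P i)" by (unfold sets_P, rule path_event)
  have "measure (P i) (?A \<inter> ?B) = (\<integral>w. indicator (?A \<inter> ?B) w \<partial>P i)"
    by (simp only: Bochner_Integration.integral_indicator
        Int_absorb2[OF sets.sets_into_space[OF sets.Int[OF A B]]])
  also have "\<dots> = (\<integral>w\<in>?A. indicator ?B w \<partial>P i)"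
    unfolding set_lebesgue_integral_def
    by (intro Bochner_Integration.integral_cong refl) (simp split: split_indicator)
  also have "\<dots> = (\<integral>w\<in>?A. real_cond_exp (P i) (path_algebra N M) (indicator ?B) w \<partial>P i)"
    using B by (intro real_cond_exp_intA path_event_path_algebra) (simp add: P.emeasure_eq_measure)
  also have "\<dots> = (\<integral>w\<in>?A. ?c \<partial>P i)"
    unfolding set_lebesgue_integral_def
  proof (rule integral_cong_AE)
    show "AE w in P i. indicat_real ?A w *\<^sub>R real_cond_exp (P i) (path_algebra N M) (indicator ?B) w
      = indicat_real ?A w *\<^sub>R ?c"
      using modulated[where i = i and n = n and D = D, OF D]
    proof eventually_elim
      case (elim w)
      show ?case
      proof (cases "w \<in> ?A")
        case True
        then have M_eq: "M k w = x k" if "k \<le> n" for k using that by blast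
        have "(\<Prod>k=1..n. measure (K (M (k - 1) w) (M k w)) (D k)) = ?c"
          by (rule prod.cong[OF refl]) (subst (1 2) M_eq, auto)
        then show ?thesis unfolding elim by (rule arg_cong)
      next
        case False
        then have ind: "indicat_real ?A w = 0" by (rule indicator_simps(2))
        show ?thesis unfolding ind by simp
      qed
    qed
    show "(\<lambda>w. indicat_real ?A w *\<^sub>R real_cond_exp (P i) (path_algebra N M) (indicator ?B) w) \<in> borel_measurable (P i)"
      using A by measurable
    show "(\<lambda>w. indicat_real ?A w *\<^sub>R ?c) \<in> borel_measurable (P i)"
      using A by measurable
  qed
  also have "\<dots> = measure (P i) ?A * ?c"
    by (rule P.set_integral_const_real[OF A])
  also have "?c = (\<Prod>k<n. measure (K (x k) (x (Suc k))) (D (Suc k)))"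
    by (rule prod.reindex_bij_witness[of _ Suc "\<lambda>k. k - 1"]) auto
  finally have main: "measure (P i) (?A \<inter> ?B) = measure (P i) ?A * (\<Prod>k<n. measure (K (x k) (x (Suc k))) (D (Suc k)))" .
  have eq: "?A \<inter> ?B = {w \<in> space N. (\<forall>k\<le>n. M k w = x k) \<and> (\<forall>k\<in>{1..n}. (A k w, B k w) \<in> D k)}"
    by blast
  show ?thesis
    unfolding eq[symmetric] main path_prob by (simp add: prod.distrib)
qed

text \<open>The probability of a rectangle, computed by conditioning on the first mark. Since the
  recursion runs from the front, it has the same shape as the one-step decomposition of
  \<open>Q\<close>.\<close>

primrec rect_prob :: "nat \<Rightarrow> (nat \<Rightarrow> 's mark set) \<Rightarrow> 's \<Rightarrow> ennreal" where
  "rect_prob 0 C s = 1"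
| "rect_prob (Suc n) C s = (\<integral>\<^sup>+e. indicator (C 0) e * rect_prob n (\<lambda>k. C (Suc k)) (fst e) \<partial>\<kappa> s)"

lemma measurable_fst_mark: "(\<lambda>e. g (fst e)) \<in> borel_measurable mark_space"
  by (rule measurable_compose[OF measurable_fst]) simp

lemma rect_prob_Suc:
  assumes C: "C 0 \<in> sets mark_space"
  shows "rect_prob (Suc n) C s = (\<integral>\<^sup>+s'. ennreal (pmf (p s) s') *
    (emeasure (K s s') {z. (s', z) \<in> C 0} * rect_prob n (\<lambda>k. C (Suc k)) s') \<partial>count_space UNIV)"
proof -
  have "rect_prob (Suc n) C s
    = (\<integral>\<^sup>+s'. \<integral>\<^sup>+z. indicator (C 0) (s', z) * rect_prob n (\<lambda>k. C (Suc k)) s' \<partial>K s s' \<partial>measure_pmf (p s))"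
    unfolding rect_prob.simps
    by (subst nn_integral_\<kappa>)
      (intro borel_measurable_times_ennreal borel_measurable_indicator measurable_fst_mark C, simp only: fst_conv)
  also have "\<dots> = (\<integral>\<^sup>+s'. emeasure (K s s') {z. (s', z) \<in> C 0} * rect_prob n (\<lambda>k. C (Suc k)) s' \<partial>measure_pmf (p s))"
  proof (rule nn_integral_cong)
    fix s'
    have slice: "{z. (s', z) \<in> C 0} \<in> sets (K s s')"
      using measurable_sets[OF measurable_Pair_K[of s' s s'] C] by (simp only: vimage_def space_K Int_UNIV_right)
    have "(\<integral>\<^sup>+z. indicator (C 0) (s', z) * rect_prob n (\<lambda>k. C (Suc k)) s' \<partial>K s s')
      = (\<integral>\<^sup>+z. indicator {z. (s', z) \<in> C 0} z * rect_prob n (\<lambda>k. C (Suc k)) s' \<partial>K s s')"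
      by (intro nn_integral_cong) (auto split: split_indicator)
    also have "\<dots> = emeasure (K s s') {z. (s', z) \<in> C 0} * rect_prob n (\<lambda>k. C (Suc k)) s'"
      by (subst nn_integral_multc)
        (simp_all only: nn_integral_indicator[OF slice] borel_measurable_indicator[OF slice])
    finally show "(\<integral>\<^sup>+z. indicator (C 0) (s', z) * rect_prob n (\<lambda>k. C (Suc k)) s' \<partial>K s s')
      = emeasure (K s s') {z. (s', z) \<in> C 0} * rect_prob n (\<lambda>k. C (Suc k)) s'" .
  qed
  finally show ?thesis by (simp only: nn_integral_measure_pmf)
qed

lemma all_less_Suc_iff: "(\<forall>k<n. R (Suc k)) \<longleftrightarrow> (\<forall>k\<in>{1..n}. R k)"
proof
  assume *: "\<forall>k<n. R (Suc k)"
  show "\<forall>k\<in>{1..n}. R k"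
  proof
    fix k assume "k \<in> {1..n}"
    then have "k - 1 < n" "Suc (k - 1) = k" by auto
    with * show "R k" by metis
  qed
qed auto

definition path_weight :: "'s \<Rightarrow> (nat \<Rightarrow> 's mark set) \<Rightarrow> nat \<Rightarrow> (nat \<Rightarrow> 's) \<Rightarrow> ennreal" where
  "path_weight i C m x = (if x 0 = i then \<Prod>k<m. ennreal (pmf (p (x k)) (x (Suc k))) *
    emeasure (K (x k) (x (Suc k))) {z. (x (Suc k), z) \<in> C k} else 0)"

text \<open>The identity interpolates between m = n, where everything is the explicit product of
  \<open>path_marks_prob\<close>, and m = 0, where everything is \<open>rect_prob\<close>. Lowering
  m by one sums over the state at time m + 1 and folds one transition into the recursion.\<close>

lemma path_rect_prob:
  assumes C: "\<And>k. C k \<in> sets mark_space" and "m \<le> n"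
  shows "emeasure (P i) {w \<in> space N. (\<forall>k\<le>m. M k w = x k) \<and> (\<forall>k<n. marks w k \<in> C k)}
    = path_weight i C m x * rect_prob (n - m) (\<lambda>k. C (m + k)) (x m)"
  using \<open>m \<le> n\<close>
proof (induction m arbitrary: x rule: inc_induct)
  case base
  interpret P: prob_space "P i" by (rule prob_space_P)
  interpret K: prob_space "K i j" for i j by (rule prob_space_K)
  define D where "D k = {z. (x k, z) \<in> C (k - 1)}" for k
  have D: "D k \<in> sets borel" for k
    using measurable_sets[OF measurable_Pair_K[of "x k"] C[of "k - 1"]] sets_K
    by (simp only: vimage_def D_def space_K Int_UNIV_right)
  have eq: "{w \<in> space N. (\<forall>k\<le>n. M k w = x k) \<and> (\<forall>k<n. marks w k \<in> C k)}
    = {w \<in> space N. (\<forall>k\<le>n. M k w = x k) \<and> (\<forall>k\<in>{1..n}. (A k w, B k w) \<in> D k)}"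
  proof (intro Collect_cong conj_cong refl)
    fix w assume "\<forall>k\<le>n. M k w = x k"
    then have "(\<forall>k<n. marks w k \<in> C k) \<longleftrightarrow> (\<forall>k<n. (A (Suc k) w, B (Suc k) w) \<in> D (Suc k))"
      by (auto simp: marks_def D_def)
    also have "\<dots> \<longleftrightarrow> (\<forall>k\<in>{1..n}. (A k w, B k w) \<in> D k)"
      by (rule all_less_Suc_iff)
    finally show "(\<forall>k<n. marks w k \<in> C k) \<longleftrightarrow> (\<forall>k\<in>{1..n}. (A k w, B k w) \<in> D k)" .
  qed
  show ?case
    unfolding eq P.emeasure_eq_measure path_marks_prob[OF D] K.emeasure_eq_measure diff_self_eq_0
      rect_prob.simps path_weight_def
    by (auto simp: D_def ennreal_mult prod_ennreal[symmetric] prod_nonneg)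
next
  case (step m)
  define Ev where "Ev s = {w \<in> space N. (\<forall>k\<le>Suc m. M k w = (x(Suc m := s)) k) \<and> (\<forall>k<n. marks w k \<in> C k)}" for s
  have meas: "Ev s \<in> sets (P i)" for s
  proof -
    have "{w \<in> space N. marks w k \<in> C k} \<in> sets N" for k
      using measurable_marks C[of k] by measurable
    then have "{w \<in> space N. (\<forall>k\<le>Suc m. M k w = (x(Suc m := s)) k) \<and> (\<forall>k<n. marks w k \<in> C k)} \<in> sets N"
      by (intro sets.sets_Collect_conj path_event sets.sets_Collect_countable_All sets.sets_Collect_imp
          sets.sets_Collect_const)
    then show ?thesis unfolding Ev_def sets_P .
  qed
  have "{w \<in> space N. (\<forall>k\<le>m. M k w = x k) \<and> (\<forall>k<n. marks w k \<in> C k)} = (\<Union>s. Ev s)"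
    unfolding Ev_def by (auto simp: le_Suc_eq)
  also have "emeasure (P i) (\<Union>s. Ev s) = (\<integral>\<^sup>+s. emeasure (P i) (Ev s) \<partial>count_space UNIV)"
  proof (rule emeasure_UN_countable)
    show "disjoint_family_on Ev UNIV"
      unfolding disjoint_family_on_def Ev_def by auto
  qed (use meas in auto)
  also have "\<dots> = (\<integral>\<^sup>+s. path_weight i C m x * (ennreal (pmf (p (x m)) s) * (emeasure (K (x m) s) {z. (s, z) \<in> C m} *
        rect_prob (n - Suc m) (\<lambda>k. C (Suc m + k)) s)) \<partial>count_space UNIV)"
    unfolding Ev_def step.IH path_weight_def by (intro nn_integral_cong) (auto simp: mult_ac intro!: prod.cong arg_cong2[where f = "(*)"])
  also have "\<dots> = path_weight i C m x * rect_prob (Suc (n - Suc m)) (\<lambda>k. C (m + k)) (x m)"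
    by (subst nn_integral_cmult) (simp_all add: rect_prob_Suc C del: rect_prob.simps)
  also have "Suc (n - Suc m) = n - m" using step.hyps by simp
  finally show ?case .
qed

lemma emeasure_Q_rect:
  assumes C: "\<And>k. C k \<in> sets mark_space"
  shows "emeasure (Q i) {x. \<forall>k<n. x k \<in> C k} = rect_prob n C i"
proof -
  note [measurable] = C
  have "{x \<in> space mark_seqs. \<forall>k<n. x k \<in> C k} \<in> sets mark_seqs" by measurable
  then have "emeasure (Q i) {x. \<forall>k<n. x k \<in> C k} = emeasure (P i) {w \<in> space N. \<forall>k<n. marks w k \<in> C k}"
    unfolding Q_def by (subst emeasure_distr) (auto intro!: measurable_P arg_cong[where f = "emeasure (P i)"])
  also have "\<dots> = emeasure (P i) {w \<in> space N. (\<forall>k\<le>0. M k w = i) \<and> (\<forall>k<n. marks w k \<in> C k)}"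
  proof (rule emeasure_eq_AE)
    have [measurable]: "{w \<in> space N. marks w k \<in> C k} \<in> sets N" for k by measurable
    show "{w \<in> space N. \<forall>k<n. marks w k \<in> C k} \<in> sets (P i)"
      unfolding sets_P by measurable
    have "{w \<in> space N. (\<forall>k\<le>0. M k w = (\<lambda>_. i) k) \<and> (\<forall>k<n. marks w k \<in> C k)} \<in> sets N"
      by (intro sets.sets_Collect_conj path_event) measurable
    then show "{w \<in> space N. (\<forall>k\<le>0. M k w = i) \<and> (\<forall>k<n. marks w k \<in> C k)} \<in> sets (P i)"
      by (simp add: sets_P)
    show "AE w in P i. w \<in> {w \<in> space N. \<forall>k<n. marks w k \<in> C k} \<longleftrightarrow>
      w \<in> {w \<in> space N. (\<forall>k\<le>0. M k w = i) \<and> (\<forall>k<n. marks w k \<in> C k)}"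
      using initial_state[of i] by eventually_elim auto
  qed
  also have "\<dots> = rect_prob n C i"
    using path_rect_prob[OF C, of 0 n i "\<lambda>_. i"] by (simp add: path_weight_def)
  finally show ?thesis .
qed

end

section \<open>The Markov property as an identity of integrals\<close>

context markov_modulated
begin

lemma step_kernel:
  "(\<lambda>e. distr (Q (fst e)) mark_seqs (case_nat e)) \<in> \<kappa> i \<rightarrow>\<^sub>M subprob_algebra mark_seqs"
proof -
  have "(\<lambda>e. Q (fst e)) \<in> mark_space \<rightarrow>\<^sub>M subprob_algebra mark_seqs"
    by (rule measurable_compose[OF measurable_fst measurable_Q])
  then have "(\<lambda>e. distr (Q (fst e)) mark_seqs (case_nat e)) \<in> mark_space \<rightarrow>\<^sub>M subprob_algebra mark_seqs"
    by (rule measurable_distr2[rotated]) measurable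
  then show ?thesis using measurable_cong_sets[OF sets_\<kappa> refl] by blast
qed

lemma measurable_case_nat_mark: "case_nat e \<in> mark_seqs \<rightarrow>\<^sub>M mark_seqs"
  by (rule measurable_seq_of_components) (auto split: nat.split)

text \<open>On rectangles both sides obey the first-mark recursion of \<open>rect_prob\<close>. This
  decomposition is the source of every later use of the Markov property.\<close>

lemma Q_step: "Q i = \<kappa> i \<bind> (\<lambda>e. distr (Q (fst e)) mark_seqs (case_nat e))" (is "_ = ?R")
proof (rule measure_eqI_rectangles[where E = mark_space])
  interpret prob_space "Q i" by (rule prob_space_Q)
  show "finite_measure (Q i)" by unfold_locales
  show "sets ?R = sets mark_seqs" by (rule sets_bind) auto
  fix n and D :: "nat \<Rightarrow> 's mark set"
  assume D [measurable]: "\<And>k. D k \<in> sets mark_space"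
  have "{x \<in> space mark_seqs. \<forall>k<n. x k \<in> D k} \<in> sets mark_seqs" by measurable
  then have rect: "{x. \<forall>k<n. x k \<in> D k} \<in> sets mark_seqs" by simp
  have "emeasure ?R {x. \<forall>k<n. x k \<in> D k}
    = (\<integral>\<^sup>+e. emeasure (distr (Q (fst e)) mark_seqs (case_nat e)) {x. \<forall>k<n. x k \<in> D k} \<partial>\<kappa> i)"
    by (rule emeasure_bind[OF _ step_kernel]) (use rect in auto)
  also have "\<dots> = (\<integral>\<^sup>+e. emeasure (Q (fst e)) {y. \<forall>k<n. case_nat e y k \<in> D k} \<partial>\<kappa> i)"
  proof (rule nn_integral_cong)
    fix e
    have "case_nat e -` {x. \<forall>k<n. x k \<in> D k} \<inter> space (Q (fst e)) = {y. \<forall>k<n. case_nat e y k \<in> D k}"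
      by (simp only: space_Q vimage_def Int_UNIV_right mem_Collect_eq)
    then show "emeasure (distr (Q (fst e)) mark_seqs (case_nat e)) {x. \<forall>k<n. x k \<in> D k}
      = emeasure (Q (fst e)) {y. \<forall>k<n. case_nat e y k \<in> D k}"
      using rect measurable_case_nat_mark by (subst emeasure_distr) (auto cong: measurable_cong_sets)
  qed
  also have "\<dots> = rect_prob n D i"
  proof (cases n)
    case 0
    then show ?thesis
      using prob_space.emeasure_space_1[OF prob_space_Q] by (simp add: emeasure_\<kappa>_UNIV)
  next
    case (Suc m)
    have "emeasure (Q (fst e)) {y. \<forall>k<n. case_nat e y k \<in> D k}
      = indicator (D 0) e * rect_prob m (\<lambda>k. D (Suc k)) (fst e)" for e
    proof (cases "e \<in> D 0")
      case True
      then have "{y. \<forall>k<n. case_nat e y k \<in> D k} = {y. \<forall>k<m. y k \<in> D (Suc k)}"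
        by (auto simp: Suc All_less_Suc2)
      then show ?thesis
        using emeasure_Q_rect[where C = "\<lambda>k. D (Suc k)" and n = m and i = "fst e"] D True by simp
    next
      case False
      then have eq: "{y. \<forall>k<n. case_nat e y k \<in> D k} = {}" by (auto simp: Suc All_less_Suc2)
      show ?thesis unfolding eq using False by simp
    qed
    then show ?thesis by (simp add: Suc)
  qed
  finally show "emeasure (Q i) {x \<in> space mark_seqs. \<forall>k<n. x k \<in> D k}
    = emeasure ?R {x \<in> space mark_seqs. \<forall>k<n. x k \<in> D k}"
    using emeasure_Q_rect[OF D, where n = n and i = i] by simp
qed simp

lemma measurable_Qf: "f \<in> borel_measurable mark_seqs \<Longrightarrow> f \<in> borel_measurable (Q i)"
  by (simp cong: measurable_cong_sets)

lemma nn_integral_Q_step: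
  assumes f: "f \<in> borel_measurable mark_seqs"
  shows "(\<integral>\<^sup>+x. f x \<partial>Q i) = (\<integral>\<^sup>+e. \<integral>\<^sup>+y. f (case_nat e y) \<partial>Q (fst e) \<partial>\<kappa> i)"
proof -
  have "(\<integral>\<^sup>+x. f x \<partial>Q i) = (\<integral>\<^sup>+e. \<integral>\<^sup>+x. f x \<partial>distr (Q (fst e)) mark_seqs (case_nat e) \<partial>\<kappa> i)"
    by (subst Q_step) (rule nn_integral_bind[OF f step_kernel])
  also have "\<dots> = (\<integral>\<^sup>+e. \<integral>\<^sup>+y. f (case_nat e y) \<partial>Q (fst e) \<partial>\<kappa> i)"
    using f measurable_case_nat_mark
    by (intro nn_integral_cong nn_integral_distr) (auto cong: measurable_cong_sets)
  finally show ?thesis .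
qed

lemma nn_integral_Q_const: "(\<integral>\<^sup>+x. c \<partial>Q i) = c"
  using prob_space.emeasure_space_1[OF prob_space_Q[of i]] by simp

lemma nn_integral_Q_first:
  assumes [measurable]: "g \<in> borel_measurable mark_space"
  shows "(\<integral>\<^sup>+x. g (x 0) \<partial>Q i) = (\<integral>\<^sup>+e. g e \<partial>\<kappa> i)"
  by (subst nn_integral_Q_step) (simp_all add: nn_integral_Q_const del: nn_integral_const)

lemma measurable_kernel_integral:
  assumes s: "s \<in> L \<rightarrow>\<^sub>M count_space UNIV"
    and f: "(\<lambda>(w, y). f w y) \<in> borel_measurable (L \<Otimes>\<^sub>M mark_seqs)"
  shows "(\<lambda>w. \<integral>\<^sup>+y. f w y \<partial>Q (s w)) \<in> borel_measurable L"
  by (rule nn_integral_measurable_subprob_algebra2[OF f]) (rule measurable_compose[OF s measurable_Q])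

lemma measurable_state_at [measurable]: "state_at i n \<in> mark_seqs \<rightarrow>\<^sub>M count_space UNIV"
  by (cases n) (simp_all add: state_at_def[abs_def])

text \<open>Everything after the first n marks is resampled from the current state. For the
  induction step, the resampled continuation is split into its first mark and the rest; integrating
  out the rest leaves a function g of n + 1 marks, and the induction hypothesis is applied a second
  time, backwards, to g.\<close>

lemma nn_integral_Q_markov:
  assumes f [measurable]: "f \<in> borel_measurable mark_seqs"
  shows "(\<integral>\<^sup>+x. f x \<partial>Q i) = (\<integral>\<^sup>+x. \<integral>\<^sup>+y. f (comb_seq n x y) \<partial>Q (state_at i n x) \<partial>Q i)"
  using assms
proof (induction n arbitrary: f)
  case 0
  then show ?case by (simp add: comb_seq_0 nn_integral_Q_const del: nn_integral_const)
next
  case (Suc n)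
  note f [measurable] = Suc.prems
  define g where "g x = (\<integral>\<^sup>+y. f (comb_seq (Suc n) x y) \<partial>Q (fst (x n)))" for x
  have g: "g \<in> borel_measurable mark_seqs"
    unfolding g_def by (rule measurable_kernel_integral) measurable
  have "(\<integral>\<^sup>+x. f x \<partial>Q i) = (\<integral>\<^sup>+x. \<integral>\<^sup>+y. f (comb_seq n x y) \<partial>Q (state_at i n x) \<partial>Q i)"
    by (rule Suc.IH[OF f])
  also have "\<dots> = (\<integral>\<^sup>+x. \<integral>\<^sup>+e. \<integral>\<^sup>+y. f (comb_seq n x (case_nat e y)) \<partial>Q (fst e) \<partial>\<kappa> (state_at i n x) \<partial>Q i)"
  proof (rule nn_integral_cong, rule nn_integral_Q_step)
    fix x :: "nat \<Rightarrow> 's mark"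
    have "comb_seq n x \<in> mark_seqs \<rightarrow>\<^sub>M mark_seqs"
      by (rule measurable_seq_of_components) (simp add: comb_seq_def)
    then show "(\<lambda>y. f (comb_seq n x y)) \<in> borel_measurable mark_seqs"
      using f by (rule measurable_compose)
  qed
  also have "\<dots> = (\<integral>\<^sup>+x. \<integral>\<^sup>+y'. g (comb_seq n x y') \<partial>Q (state_at i n x) \<partial>Q i)"
  proof (rule nn_integral_cong)
    fix x :: "nat \<Rightarrow> 's mark"
    define h where "h e = (\<integral>\<^sup>+y. f (comb_seq n x (case_nat e y)) \<partial>Q (fst e))" for e
    have h: "h \<in> borel_measurable mark_space"
      unfolding h_def
    proof (rule measurable_kernel_integral)
      have "(\<lambda>(e, y). comb_seq n x (case_nat e y)) \<in> mark_space \<Otimes>\<^sub>M mark_seqs \<rightarrow>\<^sub>M mark_seqs"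
        unfolding split_beta'
        by (rule measurable_seq_of_components) (auto simp: comb_seq_def split: nat.split)
      from measurable_compose[OF this f]
      show "(\<lambda>(e, y). f (comb_seq n x (case_nat e y))) \<in> borel_measurable (mark_space \<Otimes>\<^sub>M mark_seqs)"
        by (simp add: split_beta')
    qed measurable
    \<comment> \<open>g resamples all marks beyond index n, so only the first mark of the
      continuation survives in it.\<close>
    have "g (comb_seq n x y') = h (y' 0)" for y'
    proof -
      have "comb_seq (Suc n) (comb_seq n x y') y = comb_seq n x (case_nat (y' 0) y)" for y
        unfolding comb_seq_Suc by (simp add: comb_seq_def fun_eq_iff)
      moreover have "comb_seq n x y' n = y' 0" by (simp add: comb_seq_def)
      ultimately show ?thesis by (simp only: g_def h_def)
    qed
    then show "(\<integral>\<^sup>+e. \<integral>\<^sup>+y. f (comb_seq n x (case_nat e y)) \<partial>Q (fst e) \<partial>\<kappa> (state_at i n x))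
      = (\<integral>\<^sup>+y'. g (comb_seq n x y') \<partial>Q (state_at i n x))"
      using nn_integral_Q_first[OF h] by (simp only: h_def)
  qed
  also have "\<dots> = (\<integral>\<^sup>+x. g x \<partial>Q i)"
    by (rule Suc.IH[OF g, symmetric])
  finally show ?case by (simp only: g_def state_at_Suc)
qed

text \<open>Where F does not vanish the state at time n is i, so the continuation has the fixed law
  \<open>Q i\<close> and the integral factorises as for independent sequences.\<close>

lemma markov_prefix_suffix:
  assumes F [measurable]: "F \<in> borel_measurable mark_seqs"
    and G [measurable]: "G \<in> borel_measurable mark_seqs"
    and prefix: "\<And>x y. F (comb_seq n x y) = F x"
    and state: "\<And>x. state_at j n x \<noteq> i \<Longrightarrow> F x = 0"
  shows "(\<integral>\<^sup>+x. F x * G (drop_seq n x) \<partial>Q j) = (\<integral>\<^sup>+x. F x \<partial>Q j) * (\<integral>\<^sup>+x. G x \<partial>Q i)"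
proof -
  have "(\<integral>\<^sup>+x. F x * G (drop_seq n x) \<partial>Q j) = (\<integral>\<^sup>+x. \<integral>\<^sup>+y. F x * G y \<partial>Q (state_at j n x) \<partial>Q j)"
    by (subst nn_integral_Q_markov[where n = n]) (simp_all add: prefix)
  also have "\<dots> = (\<integral>\<^sup>+x. F x * (\<integral>\<^sup>+y. G y \<partial>Q i) \<partial>Q j)"
  proof (rule nn_integral_cong)
    fix x
    show "(\<integral>\<^sup>+y. F x * G y \<partial>Q (state_at j n x)) = F x * (\<integral>\<^sup>+y. G y \<partial>Q i)"
      using state[of x] by (cases "state_at j n x = i") (simp_all add: nn_integral_cmult)
  qed
  also have "\<dots> = (\<integral>\<^sup>+x. F x \<partial>Q j) * (\<integral>\<^sup>+x. G x \<partial>Q i)"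
    by (rule nn_integral_multc) measurable
  finally show ?thesis .
qed

lemma nn_integral_state_at:
  "(\<integral>\<^sup>+x. h (state_at i n x) \<partial>Q i) = (\<integral>\<^sup>+s. h s \<partial>measure_pmf (nstep p n i))"
proof (induction n arbitrary: h)
  case 0
  then show ?case by (simp add: nn_integral_Q_const nn_integral_return_pmf del: nn_integral_const)
next
  case (Suc n)
  have one: "(\<integral>\<^sup>+y. h (fst (y 0)) \<partial>Q s) = (\<integral>\<^sup>+s'. h s' \<partial>measure_pmf (p s))" for s
  proof -
    have "(\<integral>\<^sup>+y. h (fst (y 0)) \<partial>Q s) = (\<integral>\<^sup>+e. h (fst e) \<partial>\<kappa> s)"
      by (rule nn_integral_Q_first) (rule measurable_fst_mark)
    also have "\<dots> = (\<integral>\<^sup>+s'. \<integral>\<^sup>+z. h (fst (s', z)) \<partial>K s s' \<partial>measure_pmf (p s))"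
      by (rule nn_integral_\<kappa>) (rule measurable_fst_mark)
    also have "\<dots> = (\<integral>\<^sup>+s'. h s' \<partial>measure_pmf (p s))"
      using prob_space.emeasure_space_1[OF prob_space_K] by simp
    finally show ?thesis .
  qed
  have "(\<lambda>x. h (fst (x n))) \<in> borel_measurable mark_seqs"
    by (rule measurable_compose[OF _ measurable_fst_mark]) measurable
  then have "(\<integral>\<^sup>+x. h (state_at i (Suc n) x) \<partial>Q i)
      = (\<integral>\<^sup>+x. \<integral>\<^sup>+y. h (fst (comb_seq n x y n)) \<partial>Q (state_at i n x) \<partial>Q i)"
    unfolding state_at_Suc by (rule nn_integral_Q_markov)
  also have "\<dots> = (\<integral>\<^sup>+x. (\<lambda>s. \<integral>\<^sup>+s'. h s' \<partial>measure_pmf (p s)) (state_at i n x) \<partial>Q i)"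
    by (simp add: comb_seq_def one)
  also have "\<dots> = (\<integral>\<^sup>+s. \<integral>\<^sup>+s'. h s' \<partial>measure_pmf (p s) \<partial>measure_pmf (nstep p n i))"
    by (rule Suc.IH)
  also have "\<dots> = (\<integral>\<^sup>+s. h s \<partial>measure_pmf (nstep p (Suc n) i))"
    by (simp add: nn_integral_bind_pmf)
  finally show ?case .
qed

lemma emeasure_state_at: "(\<integral>\<^sup>+x. indicator {j} (state_at i n x) \<partial>Q i) = ennreal (pmf (nstep p n i) j)"
  by (simp add: nn_integral_state_at emeasure_pmf_single)

end

section \<open>Returns to a fixed state\<close>

lemma drop_seq_drop_seq: "drop_seq a (drop_seq b x) = drop_seq (b + a) x"
  by (simp add: drop_seq_def add.assoc)

definition hits :: "'s \<Rightarrow> (nat \<Rightarrow> 's mark) \<Rightarrow> bool" where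
  "hits i x \<longleftrightarrow> (\<exists>n. fst (x n) = i)"

definition first_hit :: "'s \<Rightarrow> nat \<Rightarrow> (nat \<Rightarrow> 's mark) \<Rightarrow> bool" where
  "first_hit i l x \<longleftrightarrow> fst (x l) = i \<and> (\<forall>k<l. fst (x k) \<noteq> i)"

text \<open>The successor appears because mark n belongs to time n + 1. On a path that never visits
  i the value is unspecified but still positive.\<close>

definition ret_time :: "'s \<Rightarrow> (nat \<Rightarrow> 's mark) \<Rightarrow> nat" where
  "ret_time i x = Suc (LEAST n. fst (x n) = i)"

primrec ret_sum :: "'s \<Rightarrow> nat \<Rightarrow> (nat \<Rightarrow> 's mark) \<Rightarrow> nat" where
  "ret_sum i 0 x = 0"
| "ret_sum i (Suc n) x = ret_sum i n x + ret_time i (drop_seq (ret_sum i n x) x)"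

abbreviation after_ret :: "'s \<Rightarrow> nat \<Rightarrow> (nat \<Rightarrow> 's mark) \<Rightarrow> nat \<Rightarrow> 's mark" where
  "after_ret i n x \<equiv> drop_seq (ret_sum i n x) x"

definition recurs :: "'s \<Rightarrow> (nat \<Rightarrow> 's mark) \<Rightarrow> bool" where
  "recurs i x \<longleftrightarrow> (\<forall>n. hits i (drop_seq n x))"

lemma ret_time_pos: "0 < ret_time i x"
  by (simp add: ret_time_def)

lemma ret_sum_ge: "n \<le> ret_sum i n x"
proof (induction n)
  case (Suc n)
  then show ?case using ret_time_pos[of i "after_ret i n x"] by simp
qed simp

lemma drop_random_funpow: "(drop_random (ret_time i) ^^ n) x = after_ret i n x"
  by (induction n) (simp_all add: drop_random_def drop_seq_drop_seq)

lemma first_hit_ret_time: "first_hit i l x \<Longrightarrow> ret_time i x = Suc l"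
  unfolding first_hit_def ret_time_def by (metis (mono_tags, lifting) LeastI not_less_Least linorder_neqE_nat)

lemma hits_first_hit: "hits i x \<Longrightarrow> first_hit i (ret_time i x - 1) x"
  unfolding first_hit_def ret_time_def hits_def by (auto intro: LeastI_ex dest: not_less_Least)

lemma first_hit_hits: "first_hit i l x \<Longrightarrow> hits i x"
  by (auto simp: first_hit_def hits_def)

lemma hits_iff: "hits i x \<longleftrightarrow> (\<exists>l. first_hit i l x)"
proof
  assume "hits i x"
  then show "\<exists>l. first_hit i l x" by (intro exI) (rule hits_first_hit)
qed (auto intro: first_hit_hits)

lemma recurs_of_drop_seq:
  assumes "recurs i (drop_seq l x)"
  shows "recurs i x"
  unfolding recurs_def
proof
  fix n
  have "hits i (drop_seq n (drop_seq l x))" using assms by (simp add: recurs_def)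
  then obtain k where "fst (x (l + (n + k))) = i" by (auto simp: hits_def drop_seq_def)
  then have "fst (drop_seq n x (l + k)) = i" by (simp add: drop_seq_def add.left_commute)
  then show "hits i (drop_seq n x)" by (auto simp: hits_def)
qed

text \<open>Every iterate moves on by at least one index, so a visit after n iterates lies beyond
  index n.\<close>

lemma recurs_iff_iterates: "recurs i x \<longleftrightarrow> (\<forall>n. hits i ((drop_random (ret_time i) ^^ n) x))"
proof
  assume *: "\<forall>n. hits i ((drop_random (ret_time i) ^^ n) x)"
  show "recurs i x"
    unfolding recurs_def
  proof
    fix n
    obtain k where k: "fst (x (ret_sum i n x + k)) = i"
      using *[rule_format, of n] by (auto simp: drop_random_funpow hits_def drop_seq_def)
    have "n \<le> ret_sum i n x" by (rule ret_sum_ge)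
    then have "ret_sum i n x + k = n + (ret_sum i n x - n + k)" by simp
    with k have "fst (drop_seq n x (ret_sum i n x - n + k)) = i" by (simp only: drop_seq_def)
    then show "hits i (drop_seq n x)" unfolding hits_def by blast
  qed
qed (simp add: recurs_def drop_random_funpow)

lemma measurable_first_hit [measurable]: "Measurable.pred mark_seqs (first_hit i l)"
proof -
  have [measurable]: "Measurable.pred mark_seqs (\<lambda>x. fst (x k) = i)" for k
    by (rule measurable_compose[OF _ measurable_count_space]) measurable
  show ?thesis unfolding first_hit_def[abs_def] by measurable
qed

lemma measurable_ret_time [measurable]: "ret_time i \<in> mark_seqs \<rightarrow>\<^sub>M count_space UNIV"
proof -
  have [measurable]: "Measurable.pred mark_seqs (\<lambda>x. fst (x k) = i)" for k
    by (rule measurable_compose[OF _ measurable_count_space]) measurable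
  show ?thesis unfolding ret_time_def[abs_def] by measurable
qed

lemma first_hit_prefix: "l < n \<Longrightarrow> first_hit i l (comb_seq n x y) = first_hit i l x"
  by (simp add: first_hit_def comb_seq_def)

section \<open>Recurrence and the strong Markov property at visits\<close>

context markov_modulated
begin

text \<open>Going back from \<open>P i\<close> to \<open>Q i\<close> takes a measurable event;
  limits are put into countable form later for this purpose.\<close>

lemma AE_Q_iff:
  assumes "Measurable.pred mark_seqs F"
  shows "(AE x in Q i. F x) \<longleftrightarrow> (AE w in P i. F (marks w))"
  unfolding Q_def
  by (rule AE_distr_iff) (use assms measurable_P[OF measurable_marks] in \<open>auto simp: pred_def\<close>)

lemma AE_Q_D: "(AE x in Q i. F x) \<Longrightarrow> (AE w in P i. F (marks w))"
  unfolding Q_def by (rule AE_distrD[where P = F, OF measurable_P[OF measurable_marks]])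

lemma tau_eq_of_hits:
  assumes "\<And>m. m < n \<Longrightarrow> hits i (drop_seq (ret_sum i m (marks w)) (marks w))"
  shows "tau M i n w = enat (ret_sum i n (marks w))"
  using assms
proof (induction n)
  case 0
  then show ?case by (simp add: zero_enat_def)
next
  case (Suc n)
  define r where "r = ret_sum i n (marks w)"
  define t where "t = ret_time i (drop_seq r (marks w))"
  have fh: "first_hit i (t - 1) (drop_seq r (marks w))"
    using hits_first_hit[of i "drop_seq r (marks w)"] Suc.prems[of n] by (simp add: r_def t_def)
  have t: "0 < t" by (simp add: t_def ret_time_pos)
  have "Inf {enat k |k. enat k > enat r \<and> M k w = i} = enat (r + t)"
  proof (rule Inf_eqI)
    fix e assume "e \<in> {enat k |k. enat k > enat r \<and> M k w = i}"
    then obtain k where k: "e = enat k" "r < k" "M k w = i" by auto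
    have "\<not> k < r + t"
    proof
      assume "k < r + t"
      then have "k - Suc r < t - 1" using k by simp
      then have "fst (drop_seq r (marks w) (k - Suc r)) \<noteq> i"
        using fh unfolding first_hit_def by blast
      moreover have "Suc (r + (k - Suc r)) = k" using k by simp
      ultimately show False using k by (simp add: drop_seq_def marks_def)
    qed
    then show "enat (r + t) \<le> e" using k by simp
  next
    fix e assume *: "\<And>e'. e' \<in> {enat k |k. enat k > enat r \<and> M k w = i} \<Longrightarrow> e \<le> e'"
    have "M (r + t) w = i"
      using fh t by (simp add: first_hit_def drop_seq_def marks_def)
    then show "e \<le> enat (r + t)" using t by (intro *) auto
  qed
  then show ?case using Suc by (simp add: r_def t_def)
qed

lemma tau_eq: "recurs i (marks w) \<Longrightarrow> tau M i n w = enat (ret_sum i n (marks w))"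
  by (rule tau_eq_of_hits) (simp add: recurs_def)

lemma tau_1_eq: "hits i (marks w) \<Longrightarrow> tau M i 1 w = enat (ret_time i (marks w))"
  using tau_eq_of_hits[of 1 i w] by simp

lemma tau_1_eq_infinity:
  assumes "\<not> hits i (marks w)"
  shows "tau M i 1 w = \<infinity>"
proof -
  have "M k w \<noteq> i" if "0 < k" for k
  proof
    assume "M k w = i"
    then have "fst (marks w (k - 1)) = i" using that by (simp add: marks_def)
    then show False using assms by (auto simp: hits_def)
  qed
  then have empty: "{enat k |k. enat k > 0 \<and> M k w = i} = {}" by (auto simp: zero_enat_def)
  have "tau M i 1 w = Inf {enat k |k. enat k > 0 \<and> M k w = i}" by simp
  also have "\<dots> = \<infinity>" unfolding empty by (simp add: top_enat_def)
  finally show ?thesis .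
qed

text \<open>Paths without a visit have an infinite return time, so a finite mean return time leaves
  them no mass.\<close>

lemma AE_hits_self: "AE x in Q i. hits i x"
proof -
  let ?N = "{x. \<not> hits i x}"
  have [measurable]: "?N \<in> sets mark_seqs"
  proof -
    have "{x \<in> space mark_seqs. \<forall>l. \<not> first_hit i l x} \<in> sets mark_seqs" by measurable
    then show ?thesis by (simp add: hits_iff)
  qed
  have "\<infinity> * emeasure (Q i) ?N = (\<integral>\<^sup>+x. \<infinity> * indicator ?N x \<partial>Q i)"
    by (simp add: nn_integral_cmult)
  also have "\<dots> = (\<integral>\<^sup>+w. \<infinity> * indicator ?N (marks w) \<partial>P i)"
    unfolding Q_def by (rule nn_integral_distr[OF measurable_P[OF measurable_marks]]) simp
  also have "\<dots> \<le> (\<integral>\<^sup>+w. ennreal_of_enat (tau M i 1 w) \<partial>P i)"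
  proof (rule nn_integral_mono)
    fix w
    show "\<infinity> * indicator ?N (marks w) \<le> ennreal_of_enat (tau M i 1 w)"
    proof (cases "hits i (marks w)")
      case False
      then have "tau M i 1 w = \<infinity>" by (rule tau_1_eq_infinity)
      then show ?thesis by simp
    qed simp
  qed
  also have "\<dots> < \<infinity>" using positive_recurrent by (simp add: positive_recurrent_chain_def)
  finally have "emeasure (Q i) ?N = 0" by (auto simp: ennreal_top_mult split: if_splits)
  then have "AE x in Q i. x \<notin> ?N" by (intro AE_not_in null_setsI) simp_all
  then show ?thesis by simp
qed

lemma nn_integral_ret_time: "(\<integral>\<^sup>+x. of_nat (ret_time i x) \<partial>Q i) < \<infinity>"
proof -
  have "(\<integral>\<^sup>+x. of_nat (ret_time i x) \<partial>Q i) = (\<integral>\<^sup>+w. of_nat (ret_time i (marks w)) \<partial>P i)"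
    unfolding Q_def by (rule nn_integral_distr[OF measurable_P[OF measurable_marks]]) measurable
  also have "\<dots> \<le> (\<integral>\<^sup>+w. ennreal_of_enat (tau M i 1 w) \<partial>P i)"
  proof (rule nn_integral_mono_AE)
    show "AE w in P i. of_nat (ret_time i (marks w)) \<le> ennreal_of_enat (tau M i 1 w)"
      using AE_Q_D[OF AE_hits_self]
    proof eventually_elim
      case (elim w)
      then show ?case by (simp only: tau_1_eq ennreal_of_enat_enat)
    qed
  qed
  also have "\<dots> < \<infinity>" using positive_recurrent by (simp add: positive_recurrent_chain_def)
  finally show ?thesis .
qed

text \<open>The strong Markov property at the first visit to i, for an arbitrary initial state j.
  Splitting by the index l of that visit reduces it to the Markov property at the fixed time l + 1.
  F may be non-measurable, hence the measurable null set U covering its exceptions.\<close>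

lemma AE_after_return:
  assumes "AE x in Q i. F x"
  shows "AE x in Q j. hits i x \<longrightarrow> F (drop_random (ret_time i) x)"
proof -
  from assms obtain U where U: "{x. \<not> F x} \<subseteq> U" "emeasure (Q i) U = 0" "U \<in> sets mark_seqs"
    by (elim AE_E) auto
  note [measurable] = U(3)
  have "AE x in Q j. first_hit i l x \<longrightarrow> F (drop_seq (Suc l) x)" for l
  proof -
    define H where "H = {x \<in> space mark_seqs. first_hit i l x}"
    have [measurable]: "H \<in> sets mark_seqs" unfolding H_def by measurable
    let ?f = "\<lambda>x. indicator H x * indicator U (drop_seq (Suc l) x) :: ennreal"
    have "(\<integral>\<^sup>+x. ?f x \<partial>Q j) = (\<integral>\<^sup>+x. indicator H x \<partial>Q j) * (\<integral>\<^sup>+x. indicator U x \<partial>Q i)"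
    proof (rule markov_prefix_suffix)
      show "indicator H (comb_seq (Suc l) x y) = (indicator H x :: ennreal)" for x y
        by (simp add: H_def indicator_def first_hit_prefix)
      show "state_at j (Suc l) x \<noteq> i \<Longrightarrow> indicator H x = (0::ennreal)" for x
        by (auto simp: H_def first_hit_def)
    qed measurable
    also have "\<dots> = 0" using U by simp
    finally have "(\<integral>\<^sup>+x. ?f x \<partial>Q j) = 0" .
    moreover have "?f \<in> borel_measurable (Q j)" by (rule measurable_Qf) measurable
    ultimately have "AE x in Q j. ?f x = 0" by (simp only: nn_integral_0_iff_AE)
    then show ?thesis
      by eventually_elim (use U(1) in \<open>auto simp: H_def split: split_indicator_asm\<close>)
  qed
  then have "AE x in Q j. \<forall>l. first_hit i l x \<longrightarrow> F (drop_seq (Suc l) x)"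
    by (simp add: AE_all_countable)
  then show ?thesis
  proof eventually_elim
    case (elim x)
    show ?case
    proof
      assume "hits i x"
      then have "first_hit i (ret_time i x - 1) x" by (rule hits_first_hit)
      then have "F (drop_seq (Suc (ret_time i x - 1)) x)" using elim by blast
      then show "F (drop_random (ret_time i) x)"
        using ret_time_pos[of i x] by (simp add: drop_random_def)
    qed
  qed
qed

lemma AE_iterates:
  assumes "AE x in Q i. F x"
  shows "AE x in Q i. \<forall>n. F ((drop_random (ret_time i) ^^ n) x)"
proof -
  have "AE x in Q i. F ((drop_random (ret_time i) ^^ n) x)" for n
  proof (induction n)
    case 0
    then show ?case using assms by simp
  next
    case (Suc n)
    show ?case
      using AE_after_return[OF Suc] AE_hits_self[of i]
      by eventually_elim (simp add: funpow_Suc_right del: funpow.simps)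
  qed
  then show ?thesis by (simp add: AE_all_countable)
qed

lemma AE_recurs_self: "AE x in Q i. recurs i x"
  using AE_iterates[OF AE_hits_self] by (simp add: recurs_iff_iterates)

text \<open>Under \<open>Q i\<close> the state j is occupied at time n with positive probability,
  and the continuation from there has law \<open>Q j\<close>. An exceptional set charged by
  \<open>Q j\<close> would thus be seen from i.\<close>

lemma AE_state_event:
  assumes F: "Measurable.pred mark_seqs F"
    and AE: "AE x in Q i. state_at i n x = j \<longrightarrow> F (drop_seq n x)"
    and pos: "pmf (nstep p n i) j > 0"
  shows "AE x in Q j. F x"
proof -
  let ?U = "{x. \<not> F x}"
  have U [measurable]: "?U \<in> sets mark_seqs"
  proof -
    have "{x \<in> space mark_seqs. \<not> F x} \<in> sets mark_seqs" using F by measurable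
    then show ?thesis by simp
  qed
  have "(\<integral>\<^sup>+x. indicator {j} (state_at i n x) * indicator ?U (drop_seq n x) \<partial>Q i)
    = (\<integral>\<^sup>+x. indicator {j} (state_at i n x) \<partial>Q i) * (\<integral>\<^sup>+x. indicator ?U x \<partial>Q j)"
  proof (rule markov_prefix_suffix)
    show "(\<lambda>x. indicator {j} (state_at i n x)) \<in> borel_measurable mark_seqs"
      by (rule measurable_compose[OF measurable_state_at]) simp
  qed (auto simp: state_at_comb_seq)
  moreover have "(\<integral>\<^sup>+x. indicator {j} (state_at i n x) * indicator ?U (drop_seq n x) \<partial>Q i) = (\<integral>\<^sup>+x. 0 \<partial>Q i)"
    by (rule nn_integral_cong_AE) (use AE in eventually_elim, auto split: split_indicator)
  ultimately have "ennreal (pmf (nstep p n i) j) * emeasure (Q j) ?U = 0"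
    by (simp add: emeasure_state_at)
  then have "emeasure (Q j) ?U = 0" using pos by simp
  then have "AE x in Q j. x \<notin> ?U" by (intro AE_not_in null_setsI) simp_all
  then show ?thesis by simp
qed

lemma measurable_hits [measurable]: "Measurable.pred mark_seqs (hits i)"
proof -
  have "hits i = (\<lambda>x. \<exists>l. first_hit i l x)" using hits_iff by (intro ext)
  then show ?thesis by simp
qed

lemma AE_hits: "AE x in Q j. hits i x"
proof -
  obtain n where n: "pmf (nstep p n i) j > 0"
    using irreducible by (auto simp: irreducible_chain_def)
  show ?thesis
    by (rule AE_state_event[OF measurable_hits _ n])
      (use AE_recurs_self[of i] in eventually_elim, simp add: recurs_def)
qed

text \<open>From j the state i is reached, and from then on the path is one started in i, which
  recurs.\<close>

lemma AE_recurs: "AE x in Q j. recurs i x"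
  using AE_after_return[OF AE_recurs_self[of i], of j] AE_hits[of i j]
  by eventually_elim (auto simp: drop_random_def intro: recurs_of_drop_seq)

text \<open>\<open>\<beta> l\<close> is the block functional written for a block of length l,
  reading l marks only. Given that the return time is l, the block is decided by these marks and the
  state at time l is i, which is the regeneration required of \<open>Q i\<close>.\<close>

theorem return_blocks_iid:
  fixes \<beta> :: "nat \<Rightarrow> (nat \<Rightarrow> 's mark) \<Rightarrow> 'b"
  assumes meas [measurable]: "\<And>l. \<beta> l \<in> mark_seqs \<rightarrow>\<^sub>M F"
    and prefix: "\<And>l x y. \<beta> l (comb_seq l x y) = \<beta> l x"
    and blk: "\<And>x. blk x = \<beta> (ret_time i x) x"
  shows "blk \<in> mark_seqs \<rightarrow>\<^sub>M F"
    and "distr (Q i) (\<Pi>\<^sub>M k\<in>UNIV. F) (\<lambda>x n. blk (after_ret i n x))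
      = (\<Pi>\<^sub>M k\<in>UNIV. distr (Q i) F blk)"
proof -
  have blk_eq: "blk = (\<lambda>x. \<beta> (ret_time i x) x)" using blk by auto
  show m [measurable]: "blk \<in> mark_seqs \<rightarrow>\<^sub>M F"
    unfolding blk_eq by (rule measurable_compose_countable[OF meas measurable_ret_time])
  have "distr (Q i) (\<Pi>\<^sub>M k\<in>UNIV. F) (\<lambda>x n. blk ((drop_random (ret_time i) ^^ n) x))
      = (\<Pi>\<^sub>M k\<in>UNIV. distr (Q i) F blk)"
  proof (rule regenerative_blocks_iid[OF prob_space_Q sets_Q measurable_ret_time m])
    fix l D G assume D [measurable]: "D \<in> sets F" and "G \<in> sets (Q i)"
    then have G [measurable]: "G \<in> sets mark_seqs" by simp
    show "emeasure (Q i) {x \<in> space (Q i). ret_time i x = l \<and> blk x \<in> D \<and> drop_seq l x \<in> G} =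
      emeasure (Q i) {x \<in> space (Q i). ret_time i x = l \<and> blk x \<in> D} * emeasure (Q i) G"
    proof (cases l)
      case 0
      then have "ret_time i x \<noteq> l" for x using ret_time_pos[of i x] by simp
      then show ?thesis by simp
    next
      case (Suc m)
      define H where "H = {x \<in> space mark_seqs. first_hit i m x \<and> \<beta> l x \<in> D}"
      have H [measurable]: "H \<in> sets mark_seqs" unfolding H_def by measurable
      \<comment> \<open>Only almost surely: on a path without a visit \<open>ret_time\<close> is
        unspecified and might happen to equal l.\<close>
      have iff: "AE x in Q i. ret_time i x = l \<and> blk x \<in> D \<longleftrightarrow> x \<in> H"
        using AE_hits_self[of i]
      proof eventually_elim
        case (elim x)
        have "ret_time i x = l \<longleftrightarrow> first_hit i m x"
          using hits_first_hit[OF elim] first_hit_ret_time[of i m x] Suc by auto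
        then show ?case by (auto simp: H_def blk)
      qed
      have s1: "{x \<in> space (Q i). ret_time i x = l \<and> blk x \<in> D \<and> drop_seq l x \<in> G} \<in> sets (Q i)"
        and s2: "{x \<in> space (Q i). ret_time i x = l \<and> blk x \<in> D} \<in> sets (Q i)"
        by measurable
      have "emeasure (Q i) {x \<in> space (Q i). ret_time i x = l \<and> blk x \<in> D \<and> drop_seq l x \<in> G}
        = (\<integral>\<^sup>+x. indicator {x \<in> space (Q i). ret_time i x = l \<and> blk x \<in> D \<and> drop_seq l x \<in> G} x \<partial>Q i)"
        by (rule nn_integral_indicator[OF s1, symmetric])
      also have "\<dots> = (\<integral>\<^sup>+x. indicator H x * indicator G (drop_seq l x) \<partial>Q i)"
        by (rule nn_integral_cong_AE) (use iff in eventually_elim, auto split: split_indicator)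
      also have "\<dots> = (\<integral>\<^sup>+x. indicator H x \<partial>Q i) * (\<integral>\<^sup>+x. indicator G x \<partial>Q i)"
      proof (rule markov_prefix_suffix)
        show "indicator H (comb_seq l x y) = (indicator H x :: ennreal)" for x y
          by (auto simp: H_def Suc first_hit_prefix prefix[of "Suc m"] split: split_indicator)
        show "state_at i l x \<noteq> i \<Longrightarrow> indicator H x = (0::ennreal)" for x
          by (auto simp: H_def Suc first_hit_def)
      qed measurable
      also have "(\<integral>\<^sup>+x. indicator H x \<partial>Q i)
        = (\<integral>\<^sup>+x. indicator {x \<in> space (Q i). ret_time i x = l \<and> blk x \<in> D} x \<partial>Q i)"
        by (rule nn_integral_cong_AE) (use iff in eventually_elim, auto split: split_indicator)
      finally show ?thesis
        using nn_integral_indicator[OF s2] by simp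
    qed
  qed
  then show "distr (Q i) (\<Pi>\<^sub>M k\<in>UNIV. F) (\<lambda>x n. blk (after_ret i n x))
      = (\<Pi>\<^sub>M k\<in>UNIV. distr (Q i) F blk)"
    by (simp only: drop_random_funpow)
qed

end

section \<open>Perpetuities in terms of return blocks\<close>

text \<open>A countable form of divergence, from which measurability of the event is
  immediate.\<close>

lemma filterlim_at_top_iff_nat:
  fixes f :: "nat \<Rightarrow> real"
  shows "filterlim f at_top sequentially \<longleftrightarrow> (\<forall>Z::nat. \<exists>N. \<forall>n\<ge>N. real Z \<le> f n)"
  unfolding filterlim_at_top eventually_sequentially
  by (meson order_trans real_arch_simple)

lemma log_plus_nonneg [simp]: "0 \<le> log_plus w"
  by (simp add: log_plus_def)

lemma measurable_log_plus [measurable]: "log_plus \<in> borel_measurable borel"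
  unfolding log_plus_def[abs_def] by measurable

lemma log_plus_mono:
  assumes "0 \<le> v" "v \<le> w"
  shows "log_plus v \<le> log_plus w"
proof (cases "v = 0")
  case False
  then have "0 < v" "0 < w" using assms by auto
  then show ?thesis using assms by (auto simp: log_plus_def le_max_iff_disj)
qed (simp add: log_plus_def)

lemma le_exp_log_plus: "0 \<le> w \<Longrightarrow> w \<le> exp (log_plus w)"
  by (auto simp: log_plus_def max_def)

text \<open>The crude bound \<open>ln l \<le> l\<close> is enough, since the factor will be a block
  length, which has finite mean.\<close>

lemma log_plus_mult_le:
  assumes "0 \<le> w" "1 \<le> l"
  shows "log_plus (l * w) \<le> log_plus w + l"
proof (cases "w = 0")
  case False
  have "ln (l * w) = ln l + ln w" using assms False by (intro ln_mult_pos) auto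
  moreover have "ln l \<le> l" using assms ln_le_minus_one[of l] by auto
  then have "max 0 (ln l + ln w) \<le> max 0 (ln w) + l" using assms by linarith
  ultimately show ?thesis using assms False by (simp only: log_plus_def mult_eq_0_iff) simp
qed (use assms in \<open>simp add: log_plus_def\<close>)

context iid_pairs
begin

lemma psum_at_top_not_nonpos:
  assumes "AE x in S. filterlim (psum x) at_top sequentially"
  shows "\<not> (AE z in \<mu>. fst z \<le> 0)"
proof
  assume "AE z in \<mu>. fst z \<le> 0"
  then have "AE x in S. fst (x k) \<le> 0" for k
    by (rule AE_component[rotated]) simp
  then have "AE x in S. \<forall>k. fst (x k) \<le> 0" by (simp add: AE_all_countable)
  with assms have "AE x in S. False"
  proof eventually_elim
    case (elim x)
    then have "psum x n \<le> 0" for n by (simp add: psum_def sum_nonpos)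
    moreover obtain N where "real 1 \<le> psum x N"
      using elim unfolding filterlim_at_top_iff_nat by blast
    ultimately show ?case by (metis not_one_le_zero of_nat_1 order_trans)
  qed
  then show False by simp
qed

end

section \<open>Products, terms and block functionals of a mark sequence\<close>

definition mark_prod :: "(nat \<Rightarrow> 's mark) \<Rightarrow> nat \<Rightarrow> real" where
  "mark_prod x n = (\<Prod>k<n. fst (snd (x k)))"

definition mark_term :: "(nat \<Rightarrow> 's mark) \<Rightarrow> nat \<Rightarrow> real" where
  "mark_term x n = mark_prod x n * snd (snd (x n))"

abbreviation ret_prod :: "'s \<Rightarrow> nat \<Rightarrow> (nat \<Rightarrow> 's mark) \<Rightarrow> real" where
  "ret_prod i n x \<equiv> mark_prod x (ret_sum i n x)"

definition nonzero_marks :: "(nat \<Rightarrow> 's mark) \<Rightarrow> bool" where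
  "nonzero_marks x \<longleftrightarrow> (\<forall>n. fst (snd (x n)) \<noteq> 0)"

definition block_log :: "'s \<Rightarrow> (nat \<Rightarrow> 's mark) \<Rightarrow> real" where
  "block_log i x = - ln \<bar>mark_prod x (ret_time i x)\<bar>"

definition block_max :: "'s \<Rightarrow> (nat \<Rightarrow> 's mark) \<Rightarrow> real" where
  "block_max i x = Max ((\<lambda>k. \<bar>mark_term x k\<bar>) ` {..<ret_time i x})"

definition block_abs :: "'s \<Rightarrow> (nat \<Rightarrow> 's mark) \<Rightarrow> real" where
  "block_abs i x = (\<Sum>k<ret_time i x. \<bar>mark_term x k\<bar>)"

definition block_seq :: "'s \<Rightarrow> ((nat \<Rightarrow> 's mark) \<Rightarrow> real) \<Rightarrow> (nat \<Rightarrow> 's mark) \<Rightarrow> nat \<Rightarrow> real \<times> real" where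
  "block_seq i g x n = (block_log i (after_ret i n x), g (after_ret i n x))"

text \<open>The functionals to which \<open>return_blocks_iid\<close> applies:
  \<open>\<gamma> l\<close> is the version for a block of length l and must not read beyond its
  end.\<close>

definition block_fun :: "'s \<Rightarrow> ((nat \<Rightarrow> 's mark) \<Rightarrow> real) \<Rightarrow> bool" where
  "block_fun i g \<longleftrightarrow> (\<exists>\<gamma>. (\<forall>l. \<gamma> l \<in> borel_measurable mark_seqs) \<and>
    (\<forall>l x y. \<gamma> l (comb_seq l x y) = \<gamma> l x) \<and> (\<forall>x. g x = \<gamma> (ret_time i x) x))"

lemma mark_prod_add: "mark_prod x (r + k) = mark_prod x r * mark_prod (drop_seq r x) k"
  by (induction k) (simp_all add: mark_prod_def drop_seq_def)

lemma mark_term_add: "mark_term x (r + k) = mark_prod x r * mark_term (drop_seq r x) k"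
  by (simp add: mark_term_def mark_prod_add) (simp add: drop_seq_def)

lemma mark_prod_nonzero: "nonzero_marks x \<Longrightarrow> mark_prod x n \<noteq> 0"
  by (simp add: mark_prod_def nonzero_marks_def)

lemma nonzero_marks_drop_seq: "nonzero_marks x \<Longrightarrow> nonzero_marks (drop_seq n x)"
  by (simp add: nonzero_marks_def drop_seq_def)

lemma measurable_mark_prod [measurable]:
  "(\<lambda>x. mark_prod x n) \<in> borel_measurable mark_seqs"
  "(\<lambda>x. mark_term x n) \<in> borel_measurable mark_seqs"
  unfolding mark_prod_def mark_term_def by measurable

lemma mark_prod_prefix: "n \<le> l \<Longrightarrow> mark_prod (comb_seq l x y) n = mark_prod x n"
  by (simp add: mark_prod_def comb_seq_def)

lemma mark_term_prefix: "n < l \<Longrightarrow> mark_term (comb_seq l x y) n = mark_term x n"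
  by (simp add: mark_term_def mark_prod_prefix) (simp add: comb_seq_def)

lemma ret_sum_cover: "\<exists>n r. k = ret_sum i n x + r \<and> r < ret_time i (after_ret i n x)"
proof -
  have "k < ret_sum i N x \<Longrightarrow> \<exists>n r. k = ret_sum i n x + r \<and> r < ret_time i (after_ret i n x)" for N
  proof (induction N)
    case (Suc N)
    show ?case
    proof (cases "k < ret_sum i N x")
      case False
      then have "k = ret_sum i N x + (k - ret_sum i N x)"
        "k - ret_sum i N x < ret_time i (after_ret i N x)"
        using Suc.prems by auto
      then show ?thesis by blast
    qed (use Suc.IH in blast)
  qed simp
  moreover have "k < ret_sum i (Suc k) x" using ret_sum_ge[of "Suc k" i x] by simp
  ultimately show ?thesis by blast
qed

lemma block_max_ge: "k < ret_time i x \<Longrightarrow> \<bar>mark_term x k\<bar> \<le> block_max i x"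
  unfolding block_max_def by (rule Max_ge) auto

lemma block_max_attained: "\<exists>k<ret_time i x. block_max i x = \<bar>mark_term x k\<bar>"
proof -
  have "block_max i x \<in> (\<lambda>k. \<bar>mark_term x k\<bar>) ` {..<ret_time i x}"
    unfolding block_max_def by (rule Max_in) (use ret_time_pos[of i x] in auto)
  then show ?thesis by auto
qed

lemma block_max_nonneg: "0 \<le> block_max i x"
  using block_max_attained[of i x] by auto

lemma block_abs_le: "block_abs i x \<le> real (ret_time i x) * block_max i x"
proof -
  have "block_abs i x \<le> (\<Sum>k<ret_time i x. block_max i x)"
    unfolding block_abs_def by (rule sum_mono) (simp add: block_max_ge)
  then show ?thesis by simp
qed

lemma psum_block_seq:
  assumes "nonzero_marks x"
  shows "psum (block_seq i g x) n = - ln \<bar>ret_prod i n x\<bar>"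
proof (induction n)
  case 0
  then show ?case by (simp add: mark_prod_def)
next
  case (Suc n)
  let ?r = "ret_sum i n x" and ?t = "ret_time i (after_ret i n x)"
  have "ln \<bar>mark_prod x (?r + ?t)\<bar> = ln \<bar>mark_prod x ?r\<bar> + ln \<bar>mark_prod (drop_seq ?r x) ?t\<bar>"
    unfolding mark_prod_add abs_mult
    using mark_prod_nonzero[OF assms] mark_prod_nonzero[OF nonzero_marks_drop_seq[OF assms]]
    by (intro ln_mult_pos) auto
  then show ?case using Suc by (simp add: psum_Suc block_seq_def block_log_def)
qed

lemma exp_psum_block_seq:
  "nonzero_marks x \<Longrightarrow> exp (- psum (block_seq i g x) n) = \<bar>ret_prod i n x\<bar>"
  using mark_prod_nonzero[of x "ret_sum i n x"] by (simp add: psum_block_seq)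

lemma psum_block_seq_at_top_iff:
  assumes "nonzero_marks x"
  shows "filterlim (psum (block_seq i g x)) at_top sequentially
    \<longleftrightarrow> (\<lambda>n. ret_prod i n x) \<longlonglongrightarrow> 0"
proof
  assume *: "filterlim (psum (block_seq i g x)) at_top sequentially"
  have "((\<lambda>n. exp (- psum (block_seq i g x) n)) \<longlongrightarrow> 0) sequentially"
    by (rule filterlim_compose[OF exp_at_bot]) (use * in \<open>simp add: filterlim_uminus_at_bot\<close>)
  then show "(\<lambda>n. ret_prod i n x) \<longlonglongrightarrow> 0"
    by (simp add: exp_psum_block_seq[OF assms] tendsto_rabs_zero_iff)
next
  assume "(\<lambda>n. ret_prod i n x) \<longlonglongrightarrow> 0"
  then have "(\<lambda>n. \<bar>ret_prod i n x\<bar>) \<longlonglongrightarrow> 0" by (rule tendsto_rabs_zero)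
  then have "filterlim (\<lambda>n. \<bar>ret_prod i n x\<bar>) (at_right 0) sequentially"
    using mark_prod_nonzero[OF assms] by (auto simp: filterlim_at)
  then have "filterlim (\<lambda>n. ln \<bar>ret_prod i n x\<bar>) at_bot sequentially"
    by (rule filterlim_compose[OF ln_at_0])
  then show "filterlim (psum (block_seq i g x)) at_top sequentially"
    by (simp add: psum_block_seq[OF assms, abs_def] filterlim_uminus_at_top)
qed

lemma measurable_Max_abs_term:
  "(\<lambda>x. Max ((\<lambda>k. \<bar>mark_term x k\<bar>) ` {..<l})) \<in> borel_measurable mark_seqs"
proof (cases l)
  case (Suc m)
  have "(\<lambda>x. Max ((\<lambda>k. \<bar>mark_term x k\<bar>) ` {..<Suc m})) \<in> borel_measurable mark_seqs"
  proof (induction m)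
    case 0
    then show ?case by (simp add: lessThan_Suc)
  next
    case (Suc m)
    have "Max ((\<lambda>k. \<bar>mark_term x k\<bar>) ` {..<Suc (Suc m)})
      = max \<bar>mark_term x (Suc m)\<bar> (Max ((\<lambda>k. \<bar>mark_term x k\<bar>) ` {..<Suc m}))" for x :: "nat \<Rightarrow> 'a mark"
      unfolding lessThan_Suc[of "Suc m"] image_insert by (rule Max_insert) auto
    then show ?case using Suc by simp
  qed
  then show ?thesis using Suc by simp
qed simp

lemma block_fun_max: "block_fun i (block_max i)"
  unfolding block_fun_def
proof (intro exI conjI allI)
  show "(\<lambda>l x. Max ((\<lambda>k. \<bar>mark_term x k\<bar>) ` {..<l})) l \<in> borel_measurable mark_seqs" for l
    using measurable_Max_abs_term by simp
  show "(\<lambda>l x. Max ((\<lambda>k. \<bar>mark_term x k\<bar>) ` {..<l})) l (comb_seq l x y)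
    = (\<lambda>l x. Max ((\<lambda>k. \<bar>mark_term x k\<bar>) ` {..<l})) l x" for l and x y :: "nat \<Rightarrow> 's mark"
    by (intro arg_cong[where f = Max] image_cong) (auto simp: mark_term_prefix)
qed (simp add: block_max_def)

lemma block_fun_abs: "block_fun i (block_abs i)"
  unfolding block_fun_def
proof (intro exI conjI allI)
  show "(\<lambda>l x. \<Sum>k<l. \<bar>mark_term x k\<bar>) l \<in> borel_measurable mark_seqs" for l
    by measurable
  show "(\<lambda>l x. \<Sum>k<l. \<bar>mark_term x k\<bar>) l (comb_seq l x y) = (\<lambda>l x. \<Sum>k<l. \<bar>mark_term x k\<bar>) l x"
    for l and x y :: "nat \<Rightarrow> 's mark"
    by (simp add: mark_term_prefix)
qed (simp add: block_abs_def)

lemma block_fun_compose: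
  assumes "block_fun i g" "f \<in> borel_measurable borel"
  shows "block_fun i (\<lambda>x. f (g x))"
proof -
  obtain \<gamma> where \<gamma>: "\<And>l. \<gamma> l \<in> borel_measurable mark_seqs"
    "\<And>l x y. \<gamma> l (comb_seq l x y) = \<gamma> l x" "\<And>x. g x = \<gamma> (ret_time i x) x"
    using assms(1) unfolding block_fun_def by blast
  show ?thesis
    unfolding block_fun_def
  proof (intro exI conjI allI)
    show "(\<lambda>l x. f (\<gamma> l x)) l \<in> borel_measurable mark_seqs" for l
      using measurable_compose[OF \<gamma>(1) assms(2)] by simp
  qed (simp_all add: \<gamma>(2,3))
qed

section \<open>The law of the block sequence\<close>

context markov_modulated
begin

definition block_law :: "'s \<Rightarrow> ((nat \<Rightarrow> 's mark) \<Rightarrow> real) \<Rightarrow> (real \<times> real) measure" where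
  "block_law i g = distr (Q i) borel (\<lambda>x. (block_log i x, g x))"

lemma
  assumes g: "block_fun i g"
  shows measurable_block: "(\<lambda>x. (block_log i x, g x)) \<in> borel_measurable mark_seqs"
    and distr_block_seq: "distr (Q i) (\<Pi>\<^sub>M k\<in>UNIV. borel) (block_seq i g) = (\<Pi>\<^sub>M k\<in>UNIV. block_law i g)"
proof -
  obtain \<gamma> where \<gamma> [measurable]: "\<And>l. \<gamma> l \<in> borel_measurable mark_seqs"
    and \<gamma>_prefix: "\<And>l x y. \<gamma> l (comb_seq l x y) = \<gamma> l x" and \<gamma>_eq: "\<And>x. g x = \<gamma> (ret_time i x) x"
    using g unfolding block_fun_def by blast
  define \<beta> where "\<beta> l x = (- ln \<bar>mark_prod x l\<bar>, \<gamma> l x)" for l x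
  have \<beta>: "\<beta> l \<in> borel_measurable mark_seqs" for l
    unfolding \<beta>_def[abs_def] by measurable
  have prefix: "\<beta> l (comb_seq l x y) = \<beta> l x" for l x y
    by (simp add: \<beta>_def mark_prod_prefix \<gamma>_prefix)
  have eq: "(block_log i x, g x) = \<beta> (ret_time i x) x" for x
    by (simp add: \<beta>_def block_log_def \<gamma>_eq)
  show "(\<lambda>x. (block_log i x, g x)) \<in> borel_measurable mark_seqs"
    by (rule return_blocks_iid(1)[where \<beta> = \<beta> and i = i, OF \<beta> prefix eq])
  show "distr (Q i) (\<Pi>\<^sub>M k\<in>UNIV. borel) (block_seq i g) = (\<Pi>\<^sub>M k\<in>UNIV. block_law i g)"
    using return_blocks_iid(2)[where \<beta> = \<beta> and i = i, OF \<beta> prefix eq]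
    by (simp add: block_seq_def[abs_def] block_law_def)
qed

lemma measurable_block_Q: "block_fun i g \<Longrightarrow> (\<lambda>x. (block_log i x, g x)) \<in> borel_measurable (Q i)"
  by (rule measurable_Qf[OF measurable_block, simplified])

lemma iid_block_law:
  assumes "block_fun i g"
  shows "iid_pairs (block_law i g)"
proof -
  interpret prob_space "block_law i g"
    unfolding block_law_def
    by (rule prob_space.prob_space_distr[OF prob_space_Q measurable_block_Q[OF assms]])
  interpret sequence_space "block_law i g" by unfold_locales
  show ?thesis by unfold_locales (simp add: block_law_def)
qed

lemma measurable_block_seq:
  assumes "block_fun i g"
  shows "block_seq i g \<in> Q i \<rightarrow>\<^sub>M (\<Pi>\<^sub>M k\<in>UNIV. borel)"
proof (rule measurable_seq_of_components)
  fix n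
  have "after_ret i n x = (drop_random (ret_time i) ^^ n) x" for x
    by (simp only: drop_random_funpow)
  moreover have "(drop_random (ret_time i) ^^ n) \<in> mark_seqs \<rightarrow>\<^sub>M mark_seqs"
    by (induction n)
      (simp_all add: id_def[abs_def] o_def
        measurable_compose[OF _ measurable_drop_random[OF measurable_ret_time]])
  ultimately have "(\<lambda>x. after_ret i n x) \<in> mark_seqs \<rightarrow>\<^sub>M mark_seqs"
    by (simp only:)
  from measurable_compose[OF this measurable_block[OF assms]]
  have "(\<lambda>x. block_seq i g x n) \<in> borel_measurable mark_seqs"
    by (simp add: block_seq_def)
  then show "(\<lambda>x. block_seq i g x n) \<in> borel_measurable (Q i)"
    by (simp cong: measurable_cong_sets)
qed

lemma AE_block_seq_D:
  assumes "block_fun i g" "AE y in (\<Pi>\<^sub>M k\<in>UNIV. block_law i g). \<Phi> y"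
  shows "AE x in Q i. \<Phi> (block_seq i g x)"
  using assms(2) unfolding distr_block_seq[OF assms(1), symmetric]
  by (rule AE_distrD[OF measurable_block_seq[OF assms(1)]])

lemma AE_block_seq_I:
  assumes "block_fun i g" "AE x in Q i. \<Phi> (block_seq i g x)"
    and "Measurable.pred (\<Pi>\<^sub>M k\<in>UNIV. block_law i g) \<Phi>"
  shows "AE y in (\<Pi>\<^sub>M k\<in>UNIV. block_law i g). \<Phi> y"
proof -
  have "sets (\<Pi>\<^sub>M k\<in>(UNIV::nat set). block_law i g) = sets (\<Pi>\<^sub>M k\<in>UNIV. borel)"
    by (rule sets_PiM_cong) (simp_all add: block_law_def)
  then have "Measurable.pred (\<Pi>\<^sub>M k\<in>UNIV. borel) \<Phi>"
    using assms(3) measurable_cong_sets by blast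
  then have "{y \<in> space (\<Pi>\<^sub>M k\<in>UNIV. borel). \<Phi> y} \<in> sets (\<Pi>\<^sub>M k\<in>UNIV. borel)"
    by (simp add: pred_def)
  then show ?thesis
    unfolding distr_block_seq[OF assms(1), symmetric]
    using assms(2) by (subst AE_distr_iff[OF measurable_block_seq[OF assms(1)]])
qed

lemma
  shows measurable_fst_pair: "fst \<in> borel_measurable (borel :: (real \<times> real) measure)"
    and measurable_snd_pair: "snd \<in> borel_measurable (borel :: (real \<times> real) measure)"
  by (simp_all add: borel_prod[symmetric])

lemma measurable_block_log [measurable]: "block_log i \<in> borel_measurable mark_seqs" for i :: 's
  using measurable_compose[OF measurable_block[OF block_fun_max] measurable_fst_pair] by simp

lemma measurable_block_fun: "block_fun i g \<Longrightarrow> g \<in> borel_measurable mark_seqs" for i :: 's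
  using measurable_compose[OF measurable_block measurable_snd_pair] by simp

lemma
  assumes g: "block_fun i g" and R: "Measurable.pred borel R"
  shows AE_block_law_fst: "(AE z in block_law i g. R (fst z)) \<longleftrightarrow> (AE x in Q i. R (block_log i x))"
    and AE_block_law_snd: "(AE z in block_law i g. R (snd z)) \<longleftrightarrow> (AE x in Q i. R (g x))"
  using measurable_compose[OF measurable_fst_pair R] measurable_compose[OF measurable_snd_pair R]
  unfolding block_law_def by (simp_all add: AE_distr_iff[OF measurable_block_Q[OF g]] pred_def)

lemma nn_integral_block_law:
  assumes "block_fun i g" "f \<in> borel_measurable borel"
  shows "(\<integral>\<^sup>+z. f (snd z) \<partial>block_law i g) = (\<integral>\<^sup>+x. f (g x) \<partial>Q i)"
  unfolding block_law_def using measurable_compose[OF measurable_snd_pair assms(2)]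
  by (subst nn_integral_distr[OF measurable_block_Q[OF assms(1)]]) auto

lemma trunc_mean_block_law:
  assumes "block_fun i g"
  shows "trunc_mean (block_law i g) y = (\<integral>x. min (max (block_log i x) 0) y \<partial>Q i)"
proof -
  have "(\<lambda>z. min (max (fst z) 0) y) \<in> borel_measurable (borel :: (real \<times> real) measure)"
    using measurable_fst_pair by measurable
  then show ?thesis
    unfolding block_law_def trunc_mean_def
    by (subst integral_distr[OF measurable_block_Q[OF assms]]) auto
qed

text \<open>Only the first component enters the truncated mean, so block maximum and block sum are
  measured by the same function J.\<close>

lemma erickson_block_law:
  assumes "block_fun i g" "block_fun i h"
  shows "erickson (block_law i g) = erickson (block_law i h)"
  by (simp add: fun_eq_iff erickson_def trunc_mean_block_law[OF assms(1)] trunc_mean_block_law[OF assms(2)])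

end

lemma sum_lessThan_add: "(\<Sum>k<r + (t::nat). f k) = (\<Sum>k<r. f k) + (\<Sum>k<t. f (r + k) :: real)"
  by (induction t) (simp_all add: add.assoc)

context markov_modulated
begin

text \<open>The right-hand side does not mention g, so a drift established with one companion of the
  block walk is available with any other.\<close>

lemma AE_psum_at_top_iff_ret:
  assumes nz: "AE x in Q i. nonzero_marks x" and g: "block_fun i g"
  shows "(AE y in (\<Pi>\<^sub>M k\<in>UNIV. block_law i g). filterlim (psum y) at_top sequentially)
    \<longleftrightarrow> (AE x in Q i. (\<lambda>n. ret_prod i n x) \<longlonglongrightarrow> 0)"
proof -
  interpret iid_pairs "block_law i g" by (rule iid_block_law[OF g])
  have pred: "Measurable.pred S (\<lambda>y. filterlim (psum y) at_top sequentially)"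
    unfolding filterlim_at_top_iff_nat by measurable
  have "(AE y in S. filterlim (psum y) at_top sequentially)
    \<longleftrightarrow> (AE x in Q i. filterlim (psum (block_seq i g x)) at_top sequentially)"
    using AE_block_seq_D[OF g] AE_block_seq_I[OF g _ pred] by blast
  also have "\<dots> \<longleftrightarrow> (AE x in Q i. (\<lambda>n. ret_prod i n x) \<longlonglongrightarrow> 0)"
  proof
    assume "AE x in Q i. filterlim (psum (block_seq i g x)) at_top sequentially"
    with nz show "AE x in Q i. (\<lambda>n. ret_prod i n x) \<longlonglongrightarrow> 0"
      by eventually_elim (simp add: psum_block_seq_at_top_iff)
  next
    assume "AE x in Q i. (\<lambda>n. ret_prod i n x) \<longlonglongrightarrow> 0"
    with nz show "AE x in Q i. filterlim (psum (block_seq i g x)) at_top sequentially"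
      by eventually_elim (simp add: psum_block_seq_at_top_iff)
  qed
  finally show ?thesis .
qed

theorem summable_of_moment:
  assumes nz: "AE x in Q i. nonzero_marks x"
    and drift: "AE x in Q i. (\<lambda>n. ret_prod i n x) \<longlonglongrightarrow> 0"
    and moment: "(\<integral>\<^sup>+x. ennreal (erickson (block_law i (block_max i)) (log_plus (block_max i x))) \<partial>Q i) < \<infinity>"
  shows "AE x in Q i. summable (\<lambda>n. \<bar>mark_term x n\<bar>)"
proof -
  \<comment> \<open>Log+ of the block sum rather than of the block maximum: the exponential of Y - S
    then dominates the contribution of a whole block to the series.\<close>
  define g where "g x = log_plus (block_abs i x)" for x
  have g: "block_fun i g"
    unfolding g_def by (rule block_fun_compose[OF block_fun_abs measurable_log_plus])
  interpret iid_pairs "block_law i g" by (rule iid_block_law[OF g])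
  have drift': "AE y in S. filterlim (psum y) at_top sequentially"
    using AE_psum_at_top_iff_ret[OF nz g] drift by simp
  interpret iid_pairs_pos "block_law i g"
    by unfold_locales (rule psum_at_top_not_nonpos[OF drift'])
  have nonneg: "AE z in block_law i g. 0 \<le> snd z"
    by (subst AE_block_law_snd[OF g]) (simp_all add: g_def)
  let ?J = "erickson (block_law i g)"
  have J_eq: "erickson (block_law i (block_max i)) = ?J"
    by (rule erickson_block_law[OF block_fun_max g])
  have "(\<integral>\<^sup>+z. ennreal (?J (snd z)) \<partial>block_law i g) = (\<integral>\<^sup>+x. ennreal (?J (g x)) \<partial>Q i)"
    by (rule nn_integral_block_law[OF g]) measurable
  also have "\<dots> \<le> (\<integral>\<^sup>+x. ennreal (?J (log_plus (block_max i x)))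
      + ennreal (?J 1) * (1 + of_nat (ret_time i x)) \<partial>Q i)"
  proof (rule nn_integral_mono)
    fix x :: "nat \<Rightarrow> 's mark"
    define l where "l = real (ret_time i x)"
    have l: "1 \<le> l" using ret_time_pos[of i x] by (simp add: l_def)
    have "g x \<le> log_plus (l * block_max i x)"
      unfolding g_def l_def by (rule log_plus_mono[OF _ block_abs_le]) (simp add: block_abs_def sum_nonneg)
    also have "\<dots> \<le> log_plus (block_max i x) + l"
      by (rule log_plus_mult_le[OF block_max_nonneg l])
    finally have "?J (g x) \<le> ?J (log_plus (block_max i x) + l)"
      by (intro erickson_mono) (simp add: g_def)
    also have "\<dots> \<le> ?J (log_plus (block_max i x)) + ?J l"
      using l by (intro erickson_subadd) auto
    also have "\<dots> \<le> ?J (log_plus (block_max i x)) + ?J 1 * (1 + l)"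
      using l erickson_le_linear[of l] by simp
    finally have "ennreal (?J (g x)) \<le> ennreal (?J (log_plus (block_max i x)) + ?J 1 * (1 + l))"
      by (rule ennreal_leI)
    also have "\<dots> = ennreal (?J (log_plus (block_max i x))) + ennreal (?J 1) * (1 + of_nat (ret_time i x))"
      using l erickson_ge_1[of 1] erickson_ge_1[of "log_plus (block_max i x)"]
      by (simp add: ennreal_plus ennreal_mult l_def ennreal_of_nat_eq_real_of_nat)
    finally show "ennreal (?J (g x)) \<le> ennreal (?J (log_plus (block_max i x)))
      + ennreal (?J 1) * (1 + of_nat (ret_time i x))" .
  qed
  also have "\<dots> = (\<integral>\<^sup>+x. ennreal (?J (log_plus (block_max i x))) \<partial>Q i)
      + ennreal (?J 1) * (1 + (\<integral>\<^sup>+x. of_nat (ret_time i x) \<partial>Q i))"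
  proof -
    have [measurable]: "(\<lambda>x. ennreal (?J (log_plus (block_max i x)))) \<in> borel_measurable (Q i)"
      by (rule measurable_Qf) (use measurable_block_fun[OF block_fun_max] in measurable)
    have [measurable]: "(\<lambda>x. of_nat (ret_time i x) :: ennreal) \<in> borel_measurable (Q i)"
      by (rule measurable_Qf) measurable
    have "(\<integral>\<^sup>+x. 1 + of_nat (ret_time i x) \<partial>Q i) = 1 + (\<integral>\<^sup>+x. of_nat (ret_time i x) \<partial>Q i)"
      by (subst nn_integral_add) (simp_all add: nn_integral_Q_const del: nn_integral_const)
    then show ?thesis
      by (subst nn_integral_add) (simp_all add: nn_integral_cmult)
  qed
  also have "\<dots> < \<infinity>"
    using moment nn_integral_ret_time[of i] by (simp add: J_eq ennreal_mult_less_top)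
  finally have "AE y in S. summable (\<lambda>n. exp (snd (y n) - psum y n))"
    by (rule erickson_moment_sufficient[OF drift' nonneg])
  from AE_block_seq_D[OF g this] nz show ?thesis
  proof eventually_elim
    case (elim x)
    let ?r = "\<lambda>n. ret_sum i n x"
    define b where "b n = (\<Sum>k<ret_time i (drop_seq (?r n) x). \<bar>mark_term x (?r n + k)\<bar>)" for n
    have b_le: "b n \<le> exp (snd (block_seq i g x n) - psum (block_seq i g x) n)" for n
    proof -
      have "b n = \<bar>mark_prod x (?r n)\<bar> * block_abs i (drop_seq (?r n) x)"
        by (simp add: b_def mark_term_add abs_mult block_abs_def sum_distrib_left)
      also have "\<dots> \<le> \<bar>mark_prod x (?r n)\<bar> * exp (g (drop_seq (?r n) x))"
        unfolding g_def by (intro mult_left_mono le_exp_log_plus) (simp_all add: block_abs_def sum_nonneg)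
      also have "\<dots> = exp (- psum (block_seq i g x) n) * exp (snd (block_seq i g x n))"
        using exp_psum_block_seq[OF elim(2)] by (simp add: block_seq_def)
      also have "\<dots> = exp (snd (block_seq i g x n) - psum (block_seq i g x) n)"
        by (simp add: exp_add[symmetric])
      finally show ?thesis .
    qed
    have b_nonneg: "0 \<le> b n" for n by (simp add: b_def sum_nonneg)
    have b: "summable b"
      by (rule summable_comparison_test'[OF elim(1), of 0]) (use b_le b_nonneg in auto)
    have blocks: "(\<Sum>k<?r n. \<bar>mark_term x k\<bar>) = (\<Sum>m<n. b m)" for n
      by (induction n) (simp_all add: sum_lessThan_add b_def)
    show ?case
    proof (rule summableI_nonneg_bounded)
      fix n
      have "(\<Sum>k<n. \<bar>mark_term x k\<bar>) \<le> (\<Sum>k<?r n. \<bar>mark_term x k\<bar>)"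
        by (rule sum_mono2) (use ret_sum_ge[of n i x] in auto)
      also have "\<dots> = (\<Sum>m<n. b m)" by (rule blocks)
      also have "\<dots> \<le> suminf b" by (rule sum_le_suminf[OF b]) (use b_nonneg in auto)
      finally show "(\<Sum>k<n. \<bar>mark_term x k\<bar>) \<le> suminf b" .
    qed simp
  qed
qed

text \<open>The block walk is used with two companions: the block maximum itself gives the
  divergence, after which log+ of that maximum gives the moment. The second part needs the first,
  because divergence excludes steps that are almost surely nonpositive.\<close>

theorem moment_of_bounded:
  assumes nz: "AE x in Q i. nonzero_marks x"
    and bounded: "AE x in Q i. \<exists>c::nat. \<forall>n. \<bar>mark_term x n\<bar> \<le> real c"
    and nontrivial: "\<not> (AE x in Q i. block_log i x = 0)"
    and nonzero: "\<not> (AE x in Q i. block_max i x \<le> 0)"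
  shows "AE x in Q i. (\<lambda>n. ret_prod i n x) \<longlonglongrightarrow> 0"
    and "(\<integral>\<^sup>+x. ennreal (erickson (block_law i (block_max i)) (log_plus (block_max i x))) \<partial>Q i) < \<infinity>"
proof -
  have block_term_le: "\<bar>ret_prod i n x\<bar> * block_max i (after_ret i n x) \<le> c"
    if "\<And>n. \<bar>mark_term x n\<bar> \<le> c" for x n and c :: real
  proof -
    obtain k where "block_max i (after_ret i n x) = \<bar>mark_term (after_ret i n x) k\<bar>"
      using block_max_attained[of i "after_ret i n x"] by (elim exE conjE)
    then have "\<bar>ret_prod i n x\<bar> * block_max i (after_ret i n x)
      = \<bar>mark_term x (ret_sum i n x + k)\<bar>"
      by (simp add: mark_term_add abs_mult)
    then show ?thesis using that by simp
  qed
  have "AE y in (\<Pi>\<^sub>M k\<in>UNIV. block_law i (block_max i)). filterlim (psum y) at_top sequentially"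
  proof -
    interpret iid_pairs "block_law i (block_max i)" by (rule iid_block_law[OF block_fun_max])
    have meas: "Measurable.pred S (\<lambda>y. \<exists>c::nat. \<forall>n. exp (- psum y n) * snd (y n) \<le> real c)"
      unfolding not_less[symmetric] by measurable
    have "AE y in S. \<exists>c::nat. \<forall>n. exp (- psum y n) * snd (y n) \<le> real c"
    proof (rule AE_block_seq_I[OF block_fun_max _ meas])
      show "AE x in Q i. \<exists>c::nat. \<forall>n. exp (- psum (block_seq i (block_max i) x) n)
          * snd (block_seq i (block_max i) x n) \<le> real c"
        using nz bounded
      proof eventually_elim
        case (elim x)
        then obtain c :: nat where c: "\<And>n. \<bar>mark_term x n\<bar> \<le> real c" by blast
        have "exp (- psum (block_seq i (block_max i) x) n) * snd (block_seq i (block_max i) x n) \<le> real c" for n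
          unfolding exp_psum_block_seq[OF elim(1)] block_seq_def snd_conv by (rule block_term_le[OF c])
        then show ?case by blast
      qed
    qed
    moreover have "\<not> (AE z in block_law i (block_max i). snd z \<le> 0)"
      using nonzero by (subst AE_block_law_snd[OF block_fun_max]) simp_all
    moreover have "\<not> (AE z in block_law i (block_max i). fst z = 0)"
      using nontrivial by (subst AE_block_law_fst[OF block_fun_max]) simp_all
    ultimately show ?thesis by (rule AE_psum_at_top)
  qed
  then show drift: "AE x in Q i. (\<lambda>n. ret_prod i n x) \<longlonglongrightarrow> 0"
    using AE_psum_at_top_iff_ret[OF nz block_fun_max] by simp
  define g where "g x = log_plus (block_max i x)" for x
  have g: "block_fun i g"
    unfolding g_def by (rule block_fun_compose[OF block_fun_max measurable_log_plus])
  interpret iid_pairs "block_law i g" by (rule iid_block_law[OF g])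
  have drift': "AE y in S. filterlim (psum y) at_top sequentially"
    using AE_psum_at_top_iff_ret[OF nz g] drift by simp
  interpret iid_pairs_pos "block_law i g"
    by unfold_locales (rule psum_at_top_not_nonpos[OF drift'])
  have nonneg: "AE z in block_law i g. 0 \<le> snd z"
    by (subst AE_block_law_snd[OF g]) (simp_all add: g_def)
  have meas: "Measurable.pred S (\<lambda>y. \<exists>c::nat. \<forall>n. snd (y n) \<le> psum_pos y n + real c)"
    unfolding not_less[symmetric] by measurable
  have "AE y in S. \<exists>c::nat. \<forall>n. snd (y n) \<le> psum_pos y n + real c"
  proof (rule AE_block_seq_I[OF g _ meas])
    show "AE x in Q i. \<exists>c::nat. \<forall>n. snd (block_seq i g x n) \<le> psum_pos (block_seq i g x) n + real c"
      using nz bounded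
    proof eventually_elim
      case (elim x)
      then obtain c :: nat where c: "\<And>n. \<bar>mark_term x n\<bar> \<le> real c" by blast
      have "snd (block_seq i g x n) \<le> psum_pos (block_seq i g x) n + real c" for n
      proof (cases "block_max i (after_ret i n x) \<le> 1")
        case True
        then have "snd (block_seq i g x n) = 0"
          using block_max_nonneg[of i "after_ret i n x"]
          by (auto simp: block_seq_def g_def log_plus_def max_def)
        moreover have "0 \<le> psum_pos (block_seq i g x) n"
          using psum_pos_mono[of 0 n "block_seq i g x"] by simp
        ultimately show ?thesis by simp
      next
        case False
        define w where "w = block_max i (after_ret i n x)"
        have w: "1 < w" using False by (simp add: w_def)
        have "exp (- psum (block_seq i g x) n) * w \<le> real c"
          using block_term_le[OF c] by (simp add: exp_psum_block_seq[OF elim(1)] w_def)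
        then have "w \<le> real c * exp (psum (block_seq i g x) n)"
          by (simp add: exp_minus field_simps)
        \<comment> \<open>Replacing c by exp c moves the constant into the exponent, so that taking
          logarithms leaves the additive bound c.\<close>
        also have "\<dots> \<le> exp (real c) * exp (psum (block_seq i g x) n)"
        proof (rule mult_right_mono)
          show "real c \<le> exp (real c)" using exp_ge_add_one_self[of "real c"] by linarith
        qed simp
        finally have "w \<le> exp (real c + psum (block_seq i g x) n)" by (simp add: exp_add)
        then have "ln w \<le> ln (exp (real c + psum (block_seq i g x) n))"
          using w by (subst ln_le_cancel_iff) auto
        then have "ln w \<le> real c + psum (block_seq i g x) n" by simp
        moreover have "snd (block_seq i g x n) = ln w"
          using w by (simp add: block_seq_def g_def log_plus_def w_def)
        ultimately show ?thesis using psum_le_psum_pos[of "block_seq i g x" n] by linarith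
      qed
      then show ?case by blast
    qed
  qed
  then have "(\<integral>\<^sup>+z. ennreal (erickson (block_law i g) (snd z)) \<partial>block_law i g) < \<infinity>"
    by (rule erickson_moment_necessary[OF _ nonneg])
  also have "(\<integral>\<^sup>+z. ennreal (erickson (block_law i g) (snd z)) \<partial>block_law i g)
      = (\<integral>\<^sup>+x. ennreal (erickson (block_law i g) (g x)) \<partial>Q i)"
    by (rule nn_integral_block_law[OF g]) measurable
  finally show "(\<integral>\<^sup>+x. ennreal (erickson (block_law i (block_max i)) (log_plus (block_max i x))) \<partial>Q i) < \<infinity>"
    by (simp add: g_def erickson_block_law[OF block_fun_max g])
qed

text \<open>If all block products have modulus 1, the terms inside a block keep the size they would
  have in a fresh start. The i.i.d. block maxima exceed some w > 0 infinitely often, so the terms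
  cannot tend to 0.\<close>

lemma nontrivial_of_tendsto_zero:
  assumes nz: "AE x in Q i. nonzero_marks x"
    and tendsto: "AE x in Q i. (\<lambda>n. mark_term x n) \<longlonglongrightarrow> 0"
    and nonzero: "\<not> (AE x in Q i. block_max i x \<le> 0)"
  shows "\<not> (AE x in Q i. block_log i x = 0)"
proof
  assume log0: "AE x in Q i. block_log i x = 0"
  obtain w where w: "w > 0" "\<not> (AE x in Q i. block_max i x < w)"
    using not_AE_nonpos_obtain[OF nonzero] by blast
  interpret iid_pairs "block_law i (block_max i)" by (rule iid_block_law[OF block_fun_max])
  \<comment> \<open>f flags block maxima of at least w. Divergence of its sums takes the place of
    the second Borel-Cantelli lemma.\<close>
  define f where "f z = (if snd z < w then 0 else 1 :: real)" for z :: "real \<times> real"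
  have [measurable]: "f \<in> borel_measurable borel"
    unfolding f_def using measurable_snd_pair by measurable
  have "\<not> (AE z in block_law i (block_max i). snd z < w)"
    using w by (subst AE_block_law_snd[OF block_fun_max]) simp_all
  then have "\<not> (AE z in block_law i (block_max i). f z = 0)"
    by (simp add: f_def)
  then have "AE y in S. filterlim (\<lambda>n. \<Sum>k<n. f (y k)) at_top sequentially"
    by (intro AE_filterlim_sum_at_top) (auto simp: f_def)
  from AE_block_seq_D[OF block_fun_max this]
  have "AE x in Q i. filterlim (\<lambda>n. \<Sum>k<n. f (block_seq i (block_max i) x k)) at_top sequentially" .
  with AE_iterates[OF log0] nz tendsto have "AE x in Q i. False"
  proof eventually_elim
    case (elim x)
    have "psum (block_seq i (block_max i) x) n = 0" for n
      using elim(1) by (simp add: psum_def block_seq_def drop_random_funpow)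
    then have prod1: "\<bar>ret_prod i n x\<bar> = 1" for n
      using exp_psum_block_seq[OF elim(2), of i "block_max i" n] by simp
    obtain N where N: "\<And>n. N \<le> n \<Longrightarrow> \<bar>mark_term x n\<bar> < w"
      using order_tendstoD(2)[OF tendsto_rabs_zero[OF elim(3)] w(1)]
      by (auto simp: eventually_sequentially)
    have zero: "f (block_seq i (block_max i) x n) = 0" if "N \<le> n" for n
    proof -
      obtain k where "block_max i (after_ret i n x) = \<bar>mark_term (after_ret i n x) k\<bar>"
        using block_max_attained[of i "after_ret i n x"] by (elim exE conjE)
      also have "\<dots> = \<bar>mark_term x (ret_sum i n x + k)\<bar>"
        by (simp add: mark_term_add abs_mult prod1)
      also have "\<dots> < w" using ret_sum_ge[of n i x] that by (intro N) simp
      finally show ?thesis by (simp add: f_def block_seq_def)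
    qed
    have "(\<Sum>k<n. f (block_seq i (block_max i) x k)) \<le> real N" for n
    proof -
      have "(\<Sum>k<n. f (block_seq i (block_max i) x k)) \<le> (\<Sum>k<n. if k < N then 1 else 0)"
        using zero by (intro sum_mono) (auto simp: f_def)
      also have "\<dots> = real (card ({..<n} \<inter> {k. k < N}))" by (simp add: sum.If_cases)
      also have "card ({..<n} \<inter> {k. k < N}) \<le> card {..<N}" by (rule card_mono) auto
      finally show ?thesis by simp
    qed
    moreover obtain n where "real (Suc N) \<le> (\<Sum>k<n. f (block_seq i (block_max i) x k))"
      using elim(4) unfolding filterlim_at_top_iff_nat by blast
    ultimately show ?case by (metis lessI not_less of_nat_less_iff order_trans)
  qed
  then show False using prob_space.AE_False[OF prob_space_Q] by simp
qed

end

section \<open>Transfer to the modulated sequence\<close>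

lemma real_le_limit_of_bounded:
  fixes f :: "nat \<Rightarrow> real"
  assumes "limsup (\<lambda>n. ereal \<bar>f n\<bar>) < \<infinity>"
  shows "\<exists>c::nat. \<forall>n. \<bar>f n\<bar> \<le> real c"
proof -
  obtain C where C: "limsup (\<lambda>n. ereal \<bar>f n\<bar>) < ereal C"
    using assms ereal_dense2 by blast
  then obtain n0 where n0: "\<And>n. n0 \<le> n \<Longrightarrow> \<bar>f n\<bar> < C"
    using Limsup_lessD[OF C] by (auto simp: eventually_sequentially)
  obtain c :: nat where c: "max C (\<Sum>k<n0. \<bar>f k\<bar>) \<le> real c" using real_arch_simple by blast
  have "\<bar>f n\<bar> \<le> real c" for n
  proof (cases "n0 \<le> n")
    case False
    then have "\<bar>f n\<bar> \<le> (\<Sum>k<n0. \<bar>f k\<bar>)" by (intro member_le_sum) auto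
    then show ?thesis using c by simp
  next
    case True
    then show ?thesis using n0[OF True] c by simp
  qed
  then show ?thesis by blast
qed

context markov_modulated
begin

lemma Prd_eq: "Prd A n w = mark_prod (marks w) n"
  unfolding Prd_def mark_prod_def marks_def
  by (rule prod.reindex_bij_witness[of _ Suc "\<lambda>k. k - 1"]) auto

lemma perp_term_eq: "perp_term A B n w = mark_term (marks w) n"
  by (simp add: perp_term_def mark_term_def Prd_eq) (simp add: marks_def)

lemma Prd_ret_eq: "recurs i (marks w) \<Longrightarrow> Prd_ret M A i n w = mark_prod (marks w) (ret_sum i n (marks w))"
  by (simp add: Prd_ret_def tau_eq Prd_eq)

lemma Prd_ret_1_eq: "hits i (marks w) \<Longrightarrow> Prd_ret M A i 1 w = mark_prod (marks w) (ret_time i (marks w))"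
  unfolding Prd_ret_def tau_1_eq by (simp add: Prd_eq)

lemma S_ret_eq: "hits i (marks w) \<Longrightarrow> S_ret M A i w = block_log i (marks w)"
  by (simp only: S_ret_def block_log_def Prd_ret_1_eq)

lemma W_eq:
  assumes "hits i (marks w)"
  shows "W M A B i w = block_max i (marks w)"
proof -
  have "{\<bar>Prd A (k - 1) w * B k w\<bar> |k. 1 \<le> k \<and> enat k \<le> enat (ret_time i (marks w))}
    = (\<lambda>k. \<bar>mark_term (marks w) k\<bar>) ` {..<ret_time i (marks w)}" (is "?L = ?R")
  proof
    show "?L \<subseteq> ?R"
    proof
      fix v assume "v \<in> ?L"
      then obtain k where k: "v = \<bar>Prd A (k - 1) w * B k w\<bar>" "1 \<le> k" "k \<le> ret_time i (marks w)" by auto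
      then have "v = \<bar>mark_term (marks w) (k - 1)\<bar>"
        by (simp add: perp_term_eq[symmetric] perp_term_def)
      moreover have "k - 1 \<in> {..<ret_time i (marks w)}" using k by auto
      ultimately show "v \<in> ?R" by blast
    qed
    show "?R \<subseteq> ?L"
    proof
      fix v assume "v \<in> ?R"
      then obtain k where k: "v = \<bar>mark_term (marks w) k\<bar>" "k < ret_time i (marks w)" by auto
      then have "v = \<bar>Prd A (Suc k - 1) w * B (Suc k) w\<bar>"
        by (simp add: perp_term_eq[symmetric] perp_term_def)
      then show "v \<in> ?L" using k by (intro CollectI exI[of _ "Suc k"]) auto
    qed
  qed
  then show ?thesis unfolding W_def block_max_def tau_1_eq[OF assms] by (rule arg_cong)
qed

lemma AE_P_hits: "AE w in P j. hits i (marks w)"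
  by (rule AE_Q_D[OF AE_hits])

lemma AE_P_recurs: "AE w in P j. recurs i (marks w)"
  by (rule AE_Q_D[OF AE_recurs])

text \<open>Without a return \<open>the_enat\<close> yields an unspecified but fixed index, so the
  product is measurable on that event too.\<close>

lemma measurable_Prd_ret_1: "Prd_ret M A i 1 \<in> borel_measurable N"
proof -
  have "Prd_ret M A i 1 w = (if hits i (marks w) then mark_prod (marks w) (ret_time i (marks w))
      else mark_prod (marks w) (the_enat \<infinity>))" for w
    using Prd_ret_1_eq tau_1_eq_infinity by (auto simp: Prd_ret_def Prd_eq)
  then have "Prd_ret M A i 1 = (\<lambda>x. if hits i x then mark_prod x (ret_time i x)
      else mark_prod x (the_enat \<infinity>)) \<circ> marks"
    by (auto simp: fun_eq_iff)
  moreover have "(\<lambda>x. mark_prod x (ret_time i x)) \<in> borel_measurable mark_seqs"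
    by (rule measurable_compose_countable[OF _ measurable_ret_time]) measurable
  then have "(\<lambda>x. if hits i x then mark_prod x (ret_time i x) else mark_prod x (the_enat \<infinity>))
      \<in> borel_measurable mark_seqs"
    by (intro measurable_If) (use measurable_hits in \<open>auto simp: pred_def\<close>)
  ultimately show ?thesis by (simp only: measurable_comp[OF measurable_marks])
qed

text \<open>\<open>\<pi>\<close> is invariant under all n-step kernels, and irreducibility leads
  from any state of its support to i. Positivity everywhere makes null sets of the mixture null for
  every \<open>P i\<close>.\<close>

lemma pmf_stationary_pos: "pmf \<pi> i > 0"
proof -
  have inv: "bind_pmf \<pi> (nstep p n) = \<pi>" for n
  proof (induction n)
    case 0
    then show ?case by (simp add: bind_return_pmf')
  next
    case (Suc n)
    have "bind_pmf \<pi> (nstep p (Suc n)) = bind_pmf \<pi> (\<lambda>i. bind_pmf (nstep p n i) p)"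
      by (rule bind_pmf_cong) simp_all
    also have "\<dots> = bind_pmf (bind_pmf \<pi> (nstep p n)) p"
      by (rule bind_assoc_pmf[symmetric])
    finally show ?case by (simp only: Suc stationary)
  qed
  obtain j where j: "j \<in> set_pmf \<pi>" using set_pmf_not_empty[of \<pi>] by blast
  obtain n where "pmf (nstep p n j) i > 0"
    using irreducible by (auto simp: irreducible_chain_def)
  then have "i \<in> set_pmf (nstep p n j)" by (simp add: set_pmf_iff)
  then have "i \<in> set_pmf (bind_pmf \<pi> (nstep p n))" using j by auto
  then have "i \<in> set_pmf \<pi>" by (simp only: inv)
  then show ?thesis by (rule pmf_positive)
qed

lemma kernel_P: "P \<in> measure_pmf \<pi> \<rightarrow>\<^sub>M subprob_algebra N"
proof -
  have "P i \<in> space (subprob_algebra N)" for i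
    by (simp add: space_subprob_algebra sets_P prob_space_imp_subprob_space prob_space_P)
  then show ?thesis by simp
qed

lemma sets_P_mix: "sets (P_mix \<pi> P) = sets N"
  unfolding P_mix_def by (rule sets_bind) (auto simp: sets_P)

lemma space_P_mix: "space (P_mix \<pi> P) = space N"
  using sets_eq_imp_space_eq[OF sets_P_mix] .

lemma emeasure_P_mix:
  "U \<in> sets N \<Longrightarrow> emeasure (P_mix \<pi> P) U = (\<integral>\<^sup>+i. emeasure (P i) U \<partial>measure_pmf \<pi>)"
  unfolding P_mix_def by (rule emeasure_bind[OF _ kernel_P]) auto

lemma null_P_mix_iff:
  assumes "U \<in> sets N"
  shows "emeasure (P_mix \<pi> P) U = 0 \<longleftrightarrow> (\<forall>i. emeasure (P i) U = 0)"
proof -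
  have "emeasure (P_mix \<pi> P) U = 0 \<longleftrightarrow> (AE i in measure_pmf \<pi>. emeasure (P i) U = 0)"
    unfolding emeasure_P_mix[OF assms] by (subst nn_integral_0_iff_AE) auto
  also have "\<dots> \<longleftrightarrow> (\<forall>i. emeasure (P i) U = 0)"
    using pmf_stationary_pos by (auto simp: AE_measure_pmf_iff set_pmf_iff less_le)
  finally show ?thesis .
qed

text \<open>For non-measurable \<open>F\<close>, intersect the null sets belonging to the countably many \<open>P i\<close>.\<close>

lemma AE_P_mix_iff: "(AE w in P_mix \<pi> P. F w) \<longleftrightarrow> (\<forall>i. AE w in P i. F w)"
proof
  assume "AE w in P_mix \<pi> P. F w"
  then obtain U where U: "{w \<in> space N. \<not> F w} \<subseteq> U" "emeasure (P_mix \<pi> P) U = 0" "U \<in> sets N"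
    by (elim AE_E) (auto simp: sets_P_mix space_P_mix)
  show "\<forall>i. AE w in P i. F w"
  proof
    fix i
    show "AE w in P i. F w"
      by (rule AE_I[of _ _ U]) (use U null_P_mix_iff in \<open>auto simp: sets_P\<close>)
  qed
next
  assume "\<forall>i. AE w in P i. F w"
  then have "\<forall>i. \<exists>U. {w \<in> space N. \<not> F w} \<subseteq> U \<and> emeasure (P i) U = 0 \<and> U \<in> sets N"
    by (metis AE_E sets_P space_P)
  then obtain U where U: "\<And>i. {w \<in> space N. \<not> F w} \<subseteq> U i" "\<And>i. emeasure (P i) (U i) = 0" "\<And>i. U i \<in> sets N"
    by metis
  define V where "V = (\<Inter>i. U i)"
  have V: "V \<in> sets N" unfolding V_def using U(3) by (intro sets.countable_INT') auto
  have "emeasure (P i) V = 0" for i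
  proof -
    have "emeasure (P i) V \<le> emeasure (P i) (U i)"
      unfolding V_def by (rule emeasure_mono) (use U(3) in \<open>auto simp: sets_P\<close>)
    then show ?thesis using U(2)[of i] by simp
  qed
  then have "emeasure (P_mix \<pi> P) V = 0" using V by (simp add: null_P_mix_iff)
  then show "AE w in P_mix \<pi> P. F w"
    by (intro AE_I[of _ _ V]) (use U(1) V in \<open>auto simp: V_def sets_P_mix space_P_mix\<close>)
qed

lemma prob_space_P_mix: "prob_space (P_mix \<pi> P)"
proof
  have "emeasure (P_mix \<pi> P) (space N) = (\<integral>\<^sup>+i. emeasure (P i) (space N) \<partial>measure_pmf \<pi>)"
    by (rule emeasure_P_mix) simp
  also have "\<dots> = (\<integral>\<^sup>+i. 1 \<partial>measure_pmf \<pi>)"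
    using prob_space.emeasure_space_1[OF prob_space_P] by simp
  finally show "emeasure (P_mix \<pi> P) (space (P_mix \<pi> P)) = 1"
    by (simp add: space_P_mix measure_pmf.emeasure_space_1[simplified])
qed

text \<open>The hypothesis concerns the first factor only, but for every initial state. By the
  Markov property the n-th factor is the first one of a chain started in the state at time
  n.\<close>

lemma AE_nonzero_marks:
  assumes "measure (P_mix \<pi> P) {w \<in> space (P_mix \<pi> P). A 1 w = 0} = 0"
  shows "AE x in Q i. nonzero_marks x"
proof -
  interpret mix: prob_space "P_mix \<pi> P" by (rule prob_space_P_mix)
  have A1: "A 1 \<in> borel_measurable N" by (rule measurable_A) simp
  have U: "{w \<in> space N. A 1 w = 0} \<in> sets N" using A1 by measurable
  have "emeasure (P_mix \<pi> P) {w \<in> space N. A 1 w = 0} = 0"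
    using assms by (simp add: mix.emeasure_eq_measure space_P_mix)
  then have null: "emeasure (P j) {w \<in> space N. A 1 w = 0} = 0" for j
    using null_P_mix_iff[OF U] by simp
  have pred0: "Measurable.pred mark_seqs (\<lambda>x. fst (snd (x n)) \<noteq> 0)" for n
    by measurable
  have first: "AE x in Q j. fst (snd (x 0)) \<noteq> 0" for j
  proof (subst AE_Q_iff[OF pred0])
    have "AE w in P j. w \<notin> {w \<in> space N. A 1 w = 0}"
      using null U by (intro AE_not_in null_setsI) (auto simp: sets_P)
    then show "AE w in P j. fst (snd (marks w 0)) \<noteq> 0"
      using AE_space[of "P j"] by eventually_elim (simp add: marks_def)
  qed
  have "AE x in Q i. fst (snd (x n)) \<noteq> 0" for n
  proof -
    let ?f = "\<lambda>x. indicator {v. v = 0} (fst (snd (x n))) :: ennreal"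
    have [measurable]: "?f \<in> borel_measurable mark_seqs" by measurable
    have "(\<integral>\<^sup>+x. ?f x \<partial>Q i) = (\<integral>\<^sup>+x. \<integral>\<^sup>+y. ?f (comb_seq n x y) \<partial>Q (state_at i n x) \<partial>Q i)"
      by (rule nn_integral_Q_markov) measurable
    also have "\<dots> = (\<integral>\<^sup>+x. \<integral>\<^sup>+y. 0 \<partial>Q (state_at i n x) \<partial>Q i)"
    proof (rule nn_integral_cong, rule nn_integral_cong_AE)
      fix x
      show "AE y in Q (state_at i n x). ?f (comb_seq n x y) = 0"
        using first[of "state_at i n x"] by eventually_elim (simp add: comb_seq_def)
    qed
    finally have "(\<integral>\<^sup>+x. ?f x \<partial>Q i) = 0" by simp
    moreover have "?f \<in> borel_measurable (Q i)" by (rule measurable_Qf) measurable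
    ultimately have "AE x in Q i. ?f x = 0" by (simp only: nn_integral_0_iff_AE)
    then show ?thesis by eventually_elim (auto split: split_indicator_asm)
  qed
  then show ?thesis by (simp add: nonzero_marks_def AE_all_countable)
qed

text \<open>The return blocks cover all indices and the products do not vanish, so zero block maxima
  force every B along the path from i to be 0. Each state j is reached with positive probability, so
  \<open>B 1\<close> would vanish under every \<open>P j\<close>.\<close>

lemma not_AE_block_max_zero:
  assumes nz: "AE x in Q i. nonzero_marks x"
    and B: "measure (P_mix \<pi> P) {w \<in> space (P_mix \<pi> P). B 1 w = 0} < 1"
  shows "\<not> (AE x in Q i. block_max i x \<le> 0)"
proof
  assume zero: "AE x in Q i. block_max i x \<le> 0"
  interpret mix: prob_space "P_mix \<pi> P" by (rule prob_space_P_mix)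
  have B1: "B 1 \<in> borel_measurable N" by (rule measurable_B) simp
  have U: "{w \<in> space N. B 1 w = 0} \<in> sets N" using B1 by measurable
  have all_zero: "AE x in Q i. \<forall>n. snd (snd (x n)) = 0"
    using AE_iterates[OF zero] nz
  proof eventually_elim
    case (elim x)
    show ?case
    proof
      fix k
      obtain n r where nr: "k = ret_sum i n x + r" "r < ret_time i (after_ret i n x)"
        using ret_sum_cover by metis
      have "\<bar>mark_term (after_ret i n x) r\<bar> \<le> block_max i (after_ret i n x)"
        by (rule block_max_ge[OF nr(2)])
      also have "\<dots> \<le> 0" using elim(1)[rule_format, of n] by (simp only: drop_random_funpow)
      finally have "mark_term (after_ret i n x) r = 0" by simp
      then show "snd (snd (x k)) = 0"
        using mark_prod_nonzero[OF nonzero_marks_drop_seq[OF elim(2)]]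
        by (simp add: mark_term_def drop_seq_apply nr(1))
    qed
  qed
  have pred: "Measurable.pred mark_seqs (\<lambda>x. snd (snd (x 0)) = 0)" by measurable
  have "AE w in P j. B 1 w = 0" for j
  proof -
    obtain n where n: "pmf (nstep p n i) j > 0"
      using irreducible by (auto simp: irreducible_chain_def)
    have "AE x in Q j. snd (snd (x 0)) = 0"
      by (rule AE_state_event[OF pred _ n]) (use all_zero in eventually_elim, simp add: drop_seq_apply)
    from AE_Q_D[OF this] show ?thesis by (simp add: marks_def)
  qed
  then have "AE w in P_mix \<pi> P. B 1 w = 0" by (simp add: AE_P_mix_iff)
  then have "AE w in P_mix \<pi> P. w \<in> {w \<in> space N. B 1 w = 0}"
    using AE_space[of "P_mix \<pi> P"] by eventually_elim (simp add: space_P_mix)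
  then have "mix.prob {w \<in> space N. B 1 w = 0} = 1"
    using U by (subst mix.prob_eq_1) (simp_all add: sets_P_mix)
  then show False using B by (simp add: space_P_mix)
qed

text \<open>The assumption rules out the degenerate branch of \<open>J\<close>; the remaining
  branches depend on the law of the block walk only.\<close>

lemma J_eq_erickson:
  assumes drift: "\<not> (AE x in Q i. block_log i x \<le> 0)"
  shows "J P M A i y = erickson (block_law i (block_max i)) y"
proof -
  interpret prob_space "P i" by (rule prob_space_P)
  have lt: "measure (P i) {w \<in> space (P i). S_ret M A i w \<le> 0} < 1" (is "prob ?U < 1")
  proof (rule ccontr)
    assume "\<not> ?thesis"
    then have one: "prob ?U = 1" using prob_le_1[of ?U] by linarith
    \<comment> \<open>\<open>measure\<close> is 0 off the sigma-algebra, so a set of measure 1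
      belongs to it.\<close>
    then have "?U \<in> events" using measure_notin_sets[of ?U "P i"] by fastforce
    then have "AE w in P i. w \<in> ?U" using one by (subst (asm) prob_eq_1) simp_all
    then have "AE w in P i. block_log i (marks w) \<le> 0"
      using AE_P_hits[of i i] by eventually_elim (simp add: S_ret_eq)
    then show False using drift by (simp add: AE_Q_iff)
  qed
  have "(\<integral>w. min (max (S_ret M A i w) 0) y \<partial>P i) = trunc_mean (block_law i (block_max i)) y"
  proof -
    have S: "S_ret M A i \<in> borel_measurable N"
      unfolding S_ret_def[abs_def] using measurable_Prd_ret_1 by measurable
    have meas: "(\<lambda>x. min (max (block_log i x) 0) y) \<in> borel_measurable mark_seqs"
      by measurable
    have "(\<integral>w. min (max (S_ret M A i w) 0) y \<partial>P i)
      = (\<integral>w. min (max (block_log i (marks w)) 0) y \<partial>P i)"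
    proof (rule integral_cong_AE)
      show "(\<lambda>w. min (max (S_ret M A i w) 0) y) \<in> borel_measurable (P i)"
        by (rule measurable_P) (use S in measurable)
      show "(\<lambda>w. min (max (block_log i (marks w)) 0) y) \<in> borel_measurable (P i)"
        by (rule measurable_P) (rule measurable_compose[OF measurable_marks meas])
      show "AE w in P i. min (max (S_ret M A i w) 0) y = min (max (block_log i (marks w)) 0) y"
        using AE_P_hits[of i i] by eventually_elim (simp only: S_ret_eq)
    qed
    also have "\<dots> = (\<integral>x. min (max (block_log i x) 0) y \<partial>Q i)"
      unfolding Q_def by (rule integral_distr[OF measurable_P[OF measurable_marks] meas, symmetric])
    finally show ?thesis by (simp only: trunc_mean_block_law[OF block_fun_max])
  qed
  then show ?thesis using lt by (simp add: J_def erickson_def)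
qed

lemma J_moment_eq:
  assumes "\<not> (AE x in Q i. block_log i x \<le> 0)"
  shows "J_moment P M A B i
    = (\<integral>\<^sup>+x. ennreal (erickson (block_law i (block_max i)) (log_plus (block_max i x))) \<partial>Q i)"
proof -
  let ?J = "erickson (block_law i (block_max i))"
  have m: "(\<lambda>x. ennreal (?J (log_plus (block_max i x)))) \<in> borel_measurable mark_seqs"
  proof -
    interpret iid_pairs "block_law i (block_max i)" by (rule iid_block_law[OF block_fun_max])
    interpret iid_pairs_pos "block_law i (block_max i)"
      by unfold_locales (use assms AE_block_law_fst[OF block_fun_max, where R = "\<lambda>v. v \<le> 0"] in simp)
    show ?thesis using measurable_block_fun[OF block_fun_max] by measurable
  qed
  have "J_moment P M A B i = (\<integral>\<^sup>+w. ennreal (?J (log_plus (block_max i (marks w)))) \<partial>P i)"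
    unfolding J_moment_def J_eq_erickson[OF assms]
    by (rule nn_integral_cong_AE) (use AE_P_hits[of i i] in eventually_elim, simp only: W_eq)
  also have "\<dots> = (\<integral>\<^sup>+x. ennreal (?J (log_plus (block_max i x))) \<partial>Q i)"
    unfolding Q_def by (rule nn_integral_distr[OF measurable_P[OF measurable_marks], symmetric]) (use m in simp)
  finally show ?thesis .
qed

lemma not_nonpos_of_drift:
  assumes nz: "AE x in Q i. nonzero_marks x"
    and drift: "AE x in Q i. (\<lambda>n. ret_prod i n x) \<longlonglongrightarrow> 0"
  shows "\<not> (AE x in Q i. block_log i x \<le> 0)"
proof -
  interpret iid_pairs "block_law i (block_max i)" by (rule iid_block_law[OF block_fun_max])
  have "\<not> (AE z in block_law i (block_max i). fst z \<le> 0)"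
    using AE_psum_at_top_iff_ret[OF nz block_fun_max] drift by (intro psum_at_top_not_nonpos) simp
  then show ?thesis using AE_block_law_fst[OF block_fun_max, where R = "\<lambda>v. v \<le> 0"] by simp
qed

lemma Psi_back_eq: "Psi_back A B n w z = Prd A n w * z + (\<Sum>k<n. perp_term A B k w)"
proof (induction n arbitrary: z)
  case 0
  then show ?case by (simp add: Prd_def)
next
  case (Suc n)
  have "Prd A (Suc n) w = Prd A n w * A (Suc n) w" by (simp add: Prd_def)
  then show ?case using Suc by (simp add: Psi_def perp_term_def algebra_simps)
qed

lemma measurable_Z_inf: "Z_inf A B \<in> borel_measurable N"
proof -
  have "(\<lambda>w. mark_term (marks w) n) \<in> borel_measurable N" for n
    by (rule measurable_compose[OF measurable_marks]) measurable
  then show ?thesis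
    unfolding Z_inf_def[abs_def] perp_term_eq by (intro borel_measurable_suminf)
qed

text \<open>A constant generates the trivial sigma-algebra. The constants 0 and 1 are the starting
  points from which the products are recovered.\<close>

lemma admissible_const: "admissible N P M A B (\<lambda>_. c)"
proof -
  have "prob_space.indep_set (P i)
        (sets (vimage_algebra (space N) (\<lambda>_. c) borel))
        (sets (vimage_algebra (space N) (\<lambda>w n. (M (Suc n) w, A (Suc n) w, B (Suc n) w)) mark_seqs))" for i
  proof -
    interpret prob_space "P i" by (rule prob_space_P)
    have eq: "(\<lambda>w n. (M (Suc n) w, A (Suc n) w, B (Suc n) w)) = marks"
      by (simp add: marks_def fun_eq_iff)
    have trivial: "U = {} \<or> U = space N" if "U \<in> sets (vimage_algebra (space N) (\<lambda>_. c) borel)" for U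
      using that by (auto simp: sets_vimage_algebra2 split: if_splits)
    have marks_events: "V \<in> events" if "V \<in> sets (vimage_algebra (space N) marks mark_seqs)" for V
      using that measurable_sets[OF measurable_marks] by (auto simp: sets_vimage_algebra2 sets_P)
    show ?thesis
      unfolding eq indep_sets2_eq
    proof (intro conjI ballI)
      show "sets (vimage_algebra (space N) (\<lambda>_. c) borel) \<subseteq> events"
        using trivial sets.top[of "P i"] by fastforce
      show "sets (vimage_algebra (space N) marks mark_seqs) \<subseteq> events"
        using marks_events by blast
      fix U V assume U: "U \<in> sets (vimage_algebra (space N) (\<lambda>_. c) borel)"
        and V: "V \<in> sets (vimage_algebra (space N) marks mark_seqs)"
      have "V \<subseteq> space N" using sets.sets_into_space[OF marks_events[OF V]] by simp
      then show "prob (U \<inter> V) = prob U * prob V"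
        using trivial[OF U] prob_space by (auto simp: Int_absorb1)
    qed
  qed
  then show ?thesis by (simp add: admissible_def)
qed

end

lemma tendsto_zero_iff_nat:
  fixes f :: "nat \<Rightarrow> real"
  shows "f \<longlonglongrightarrow> 0 \<longleftrightarrow> (\<forall>m::nat. \<exists>N. \<forall>n\<ge>N. \<bar>f n\<bar> < 1 / real (Suc m))"
proof
  assume f: "f \<longlonglongrightarrow> 0"
  show "\<forall>m::nat. \<exists>N. \<forall>n\<ge>N. \<bar>f n\<bar> < 1 / real (Suc m)"
  proof
    fix m :: nat
    have "0 < 1 / real (Suc m)" by simp
    from LIMSEQ_D[OF f this] show "\<exists>N. \<forall>n\<ge>N. \<bar>f n\<bar> < 1 / real (Suc m)" by simp
  qed
next
  assume *: "\<forall>m::nat. \<exists>N. \<forall>n\<ge>N. \<bar>f n\<bar> < 1 / real (Suc m)"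
  show "f \<longlonglongrightarrow> 0"
  proof (rule LIMSEQ_I)
    fix r :: real assume "0 < r"
    then obtain m where m: "1 / real (Suc m) < r" using nat_approx_posE by blast
    obtain N where "\<forall>n\<ge>N. \<bar>f n\<bar> < 1 / real (Suc m)" using * by blast
    then show "\<exists>N. \<forall>n\<ge>N. norm (f n - 0) < r"
      using m by (intro exI[of _ N]) (auto intro: less_trans)
  qed
qed

section \<open>Change of the initial state and passage between P and Q\<close>

context markov_modulated
begin

text \<open>Pulling an almost sure statement back to \<open>Q i\<close> takes a measurable event, so
  the limit is rewritten as divergence of the block walk for the passage.\<close>

lemma AE_Q_Prd_ret:
  assumes "AE w in P i. (\<lambda>n. Prd_ret M A i n w) \<longlonglongrightarrow> 0" and nz: "AE x in Q i. nonzero_marks x"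
  shows "AE x in Q i. (\<lambda>n. ret_prod i n x) \<longlonglongrightarrow> 0"
proof -
  have "AE w in P i. filterlim (psum (block_seq i (block_max i) (marks w))) at_top sequentially"
    using assms(1) AE_P_recurs[of i i] AE_Q_D[OF nz]
    by eventually_elim (simp add: psum_block_seq_at_top_iff Prd_ret_eq)
  moreover have "Measurable.pred mark_seqs (\<lambda>x. filterlim (psum (block_seq i (block_max i) x)) at_top sequentially)"
  proof -
    have "block_seq i (block_max i) \<in> mark_seqs \<rightarrow>\<^sub>M (\<Pi>\<^sub>M k\<in>UNIV. borel)"
      using measurable_block_seq[OF block_fun_max] by (simp cong: measurable_cong_sets)
    moreover have "(\<lambda>y. psum y n) \<in> borel_measurable (\<Pi>\<^sub>M k\<in>UNIV. (borel :: (real \<times> real) measure))" for n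
      unfolding psum_def borel_prod[symmetric] by measurable
    ultimately have [measurable]: "(\<lambda>x. psum (block_seq i (block_max i) x) n) \<in> borel_measurable mark_seqs" for n
      by (rule measurable_compose)
    show ?thesis unfolding filterlim_at_top_iff_nat by measurable
  qed
  ultimately have "AE x in Q i. filterlim (psum (block_seq i (block_max i) x)) at_top sequentially"
    by (simp add: AE_Q_iff)
  with nz show ?thesis by eventually_elim (simp add: psum_block_seq_at_top_iff)
qed

text \<open>From j, the first visit to i contributes a constant factor, and the returns counted
  afterwards are those of a path started in i.\<close>

lemma AE_P_Prd_ret:
  assumes "AE x in Q i. (\<lambda>n. ret_prod i n x) \<longlonglongrightarrow> 0"
  shows "AE w in P j. (\<lambda>n. Prd_ret M A i n w) \<longlonglongrightarrow> 0"
proof -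
  have "AE x in Q j. (\<lambda>n. ret_prod i n x) \<longlonglongrightarrow> 0"
    using AE_after_return[OF assms, of j] AE_hits[of i j]
  proof eventually_elim
    case (elim x)
    let ?t = "ret_time i x"
    have "ret_sum i (Suc n) x = ?t + ret_sum i n (drop_seq ?t x)" for n
      by (induction n) (simp_all add: drop_seq_drop_seq add.assoc)
    then have "mark_prod x (ret_sum i (Suc n) x)
        = mark_prod x ?t * mark_prod (drop_seq ?t x) (ret_sum i n (drop_seq ?t x))" for n
      by (simp only: mark_prod_add)
    moreover have "(\<lambda>n. mark_prod x ?t * mark_prod (drop_seq ?t x) (ret_sum i n (drop_seq ?t x))) \<longlonglongrightarrow> 0"
      using elim by (intro tendsto_mult_right_zero) (simp add: drop_random_def)
    ultimately have "(\<lambda>n. mark_prod x (ret_sum i (Suc n) x)) \<longlonglongrightarrow> 0" by (simp only:)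
    then show ?case by (rule LIMSEQ_imp_Suc)
  qed
  from AE_Q_D[OF this] AE_P_recurs[of i j] show ?thesis
    by eventually_elim (simp add: Prd_ret_eq)
qed

lemma AE_P_summable:
  assumes "AE x in Q i. summable (\<lambda>n. \<bar>mark_term x n\<bar>)"
  shows "AE w in P j. summable (\<lambda>n. \<bar>perp_term A B n w\<bar>)"
proof -
  have "AE x in Q j. summable (\<lambda>n. \<bar>mark_term x n\<bar>)"
    using AE_after_return[OF assms, of j] AE_hits[of i j]
  proof eventually_elim
    case (elim x)
    let ?t = "ret_time i x"
    have "summable (\<lambda>n. \<bar>mark_prod x ?t\<bar> * \<bar>mark_term (drop_seq ?t x) n\<bar>)"
      using elim by (intro summable_mult) (simp add: drop_random_def)
    then have "summable (\<lambda>n. \<bar>mark_term x (n + ?t)\<bar>)"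
      by (simp add: mark_term_add add.commute[of _ ?t] abs_mult)
    then show ?case by (subst (asm) summable_iff_shift)
  qed
  from AE_Q_D[OF this] show ?thesis by (simp add: perp_term_eq)
qed

lemma summable_of_cond_b:
  assumes nz: "AE x in Q i. nonzero_marks x"
    and drift: "AE w in P i. (\<lambda>n. Prd_ret M A i n w) \<longlonglongrightarrow> 0"
    and moment: "J_moment P M A B i < \<infinity>"
  shows "AE w in P j. summable (\<lambda>n. \<bar>perp_term A B n w\<bar>)"
proof -
  have d: "AE x in Q i. (\<lambda>n. ret_prod i n x) \<longlonglongrightarrow> 0"
    by (rule AE_Q_Prd_ret[OF drift nz])
  show ?thesis
    using moment J_moment_eq[OF not_nonpos_of_drift[OF nz d]]
    by (intro AE_P_summable[OF summable_of_moment[OF nz d]]) simp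
qed

lemma block_log_zero_iff:
  assumes "nonzero_marks (marks w)" "hits i (marks w)"
  shows "block_log i (marks w) = 0 \<longleftrightarrow> \<bar>Prd_ret M A i 1 w\<bar> = 1"
  using mark_prod_nonzero[OF assms(1), of "ret_time i (marks w)"]
  unfolding block_log_def Prd_ret_1_eq[OF assms(2)] by simp

lemma prob_Prd_ret_one_iff:
  assumes nz: "AE x in Q i. nonzero_marks x"
  shows "measure (P i) {w \<in> space (P i). \<bar>Prd_ret M A i 1 w\<bar> = 1} < 1
    \<longleftrightarrow> \<not> (AE x in Q i. block_log i x = 0)"
proof -
  interpret prob_space "P i" by (rule prob_space_P)
  let ?U = "{w \<in> space (P i). \<bar>Prd_ret M A i 1 w\<bar> = 1}"
  have U: "?U \<in> events"
  proof -
    have [measurable]: "Prd_ret M A i 1 \<in> borel_measurable (P i)"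
      by (rule measurable_P[OF measurable_Prd_ret_1])
    show ?thesis by measurable
  qed
  have "(AE x in Q i. block_log i x = 0) \<longleftrightarrow> (AE w in P i. block_log i (marks w) = 0)"
    by (rule AE_Q_iff) measurable
  also have "\<dots> \<longleftrightarrow> (AE w in P i. w \<in> ?U)"
  proof
    assume "AE w in P i. block_log i (marks w) = 0"
    with AE_Q_D[OF nz] AE_P_hits[of i i] AE_space[of "P i"] show "AE w in P i. w \<in> ?U"
      by eventually_elim (simp only: block_log_zero_iff mem_Collect_eq)
  next
    assume "AE w in P i. w \<in> ?U"
    with AE_Q_D[OF nz] AE_P_hits[of i i] show "AE w in P i. block_log i (marks w) = 0"
      by eventually_elim (simp only: block_log_zero_iff mem_Collect_eq)
  qed
  also have "\<dots> \<longleftrightarrow> prob ?U = 1" by (rule prob_eq_1[OF U, symmetric])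
  finally show ?thesis using prob_le_1[of ?U] by linarith
qed

lemma cond_b_of_bounded:
  assumes nz: "AE x in Q i. nonzero_marks x"
    and nonzero: "\<not> (AE x in Q i. block_max i x \<le> 0)"
    and nontrivial: "measure (P i) {w \<in> space (P i). \<bar>Prd_ret M A i 1 w\<bar> = 1} < 1"
    and bounded: "AE w in P i. limsup (\<lambda>n. ereal \<bar>perp_term A B n w\<bar>) < \<infinity>"
  shows "AE w in P j. (\<lambda>n. Prd_ret M A i n w) \<longlonglongrightarrow> 0" and "J_moment P M A B i < \<infinity>"
proof -
  have pred: "Measurable.pred mark_seqs (\<lambda>x. \<exists>c::nat. \<forall>n. \<bar>mark_term x n\<bar> \<le> real c)"
    by measurable
  have b: "AE x in Q i. \<exists>c::nat. \<forall>n. \<bar>mark_term x n\<bar> \<le> real c"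
    unfolding AE_Q_iff[OF pred] using bounded
    by eventually_elim (rule real_le_limit_of_bounded, simp only: perp_term_eq)
  have nt: "\<not> (AE x in Q i. block_log i x = 0)"
    using nontrivial prob_Prd_ret_one_iff[OF nz] by simp
  have d: "AE x in Q i. (\<lambda>n. ret_prod i n x) \<longlonglongrightarrow> 0"
    by (rule moment_of_bounded(1)[OF nz b nt nonzero])
  show "AE w in P j. (\<lambda>n. Prd_ret M A i n w) \<longlonglongrightarrow> 0"
    by (rule AE_P_Prd_ret[OF d])
  show "J_moment P M A B i < \<infinity>"
    unfolding J_moment_eq[OF not_nonpos_of_drift[OF nz d]] by (rule moment_of_bounded(2)[OF nz b nt nonzero])
qed

lemma cond_c_of_tendsto_zero:
  assumes nz: "AE x in Q i. nonzero_marks x"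
    and nonzero: "\<not> (AE x in Q i. block_max i x \<le> 0)"
    and tendsto: "AE w in P i. (\<lambda>n. perp_term A B n w) \<longlonglongrightarrow> 0"
  shows "measure (P i) {w \<in> space (P i). \<bar>Prd_ret M A i 1 w\<bar> = 1} < 1"
proof -
  have pred: "Measurable.pred mark_seqs (\<lambda>x. (\<lambda>n. mark_term x n) \<longlonglongrightarrow> 0)"
  proof -
    have "(\<lambda>n. mark_term x n) \<longlonglongrightarrow> 0 \<longleftrightarrow> (\<forall>m::nat. \<exists>N. \<forall>n\<ge>N. \<bar>mark_term x n\<bar> < 1 / real (Suc m))"
      for x :: "nat \<Rightarrow> 's mark"
      by (rule tendsto_zero_iff_nat)
    then show ?thesis by simp
  qed
  have t: "AE x in Q i. (\<lambda>n. mark_term x n) \<longlonglongrightarrow> 0"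
    unfolding AE_Q_iff[OF pred] using tendsto by (simp only: perp_term_eq)
  show ?thesis
    unfolding prob_Prd_ret_one_iff[OF nz] by (rule nontrivial_of_tendsto_zero[OF nz t nonzero])
qed

lemma Prd_ret_of_Prd:
  assumes "recurs i (marks w)" "(\<lambda>n. Prd A n w) \<longlonglongrightarrow> 0"
  shows "(\<lambda>n. Prd_ret M A i n w) \<longlonglongrightarrow> 0"
proof -
  have "filterlim (\<lambda>n. ret_sum i n (marks w)) at_top sequentially"
    by (rule filterlim_at_top_mono[OF filterlim_ident]) (simp add: ret_sum_ge)
  then have "(\<lambda>n. Prd A (ret_sum i n (marks w)) w) \<longlonglongrightarrow> 0"
    by (rule filterlim_compose[OF assms(2)])
  then show ?thesis by (simp add: Prd_ret_eq[OF assms(1)] Prd_eq)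
qed

text \<open>Convergence along the return times does not make the whole product sequence converge; it
  identifies a limit already known to exist.\<close>

lemma Prd_limit_unique:
  assumes "recurs i (marks w)" "(\<lambda>n. Prd A n w) \<longlonglongrightarrow> l" "(\<lambda>n. Prd_ret M A i n w) \<longlonglongrightarrow> 0"
  shows "l = 0"
proof -
  have "filterlim (\<lambda>n. ret_sum i n (marks w)) at_top sequentially"
    by (rule filterlim_at_top_mono[OF filterlim_ident]) (simp add: ret_sum_ge)
  then have "(\<lambda>n. Prd A (ret_sum i n (marks w)) w) \<longlonglongrightarrow> l"
    by (rule filterlim_compose[OF assms(2)])
  then have "(\<lambda>n. Prd_ret M A i n w) \<longlonglongrightarrow> l" by (simp add: Prd_ret_eq[OF assms(1)] Prd_eq)
  then show ?thesis using assms(3) by (rule LIMSEQ_unique)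
qed

end

section \<open>The cycle of implications and arbitrary starting points\<close>

theorem theorem3p1:
  fixes N :: "'w measure"
    and P :: "'s::countable \<Rightarrow> 'w measure"
    and M :: "nat \<Rightarrow> 'w \<Rightarrow> 's"
    and A B :: "nat \<Rightarrow> 'w \<Rightarrow> real"
    and p :: "'s \<Rightarrow> 's pmf"
    and K :: "'s \<Rightarrow> 's \<Rightarrow> (real \<times> real) measure"
    and \<pi> :: "'s pmf"
  defines "P\<pi> \<equiv> P_mix \<pi> P"
  defines "cond_a \<equiv> AE \<omega> in P\<pi>.
      (\<lambda>n. Psi_back A B n \<omega> 0) \<longlonglongrightarrow> Z_inf A B \<omega> \<and> (\<lambda>n. perp_term A B n \<omega>) sums Z_inf A B \<omega>"
    and "cond_b \<equiv> \<lambda>i. (AE \<omega> in P\<pi>. (\<lambda>n. Prd_ret M A i n \<omega>) \<longlonglongrightarrow> 0) \<and> J_moment P M A B i < \<infinity>"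
    and "cond_c \<equiv> \<lambda>i. measure (P i) {\<omega> \<in> space (P i). \<bar>Prd_ret M A i 1 \<omega>\<bar> = 1} < 1 \<and>
      (AE \<omega> in P\<pi>. limsup (\<lambda>n. ereal \<bar>perp_term A B n \<omega>\<bar>) < \<infinity>)"
    and "cond_d \<equiv> AE \<omega> in P\<pi>. (\<lambda>n. perp_term A B n \<omega>) \<longlonglongrightarrow> 0"
    and "cond_e \<equiv> AE \<omega> in P\<pi>. summable (\<lambda>n. \<bar>perp_term A B n \<omega>\<bar>)"
    and "cond_f \<equiv> \<lambda>i. (AE \<omega> in P\<pi>. (\<lambda>n. Prd A n \<omega>) \<longlonglongrightarrow> 0) \<and> J_moment P M A B i < \<infinity>"
    and "conv_all \<equiv> \<forall>Z0. admissible N P M A B Z0 \<longrightarrow>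
      (\<exists>Z \<in> borel_measurable N. AE \<omega> in P\<pi>. (\<lambda>n. Psi_back A B n \<omega> (Z0 \<omega>)) \<longlonglongrightarrow> Z \<omega>)"
  assumes "markov_modulated N P M A B p K \<pi>"
    and "measure P\<pi> {\<omega> \<in> space P\<pi>. A 1 \<omega> = 0} = 0"
    and "measure P\<pi> {\<omega> \<in> space P\<pi>. B 1 \<omega> = 0} < 1"
  shows "(cond_a \<longleftrightarrow> (\<exists>i. cond_b i)) \<and> (cond_a \<longleftrightarrow> (\<forall>i. cond_b i)) \<and>
         (cond_a \<longleftrightarrow> (\<exists>i. cond_c i)) \<and> (cond_a \<longleftrightarrow> (\<forall>i. cond_c i)) \<and>
         (cond_a \<longleftrightarrow> cond_d) \<and> (cond_a \<longleftrightarrow> cond_e) \<and>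
         (conv_all \<longleftrightarrow> (\<exists>i. cond_f i)) \<and> (conv_all \<longleftrightarrow> (\<forall>i. cond_f i)) \<and>
         (conv_all \<longrightarrow> (\<forall>Z0. admissible N P M A B Z0 \<longrightarrow>
            (AE \<omega> in P\<pi>. (\<lambda>n. Psi_back A B n \<omega> (Z0 \<omega>)) \<longlonglongrightarrow> Z_inf A B \<omega>)))"
proof -
  interpret markov_modulated N P M A B p K \<pi> by fact
  note AE_iff = AE_P_mix_iff[folded P\<pi>_def]
  \<comment> \<open>The eight defining equations come first among the assumptions, so 10 and 11 are
    the hypotheses on \<open>A 1\<close> and \<open>B 1\<close>.\<close>
  have nz: "AE x in Q i. nonzero_marks x" for i
    using assms(10) unfolding P\<pi>_def by (rule AE_nonzero_marks)
  have nonzero: "\<not> (AE x in Q i. block_max i x \<le> 0)" for i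
    using assms(11) unfolding P\<pi>_def by (rule not_AE_block_max_zero[OF nz])
  \<comment> \<open>The cycle runs (b), (e), (a), (d), (c), (b). It enters the state-free conditions
    from a single state and leaves (d) towards every state, which yields the versions for some and
    for all states together.\<close>
  have b_e: "cond_e" if "cond_b i" for i
    using that unfolding cond_b_def cond_e_def AE_iff by (intro allI summable_of_cond_b[OF nz]) auto
  have e_a: "cond_a" if "cond_e"
    using that unfolding cond_e_def cond_a_def
  proof eventually_elim
    case (elim w)
    have "summable (\<lambda>n. perp_term A B n w)" using elim by (rule summable_rabs_cancel)
    then have "(\<lambda>n. perp_term A B n w) sums Z_inf A B w"
      unfolding Z_inf_def by (rule summable_sums)
    then show ?case by (simp add: sums_def Psi_back_eq)
  qed
  have a_d: "cond_d" if "cond_a"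
    using that unfolding cond_a_def cond_d_def
    by eventually_elim (blast intro: summable_LIMSEQ_zero sums_summable)
  have d_c: "cond_c i" if "cond_d" for i
    unfolding cond_c_def
  proof
    show "measure (P i) {w \<in> space (P i). \<bar>Prd_ret M A i 1 w\<bar> = 1} < 1"
      using that unfolding cond_d_def AE_iff by (intro cond_c_of_tendsto_zero[OF nz nonzero]) auto
    show "AE w in P\<pi>. limsup (\<lambda>n. ereal \<bar>perp_term A B n w\<bar>) < \<infinity>"
      using that unfolding cond_d_def
    proof eventually_elim
      case (elim w)
      then have "(\<lambda>n. ereal \<bar>perp_term A B n w\<bar>) \<longlonglongrightarrow> ereal 0"
        by (intro tendsto_ereal tendsto_rabs_zero)
      then have "limsup (\<lambda>n. ereal \<bar>perp_term A B n w\<bar>) = ereal 0"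
        by (intro lim_imp_Limsup) simp_all
      then show ?case by simp
    qed
  qed
  have c_b: "cond_b i" if "cond_c i" for i
    using that unfolding cond_c_def cond_b_def AE_iff
    by (blast intro: cond_b_of_bounded[OF nz nonzero])
  have f_b: "cond_b i" if "cond_f i" for i
    using that unfolding cond_f_def cond_b_def AE_iff
  proof (elim conjE, intro conjI allI)
    fix j assume "\<forall>j. AE w in P j. (\<lambda>n. Prd A n w) \<longlonglongrightarrow> 0"
    then have "AE w in P j. (\<lambda>n. Prd A n w) \<longlonglongrightarrow> 0" ..
    with AE_P_recurs[of i j] show "AE w in P j. (\<lambda>n. Prd_ret M A i n w) \<longlonglongrightarrow> 0"
      by eventually_elim (rule Prd_ret_of_Prd)
  qed
  have f_limit: "AE w in P\<pi>. (\<lambda>n. Psi_back A B n w (Z0 w)) \<longlonglongrightarrow> Z_inf A B w" if "cond_f i" for i Z0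
  proof -
    have "AE w in P\<pi>. (\<lambda>n. Prd A n w) \<longlonglongrightarrow> 0" using that by (simp add: cond_f_def)
    with e_a[OF b_e[OF f_b[OF that]], unfolded cond_a_def] show ?thesis
    proof eventually_elim
      case (elim w)
      have "(\<lambda>n. Prd A n w * Z0 w + (\<Sum>k<n. perp_term A B k w)) \<longlonglongrightarrow> 0 * Z0 w + Z_inf A B w"
        using elim by (intro tendsto_add tendsto_mult tendsto_const) (simp_all add: sums_def)
      then show ?case by (simp add: Psi_back_eq)
    qed
  qed
  have f_conv: "conv_all" if "cond_f i" for i
    unfolding conv_all_def using f_limit[OF that] measurable_Z_inf by blast
  have conv_f: "cond_f i" if conv: "conv_all" for i
  proof -
    \<comment> \<open>Starting point 0 gives the series and hence (b). The difference between
      starting points 1 and 0 is the product \<open>Prd A n\<close>, which therefore converges; by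
      (b) its limit along the returns is 0.\<close>
    obtain Z where Z: "AE w in P\<pi>. (\<lambda>n. Psi_back A B n w 0) \<longlonglongrightarrow> Z w"
      using conv admissible_const[of 0] unfolding conv_all_def by blast
    obtain Z' where Z': "AE w in P\<pi>. (\<lambda>n. Psi_back A B n w 1) \<longlonglongrightarrow> Z' w"
      using conv admissible_const[of 1] unfolding conv_all_def by blast
    have "cond_a"
      unfolding cond_a_def using Z
    proof eventually_elim
      case (elim w)
      then have "(\<lambda>n. perp_term A B n w) sums Z w" by (simp add: sums_def Psi_back_eq)
      then have "(\<lambda>n. perp_term A B n w) sums Z_inf A B w"
        unfolding Z_inf_def by (intro summable_sums sums_summable)
      then show ?case by (simp add: sums_def Psi_back_eq)
    qed
    then have b: "cond_b i" by (rule c_b[OF d_c[OF a_d]])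
    have "AE w in P\<pi>. recurs i (marks w)" unfolding AE_iff using AE_P_recurs by blast
    with Z Z' b[unfolded cond_b_def, THEN conjunct1] have "AE w in P\<pi>. (\<lambda>n. Prd A n w) \<longlonglongrightarrow> 0"
    proof eventually_elim
      case (elim w)
      have "(\<lambda>n. Psi_back A B n w 1 - Psi_back A B n w 0) \<longlonglongrightarrow> Z' w - Z w"
        using elim by (intro tendsto_diff)
      then have lim: "(\<lambda>n. Prd A n w) \<longlonglongrightarrow> Z' w - Z w" by (simp add: Psi_back_eq)
      then have "Z' w - Z w = 0" using elim by (intro Prd_limit_unique)
      with lim show ?case by simp
    qed
    then show ?thesis using b by (simp add: cond_f_def cond_b_def)
  qed
  show ?thesis
    using b_e e_a a_d d_c c_b f_conv conv_f f_limit by blast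
qed

end
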